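(* The operator $L$ generates a $C_0$-group of operators $T:\mathbb{R}\to B(\mathcal{H})$. Moreover, there exist a number $k\in\mathbb{Z}_+$ and a continuously invertible operator $U\in B(\mathcal{H})$ of the form $U=I+W$ with $W\in\mathfrak{S}_2(\mathcal{H},\mathcal{P})$, such that the group $\widetilde{T}:\mathbb{R}\to B(\mathcal{H})$ given by $\widetilde{T}(t)=U^{-1}T(t)U$, $t\in\mathbb{R}$, satisfies $$\widetilde{T}(t)=\Big(\bigoplus_{\ell=-\infty}^{-k-1}e^{t(\frac{i2\pi\ell}{\omega}I_\ell+B_\ell)}\Big)\oplus e^{tB_{(k)}}\oplus\Big(\bigoplus_{\ell=k+1}^{\infty}e^{t(\frac{i2\pi\ell}{\omega}I_\ell+B_\ell)}\Big),\quad t\in\mathbb{R},$$ (orthogonal direct sum with respect to $\mathcal{H}=\big(\bigoplus_{\ell<-k}\mathcal{H}_\ell\big)\oplus\mathcal{H}_{(k)}\oplus\big(\bigoplus_{\ell>k}\mathcal{H}_\ell\big)$), for some $B_{(k)}\in B(\mathcal{H}_{(k)})$ and $B_\ell\in B(\mathcal{H}_\ell)$, $|\ell|>k$, with $\sum_{|\ell|>k}\|B_\ell\|^2<\infty$.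
   Context: Setting. Let $\omega>0$, let $H$ be a complex Hilbert space, and let $\mathcal{H}=L^2=L^2([0,\omega],H)$ with inner product $\langle x,y\rangle=\frac1\omega\int_0^\omega\langle x(s),y(s)\rangle_H\,ds$. $W_2^1$ is the Sobolev space of continuous functions in $L^2$ with derivative in $L^2$. Let $\mathcal{V}:[0,\omega]\to B(H)$ be strongly measurable with $s\mapsto\mathcal{V}(s)x$ in $L^2$ for every $x\in H$, and let $\widehat{\mathcal{V}}(n)x=\frac1\omega\int_0^\omega\mathcal{V}(s)x\,e^{-i2\pi ns/\omega}ds$, $n\in\mathbb{Z}$. Assume $\sum_{n\in\mathbb{Z}}\|\widehat{\mathcal{V}}(n)\|^2<\infty$ and $\sum_{j,\ell\in\mathbb{Z}}\big\|\sum_{n\neq\ell}\frac{\widehat{\mathcal{V}}(j+n)\widehat{\mathcal{V}}(\ell+n)}{\ell-n}\big\|^2<\infty$. Let $L_0=\frac{d}{ds}$ with domain $D(L_0)=\{y\in W_2^1: y(0)=y(\omega)\}$, $(Vy)(s)=\mathcal{V}(s)y(\omega-s)$ for $y\in D(L_0)$, and $L=L_0-V$ with $D(L)=D(L_0)$. Projections. For $\ell\in\mathbb{Z}$ let $(P_\ell x)(s)=\widehat{x}(\ell)e^{i2\pi\ell s/\omega}$, $\widehat{x}(\ell)=\frac1\omega\int_0^\omega x(\tau)e^{-i2\pi\ell\tau/\omega}d\tau$ (the spectral projections of $L_0$), $\mathcal{H}_\ell=\mathrm{Im}\,P_\ell$, $I_\ell$ the identity on $\mathcal{H}_\ell$,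 $\mathcal{P}=\{P_\ell:\ell\in\mathbb{Z}\}$, and for $m\in\mathbb{Z}_+=\mathbb{N}\cup\{0\}$ let $P_{(m)}=\sum_{|\ell|\le m}P_\ell$, $\mathcal{H}_{(m)}=\mathrm{Im}\,P_{(m)}$. $\mathfrak{S}_2(\mathcal{H},\mathcal{P})$ is the set of $X\in B(\mathcal{H})$ with $\|X\|_{2,\mathcal{P}}^2=\sum_{j,\ell\in\mathbb{Z}}\|P_jXP_\ell\|^2<\infty$ (operator norms inside the sum). *)

theory Defs
  imports "HOL-Analysis.Analysis"
begin

section \<open>Complex Hilbert spaces\<close>

text \<open>The inherited real structure is the underlying real Hilbert space; \<open>cinner\<close> is linear in its
  first argument. Since the norm is the same, a complex-linear map has the same operator norm as
  its underlying real-linear map.\<close>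

class complex_hilbert = real_inner + banach +
  fixes scaleC :: "complex \<Rightarrow> 'a \<Rightarrow> 'a"  (infixr \<open>*\<^sub>C\<close> 75)
    and cinner :: "'a \<Rightarrow> 'a \<Rightarrow> complex"
  assumes scaleC_add_right: "c *\<^sub>C (x + y) = c *\<^sub>C x + c *\<^sub>C y"
    and scaleC_add_left: "(b + c) *\<^sub>C x = b *\<^sub>C x + c *\<^sub>C x"
    and scaleC_scaleC: "b *\<^sub>C c *\<^sub>C x = (b * c) *\<^sub>C x"
    and scaleR_scaleC: "r *\<^sub>R x = complex_of_real r *\<^sub>C x"
    and cinner_commute: "cinner x y = cnj (cinner y x)"
    and cinner_add_left: "cinner (x + y) z = cinner x z + cinner y z"
    and cinner_scaleC_left: "cinner (c *\<^sub>C x) y = c * cinner x y"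
    and inner_eq_Re_cinner: "inner x y = Re (cinner x y)"

instantiation complex :: complex_hilbert
begin
definition "scaleC_complex (c::complex) x = c * x"
definition "cinner_complex (x::complex) y = x * cnj y"
instance
  by standard
    (auto simp: scaleC_complex_def cinner_complex_def algebra_simps scaleR_conv_of_real
      inner_complex_def)
end

definition csubspace :: "'e::complex_hilbert set \<Rightarrow> bool" where
  "csubspace S \<longleftrightarrow> 0 \<in> S \<and> (\<forall>x\<in>S. \<forall>y\<in>S. x + y \<in> S) \<and> (\<forall>c. \<forall>x\<in>S. c *\<^sub>C x \<in> S)"

text \<open>\<open>B(E)\<close>: the bounded complex-linear operators.\<close>

definition complex_operators :: "('e::complex_hilbert \<Rightarrow>\<^sub>L 'e) set" where
  "complex_operators = {A. \<forall>c x. blinfun_apply A (c *\<^sub>C x) = c *\<^sub>C blinfun_apply A x}"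

text \<open>\<open>B(S)\<close> for a subspace \<open>S\<close>; only the values on \<open>S\<close> are relevant.\<close>

definition complex_operators_on :: "'e::complex_hilbert set \<Rightarrow> ('e \<Rightarrow> 'e) set" where
  "complex_operators_on S = {A. A ` S \<subseteq> S \<and>
     (\<forall>x\<in>S. \<forall>y\<in>S. A (x + y) = A x + A y) \<and> (\<forall>c. \<forall>x\<in>S. A (c *\<^sub>C x) = c *\<^sub>C A x) \<and>
     (\<exists>K. \<forall>x\<in>S. norm (A x) \<le> K * norm x)}"

definition onorm_on :: "'e::complex_hilbert set \<Rightarrow> ('e \<Rightarrow> 'e) \<Rightarrow> real" where
  "onorm_on S A = (SUP x\<in>S. norm (A x) / norm x)"

definition op_exp :: "('e::complex_hilbert \<Rightarrow> 'e) \<Rightarrow> 'e \<Rightarrow> 'e" where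
  "op_exp A x = (\<Sum>n. (A ^^ n) x /\<^sub>R fact n)"

definition orthogonal_decomposition :: "'i set \<Rightarrow> ('i \<Rightarrow> 'e::complex_hilbert set) \<Rightarrow> bool" where
  "orthogonal_decomposition I S \<longleftrightarrow>
     (\<forall>i\<in>I. csubspace (S i) \<and> closed (S i)) \<and>
     (\<forall>i\<in>I. \<forall>j\<in>I. i \<noteq> j \<longrightarrow> (\<forall>x\<in>S i. \<forall>y\<in>S j. cinner x y = 0)) \<and>
     (\<forall>x. \<exists>\<xi>. (\<forall>i\<in>I. \<xi> i \<in> S i) \<and> (\<xi> has_sum x) I)"

text \<open>\<open>T\<close> is the orthogonal direct sum of the operators \<open>A i\<close> on \<open>S i\<close>, with respect to the
  decomposition of the whole space into the \<open>S i\<close>.\<close>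

definition is_orthogonal_direct_sum ::
    "'i set \<Rightarrow> ('i \<Rightarrow> 'e::complex_hilbert set) \<Rightarrow> ('i \<Rightarrow> 'e \<Rightarrow> 'e) \<Rightarrow> ('e \<Rightarrow>\<^sub>L 'e) \<Rightarrow> bool" where
  "is_orthogonal_direct_sum I S A T \<longleftrightarrow>
     orthogonal_decomposition I S \<and>
     (\<forall>i\<in>I. A i \<in> complex_operators_on (S i)) \<and>
     (\<forall>x \<xi>. (\<forall>i\<in>I. \<xi> i \<in> S i) \<and> (\<xi> has_sum x) I \<longrightarrow> ((\<lambda>i. A i (\<xi> i)) has_sum T x) I)"

text \<open>Unbounded operators, in particular generators, are represented by their graphs.\<close>

definition C0_group :: "(real \<Rightarrow> 'e::complex_hilbert \<Rightarrow>\<^sub>L 'e) \<Rightarrow> bool" where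
  "C0_group T \<longleftrightarrow>
     (\<forall>t. T t \<in> complex_operators) \<and>
     T 0 = id_blinfun \<and> (\<forall>s t. T (s + t) = T s o\<^sub>L T t) \<and>
     (\<forall>x. continuous_on UNIV (\<lambda>t. T t x))"

definition generator :: "(real \<Rightarrow> 'e::complex_hilbert \<Rightarrow>\<^sub>L 'e) \<Rightarrow> ('e \<times> 'e) set" where
  "generator T = {(x, y). ((\<lambda>t. (T t x - x) /\<^sub>R t) \<longlongrightarrow> y) (at 0)}"

section \<open>Bochner integration without separability\<close>

text \<open>The library's Bochner integral requires second countable target spaces, whereas the Hilbert
  spaces here are arbitrary. \<open>has_strong_integral\<close> is the library's definition of
  \<open>has_bochner_integral\<close> with Borel measurability replaced by strong measurability.\<close>

definition strongly_measurable :: "'a measure \<Rightarrow> ('a \<Rightarrow> 'b::real_normed_vector) \<Rightarrow> bool" where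
  "strongly_measurable M f \<longleftrightarrow>
     (\<exists>s. (\<forall>i. simple_function M (s i)) \<and> (AE x in M. (\<lambda>i. s i x) \<longlonglongrightarrow> f x))"

definition has_strong_integral ::
    "'a measure \<Rightarrow> ('a \<Rightarrow> 'b::real_normed_vector) \<Rightarrow> 'b \<Rightarrow> bool" where
  "has_strong_integral M f v \<longleftrightarrow>
     strongly_measurable M f \<and>
     (\<exists>s. (\<forall>i. Bochner_Integration.simple_bochner_integrable M (s i)) \<and>
       (\<lambda>i. \<integral>\<^sup>+x. norm (f x - s i x) \<partial>M) \<longlonglongrightarrow> 0 \<and>
       (\<lambda>i. Bochner_Integration.simple_bochner_integral M (s i)) \<longlonglongrightarrow> v)"

definition strong_integral :: "'a measure \<Rightarrow> ('a \<Rightarrow> 'b::real_normed_vector) \<Rightarrow> 'b" where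
  "strong_integral M f =
     (if \<exists>v. has_strong_integral M f v then THE v. has_strong_integral M f v else 0)"

section \<open>The space \<open>L\<^sup>2([0, \<omega>], H)\<close>\<close>

text \<open>Representatives; their values outside \<open>[0, \<omega>]\<close> play no role.\<close>

definition L2_functions :: "real \<Rightarrow> (real \<Rightarrow> 'h::complex_hilbert) set" where
  "L2_functions \<omega> = {f. strongly_measurable (lebesgue_on {0..\<omega>}) f \<and>
     integrable (lebesgue_on {0..\<omega>}) (\<lambda>s. (norm (f s))\<^sup>2)}"

text \<open>As \<open>\<omega>\<close> is a variable, the space of classes cannot be a fixed HOL type. Instead, the type \<open>'e\<close>
  together with the map \<open>cls\<close> sending a function to its class is (a copy of) the quotient of
  \<open>L2_functions \<omega>\<close> by equality almost everywhere, with the induced operations and the inner product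
  normalised by \<open>1 / \<omega>\<close>; this determines it up to unitary isomorphism. A suitable type exists for
  every \<open>\<omega> > 0\<close>: the quotient of \<open>L2_functions 1\<close>, with \<open>cls f\<close> the class of \<open>\<lambda>s. f (\<omega> * s)\<close>.\<close>

definition is_L2_space :: "real \<Rightarrow> ((real \<Rightarrow> 'h::complex_hilbert) \<Rightarrow> 'e::complex_hilbert) \<Rightarrow> bool" where
  "is_L2_space \<omega> cls \<longleftrightarrow>
     cls ` L2_functions \<omega> = UNIV \<and>
     (\<forall>f\<in>L2_functions \<omega>. \<forall>g\<in>L2_functions \<omega>.
        (cls f = cls g \<longleftrightarrow> (AE s in lebesgue_on {0..\<omega>}. f s = g s)) \<and>
        cls (\<lambda>s. f s + g s) = cls f + cls g \<and>
        cinner (cls f) (cls g) =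
          complex_of_real (1 / \<omega>) * (LINT s|lebesgue_on {0..\<omega>}. cinner (f s) (g s))) \<and>
     (\<forall>c. \<forall>f\<in>L2_functions \<omega>. cls (\<lambda>s. c *\<^sub>C f s) = c *\<^sub>C cls f)"

definition fourier_coeff :: "real \<Rightarrow> (real \<Rightarrow> 'h::complex_hilbert) \<Rightarrow> int \<Rightarrow> 'h" where
  "fourier_coeff \<omega> f n = (1 / \<omega>) *\<^sub>R
     strong_integral (lebesgue_on {0..\<omega>}) (\<lambda>s. cis (- (2 * pi * of_int n * s / \<omega>)) *\<^sub>C f s)"

definition fourier_proj ::
    "((real \<Rightarrow> 'h::complex_hilbert) \<Rightarrow> 'e::complex_hilbert) \<Rightarrow> real \<Rightarrow> int \<Rightarrow> 'e \<Rightarrow>\<^sub>L 'e" where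
  "fourier_proj cls \<omega> l = Blinfun (\<lambda>x.
     cls (\<lambda>s. cis (2 * pi * of_int l * s / \<omega>) *\<^sub>C
       fourier_coeff \<omega> (inv_into (L2_functions \<omega>) cls x) l))"

definition fourier_proj_upto ::
    "((real \<Rightarrow> 'h::complex_hilbert) \<Rightarrow> 'e::complex_hilbert) \<Rightarrow> real \<Rightarrow> nat \<Rightarrow> 'e \<Rightarrow>\<^sub>L 'e" where
  "fourier_proj_upto cls \<omega> m = (\<Sum>l\<in>{l. \<bar>l\<bar> \<le> int m}. fourier_proj cls \<omega> l)"

definition S2_class ::
    "((real \<Rightarrow> 'h::complex_hilbert) \<Rightarrow> 'e::complex_hilbert) \<Rightarrow> real \<Rightarrow> ('e \<Rightarrow>\<^sub>L 'e) set" where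
  "S2_class cls \<omega> = {X \<in> complex_operators.
     (\<lambda>(j, l). (norm (fourier_proj cls \<omega> j o\<^sub>L X o\<^sub>L fourier_proj cls \<omega> l))\<^sup>2)
       summable_on (UNIV :: (int \<times> int) set)}"

section \<open>The operator \<open>L\<close>\<close>

text \<open>\<open>y\<close> is in \<open>W\<^sub>2\<^sup>1\<close> with derivative \<open>g\<close>, i.e. \<open>y\<close> is absolutely continuous on \<open>[0, \<omega>]\<close> with
  derivative \<open>g\<close> in \<open>L\<^sup>2\<close>. This selects the continuous representative, so that \<open>y 0\<close>, \<open>y \<omega>\<close> and
  \<open>y (\<omega> - s)\<close> are meaningful.\<close>

definition W21_deriv ::
    "real \<Rightarrow> (real \<Rightarrow> 'h::complex_hilbert) \<Rightarrow> (real \<Rightarrow> 'h) \<Rightarrow> bool" where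
  "W21_deriv \<omega> y g \<longleftrightarrow> g \<in> L2_functions \<omega> \<and>
     (\<forall>s\<in>{0..\<omega>}. y s = y 0 + strong_integral (lebesgue_on {0..s}) g)"

definition op_L0 ::
    "((real \<Rightarrow> 'h::complex_hilbert) \<Rightarrow> 'e::complex_hilbert) \<Rightarrow> real \<Rightarrow> ('e \<times> 'e) set" where
  "op_L0 cls \<omega> = {(cls y, cls g) | y g. W21_deriv \<omega> y g \<and> y 0 = y \<omega>}"

definition op_V :: "((real \<Rightarrow> 'h::complex_hilbert) \<Rightarrow> 'e::complex_hilbert) \<Rightarrow> real \<Rightarrow>
    (real \<Rightarrow> 'h \<Rightarrow>\<^sub>L 'h) \<Rightarrow> ('e \<times> 'e) set" where
  "op_V cls \<omega> \<V> =
     {(cls y, cls (\<lambda>s. \<V> s (y (\<omega> - s)))) | y. (\<exists>g. W21_deriv \<omega> y g) \<and> y 0 = y \<omega>}"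

definition op_L :: "((real \<Rightarrow> 'h::complex_hilbert) \<Rightarrow> 'e::complex_hilbert) \<Rightarrow> real \<Rightarrow>
    (real \<Rightarrow> 'h \<Rightarrow>\<^sub>L 'h) \<Rightarrow> ('e \<times> 'e) set" where
  "op_L cls \<omega> \<V> = {(x, u - v) | x u v. (x, u) \<in> op_L0 cls \<omega> \<and> (x, v) \<in> op_V cls \<omega> \<V>}"

text \<open>The operator-valued Fourier coefficient; the map below is bounded whenever every
  \<open>\<lambda>s. \<V> s x\<close> is in \<open>L\<^sup>2\<close> (closed graph theorem).\<close>

definition op_fourier_coeff ::
    "real \<Rightarrow> (real \<Rightarrow> 'h::complex_hilbert \<Rightarrow>\<^sub>L 'h) \<Rightarrow> int \<Rightarrow> 'h \<Rightarrow>\<^sub>L 'h" where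
  "op_fourier_coeff \<omega> \<V> n = Blinfun (\<lambda>x. fourier_coeff \<omega> (\<lambda>s. \<V> s x) n)"

end

theory Submission
  imports Defs
begin

text \<open>In the Fourier basis \<open>L\<^sub>0\<close> is diagonal, with eigenvalue \<open>\<i> c l\<close> on the range of \<open>P\<^sub>l\<close>, where
  \<open>c = 2 \<pi> / \<omega>\<close>. The reflection \<open>s \<mapsto> \<omega> - s\<close> turns the exponential of index \<open>n\<close> into the one of
  index \<open>-n\<close>, so that \<open>V\<close> has the Hankel matrix with entries \<open>V\<^sub>j\<^sub>n\<close> given by the Fourier
  coefficients of index \<open>j + n\<close> (\<open>op_L0_eq\<close>, \<open>V_fourier\<close>, \<open>op_L_eq\<close>). From there on everything takes
  place for block matrices with respect to a complete system of orthogonal projections, and the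
  operators whose blocks have square summable norms form an ideal on which the square root of the
  sum of squares is a submultiplicative norm dominating the operator norm (\<open>hs_compose\<close>, \<open>hs_norm\<close>).

  Let \<open>\<Gamma>\<close> divide the entry \<open>(j, l)\<close>, \<open>j \<noteq> l\<close>, of a matrix by \<open>\<i> c (j - l)\<close> and delete the diagonal. Then
  \<open>L\<^sub>0 \<Gamma>X - \<Gamma>X L\<^sub>0\<close> is the off-diagonal part of \<open>X\<close>, so that conjugation with \<open>1 + \<Gamma>X\<close> removes the
  off-diagonal part of a perturbation up to terms of second order. This is done twice.

  First, \<open>\<Gamma>V\<close> is in the ideal although \<open>V\<close> is unbounded: its squared norm is the sum over \<open>j + l\<close> and
  \<open>j - l\<close> of a product of two summable families. The second order term \<open>V \<Gamma>V\<close> is in the ideal by the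
  second hypothesis on the Fourier coefficients. With finitely many entries dropped, \<open>\<Gamma>V\<close> is small, so
  that the sum of the identity and the remaining matrix is invertible, and \<open>L\<close> becomes \<open>L\<^sub>0 - B\<close> with \<open>B\<close> in the ideal
  (\<open>unbounded_perturbation_similar_bounded\<close>).

  Second, let \<open>J\<close> keep the diagonal and the central block \<open>|j|, |l| \<le> k\<close> of a matrix, and let \<open>\<Gamma>\<close> act
  on the remaining entries. Conjugation with \<open>1 + \<Gamma>X\<close> takes \<open>L\<^sub>0 - B\<close> to \<open>L\<^sub>0 - J X\<close> if
  \<open>X = B + B \<Gamma>X - \<Gamma>X J X\<close>. For large \<open>k\<close> this equation is solved by iteration
  (\<open>bounded_perturbation_block_diagonalization\<close>): the large part of \<open>B\<close> sits in finitely many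
  entries, far inside the central block, and its products with \<open>\<Gamma>X\<close> involve only entries of \<open>\<Gamma>X\<close>
  with one index beyond \<open>k\<close>, where \<open>j - l\<close> is large.

  For the group it matters that the transformations preserve the domain of \<open>L\<^sub>0\<close>. They map it into
  itself by the commutator identity, and onto itself since \<open>V\<close> composed with the resolvent of \<open>L\<^sub>0\<close> at
  a large real number is small (\<open>id_plus_onto_domain\<close>). The block diagonal operator \<open>L\<^sub>0 - C\<close> is the
  sum of two commuting parts, a bounded operator and the diagonal operator with the frequencies
  \<open>|l| \<le> k\<close> deleted, and generates the product of an exponential series and a diagonal
  unitary group (\<open>block_diagonal_group\<close>). The group of \<open>L\<close> is the conjugate of this one.

  Two points of analysis underlie the passage to Fourier coefficients. Integrals of functions with
  values in a nonseparable space are only used through their inner products with vectors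
  (\<open>cinner_strong_integral\<close>), which also reduces completeness of the exponentials to the scalar case
  (\<open>trig_system_complete\<close>). And \<open>x \<mapsto> \<V> x\<close> is bounded from \<open>H\<close> to \<open>L\<^sup>2\<close>, by Baire's theorem and
  Fatou's lemma (\<open>V_cls_bounded\<close>), so that the norm of \<open>V y\<close> is at most a
  multiple of the sum of the norms of the Fourier coefficients of \<open>y\<close>.\<close>

section \<open>Complex Hilbert spaces\<close>

lemma scaleC_one [simp]: "1 *\<^sub>C x = (x::'a::complex_hilbert)"
  by (metis scaleR_one scaleR_scaleC of_real_1)

lemma scaleC_zero_left [simp]: "0 *\<^sub>C x = (0::'a::complex_hilbert)"
  by (metis scaleR_zero_left scaleR_scaleC of_real_0)

lemma cinner_add_right: "cinner x (y + z) = cinner x y + cinner x (z::'a::complex_hilbert)"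
  by (metis cinner_add_left cinner_commute complex_cnj_add)

lemma cinner_scaleC_right: "cinner x (c *\<^sub>C y) = cnj c * cinner x (y::'a::complex_hilbert)"
  by (metis cinner_commute cinner_scaleC_left complex_cnj_mult)

lemma cinner_self: "cinner x x = complex_of_real ((norm (x::'a::complex_hilbert))\<^sup>2)"
proof -
  have "Im (cinner x x) = 0"
    using cinner_commute[of x x] by (metis cnj.simps(2) neg_equal_zero)
  then show ?thesis
    using inner_eq_Re_cinner[of x x] by (simp add: complex_eq_iff power2_norm_eq_inner)
qed

lemma norm_scaleC: "norm (c *\<^sub>C x) = cmod c * norm (x::'a::complex_hilbert)"
proof -
  have "complex_of_real ((norm (c *\<^sub>C x))\<^sup>2) = (c * cnj c) * cinner x x"
    unfolding cinner_self[symmetric] cinner_scaleC_left cinner_scaleC_right by (simp add: mult.assoc)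
  also have "\<dots> = complex_of_real ((cmod c)\<^sup>2 * (norm x)\<^sup>2)"
    by (simp only: cinner_self of_real_mult complex_norm_square[symmetric] of_real_power)
  finally have "(norm (c *\<^sub>C x))\<^sup>2 = (cmod c * norm x)\<^sup>2"
    by (simp only: of_real_eq_iff power_mult_distrib)
  then show ?thesis by (simp add: power2_eq_iff_nonneg)
qed

text \<open>The inequality for the real inner product suffices, once \<open>x\<close> is multiplied by a
  phase that makes \<open>cinner x y\<close> real and nonnegative.\<close>

lemma cinner_norm_le: "cmod (cinner x y) \<le> norm x * norm (y::'a::complex_hilbert)"
proof (cases "cinner x y = 0")
  case False
  define z where "z = cinner x y"
  define c where "c = cnj z / complex_of_real (cmod z)"
  have z: "z \<noteq> 0" using False by (simp add: z_def)
  have c: "cmod c = 1" using z by (simp add: c_def norm_divide)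
  have "c * z = (z * cnj z) / complex_of_real (cmod z)" by (simp add: c_def mult.commute)
  also have "\<dots> = complex_of_real (cmod z)"
    unfolding complex_norm_square[symmetric] using z by (simp add: power2_eq_square)
  finally have "c * cinner x y = complex_of_real (cmod (cinner x y))" by (simp add: z_def)
  then have "cmod (cinner x y) = inner (c *\<^sub>C x) y"
    by (simp add: inner_eq_Re_cinner cinner_scaleC_left)
  also have "\<dots> \<le> norm (c *\<^sub>C x) * norm y" by (rule norm_cauchy_schwarz)
  finally show ?thesis by (simp add: norm_scaleC c)
qed auto

lemma bounded_bilinear_cinner: "bounded_bilinear (cinner :: 'a::complex_hilbert \<Rightarrow> _)"
proof
  fix a b :: 'a and r :: real
  show "cinner (r *\<^sub>R a) b = r *\<^sub>R cinner a b"
    by (simp only: scaleR_scaleC[of r a] cinner_scaleC_left scaleR_conv_of_real)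
  show "cinner a (r *\<^sub>R b) = r *\<^sub>R cinner a b"
    by (simp only: scaleR_scaleC[of r b] cinner_scaleC_right scaleR_conv_of_real complex_cnj_complex_of_real)
  show "\<exists>K. \<forall>a b::'a. norm (cinner a b) \<le> norm a * norm b * K"
    by (rule exI[of _ 1]) (simp add: cinner_norm_le)
qed (simp_all only: cinner_add_left cinner_add_right)

lemma bounded_bilinear_scaleC: "bounded_bilinear (scaleC :: _ \<Rightarrow> 'a::complex_hilbert \<Rightarrow> _)"
proof
  fix a :: complex and b :: 'a and r :: real
  show "(r *\<^sub>R a) *\<^sub>C b = r *\<^sub>R (a *\<^sub>C b)"
    by (simp only: scaleR_scaleC[of r "a *\<^sub>C b"] scaleC_scaleC scaleR_conv_of_real)
  show "a *\<^sub>C (r *\<^sub>R b) = r *\<^sub>R (a *\<^sub>C b)"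
    by (simp only: scaleR_scaleC[of r "a *\<^sub>C b"] scaleR_scaleC[of r b] scaleC_scaleC mult.commute)
  show "\<exists>K. \<forall>a (b::'a). norm (a *\<^sub>C b) \<le> norm a * norm b * K"
    by (rule exI[of _ 1]) (simp add: norm_scaleC)
qed (simp_all only: scaleC_add_left scaleC_add_right)

interpretation cinner: bounded_bilinear "cinner :: 'a::complex_hilbert \<Rightarrow> _"
  by (rule bounded_bilinear_cinner)

interpretation scaleC: bounded_bilinear "scaleC :: _ \<Rightarrow> 'a::complex_hilbert \<Rightarrow> _"
  by (rule bounded_bilinear_scaleC)

lemma cinner_eqI: "(\<And>h. cinner x h = cinner y h) \<Longrightarrow> x = (y::'a::complex_hilbert)"
proof -
  assume "\<And>h. cinner x h = cinner y h"
  then have "cinner (x - y) (x - y) = 0" by (simp add: cinner.diff_left)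
  then show ?thesis by (simp add: cinner_self)
qed

lemma complex_operatorsD: "A \<in> complex_operators \<Longrightarrow> A (c *\<^sub>C x) = c *\<^sub>C A x"
  by (simp add: complex_operators_def)

lemma complex_operators_compose:
  "A \<in> complex_operators \<Longrightarrow> B \<in> complex_operators \<Longrightarrow> A o\<^sub>L B \<in> complex_operators"
  by (simp add: complex_operators_def)

lemma complex_operators_add:
  "A \<in> complex_operators \<Longrightarrow> B \<in> complex_operators \<Longrightarrow> A + B \<in> complex_operators"
  by (simp add: complex_operators_def blinfun.add_left scaleC.add_right)

lemma complex_operators_diff:
  "A \<in> complex_operators \<Longrightarrow> B \<in> complex_operators \<Longrightarrow> A - B \<in> complex_operators"
  by (simp add: complex_operators_def blinfun.diff_left scaleC.diff_right)

lemma complex_operators_uminus: "A \<in> complex_operators \<Longrightarrow> - A \<in> complex_operators"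
  by (simp add: complex_operators_def blinfun.minus_left scaleC.minus_right)

lemma complex_operators_scaleR: "A \<in> complex_operators \<Longrightarrow> r *\<^sub>R A \<in> complex_operators"
  by (simp add: complex_operators_def blinfun.scaleR_left scaleC.scaleR_right)

lemma complex_operators_id: "id_blinfun \<in> complex_operators"
  by (simp add: complex_operators_def)

lemma complex_operators_0: "0 \<in> complex_operators"
  by (simp add: complex_operators_def scaleC.zero_right)

lemma complex_operators_sum:
  "(\<And>i. i \<in> I \<Longrightarrow> A i \<in> complex_operators) \<Longrightarrow> sum A I \<in> complex_operators"
  by (induction I rule: infinite_finite_induct)
     (auto simp: complex_operators_0 complex_operators_add)

lemma complex_operators_tendsto:
  fixes A :: "'n \<Rightarrow> 'e::complex_hilbert \<Rightarrow>\<^sub>L 'e" and B :: "'e \<Rightarrow>\<^sub>L 'e"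
  assumes "\<And>x. ((\<lambda>n. A n x) \<longlongrightarrow> B x) F" "F \<noteq> bot" "\<forall>\<^sub>F n in F. A n \<in> complex_operators"
  shows "B \<in> complex_operators"
  unfolding complex_operators_def
proof (clarify)
  fix c x
  have "((\<lambda>n. A n (c *\<^sub>C x)) \<longlongrightarrow> c *\<^sub>C B x) F"
    by (rule Lim_transform_eventually[OF scaleC.tendsto[OF tendsto_const assms(1)]])
       (use assms(3) in eventually_elim, simp add: complex_operatorsD)
  then show "B (c *\<^sub>C x) = c *\<^sub>C B x"
    using tendsto_unique[OF assms(2) assms(1)] by blast
qed

lemma complex_operators_infsum:
  fixes A :: "'n \<Rightarrow> 'e::complex_hilbert \<Rightarrow>\<^sub>L 'e"
  assumes "A summable_on I" "\<And>i. i \<in> I \<Longrightarrow> A i \<in> complex_operators"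
  shows "infsum A I \<in> complex_operators"
proof (rule complex_operators_tendsto)
  show "((\<lambda>S. sum A S x) \<longlongrightarrow> infsum A I x) (finite_subsets_at_top I)" for x
    by (rule blinfun.tendsto[OF infsum_tendsto[OF assms(1)] tendsto_const])
  show "\<forall>\<^sub>F S in finite_subsets_at_top I. sum A S \<in> complex_operators"
    by (rule eventually_finite_subsets_at_top_weakI) (use assms(2) in \<open>auto intro!: complex_operators_sum\<close>)
qed simp

definition scalar_op :: "complex \<Rightarrow> 'e::complex_hilbert \<Rightarrow>\<^sub>L 'e" where
  "scalar_op z = Blinfun (\<lambda>x. z *\<^sub>C x)"

lemma scalar_op_apply [simp]: "scalar_op z x = z *\<^sub>C x"
  unfolding scalar_op_def by (simp only: bounded_linear_Blinfun_apply[OF scaleC.bounded_linear_right])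

lemma scalar_op_complex: "scalar_op z \<in> complex_operators"
  by (simp add: complex_operators_def scaleC_scaleC mult.commute)

lemma norm_scalar_op_compose_le: "norm (scalar_op z o\<^sub>L A) \<le> cmod z * norm A"
proof (rule norm_blinfun_bound)
  fix x show "norm ((scalar_op z o\<^sub>L A) x) \<le> cmod z * norm A * norm x"
    using mult_left_mono[OF norm_blinfun[of A x] norm_ge_zero[of z]]
    by (simp only: blinfun_apply_blinfun_compose scalar_op_apply norm_scaleC mult.assoc)
qed simp

text \<open>The Cauchy criterion for orthogonal expansions. It is applied to orthogonal families of
  vectors and to the blocks of an operator; the latter are not orthogonal in a Hilbert space, but their
  finite sums obey the same bound.\<close>

lemma summable_on_if_finite_sums_norm2_le:
  fixes v :: "'i \<Rightarrow> 'b::banach"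
  assumes g: "g summable_on A"
    and le: "\<And>F. finite F \<Longrightarrow> F \<subseteq> A \<Longrightarrow> (norm (sum v F))\<^sup>2 \<le> sum g F"
  shows "v summable_on A"
proof -
  have "cauchy_filter (filtermap (sum v) (finite_subsets_at_top A))"
    unfolding cauchy_filter_metric_filtermap
  proof (intro allI impI)
    fix e :: real assume e: "e > 0"
    have "eventually (\<lambda>S. dist (sum g S) (infsum g A) < e\<^sup>2/16) (finite_subsets_at_top A)"
      by (rule tendstoD[OF infsum_tendsto[OF g]]) (use e in simp)
    then obtain S0 where S0: "finite S0" "S0 \<subseteq> A"
      and S0d: "\<And>S. finite S \<Longrightarrow> S0 \<subseteq> S \<Longrightarrow> S \<subseteq> A \<Longrightarrow> dist (sum g S) (infsum g A) < e\<^sup>2/16"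
      unfolding eventually_finite_subsets_at_top by metis
    define Q where "Q S \<longleftrightarrow> finite S \<and> S0 \<subseteq> S \<and> S \<subseteq> A" for S
    have evQ: "eventually Q (finite_subsets_at_top A)"
      unfolding eventually_finite_subsets_at_top Q_def
      by (rule exI[of _ S0]) (use S0 in simp)
    have near: "norm (sum v S - sum v S0) < e/2" if "Q S" for S
    proof -
      have S: "finite S" "S0 \<subseteq> S" "S \<subseteq> A" using that by (auto simp: Q_def)
      have "(norm (sum v S - sum v S0))\<^sup>2 = (norm (sum v (S - S0)))\<^sup>2"
        using S S0 by (simp add: sum_diff)
      also have "\<dots> \<le> sum g (S - S0)" using S S0 by (intro le) auto
      also have "\<dots> = sum g S - sum g S0" using S S0 by (simp add: sum_diff)
      also have "\<dots> < e\<^sup>2/8" using S0d[OF S] S0d[OF S0(1) order_refl S0(2)] unfolding dist_real_def abs_less_iff by linarith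
      also have "\<dots> < (e/2)\<^sup>2" using e by (simp add: power2_eq_square)
      finally show ?thesis using e power_less_imp_less_base[of "norm (sum v S - sum v S0)" 2 "e/2"] by linarith
    qed
    have "dist (sum v S) (sum v S') < e" if "Q S" "Q S'" for S S'
      using dist_triangle_half_l[OF near[OF that(1), folded dist_norm] near[OF that(2), folded dist_norm]] .
    then show "\<exists>P. eventually P (finite_subsets_at_top A) \<and> (\<forall>x y. P x \<and> P y \<longrightarrow> dist (sum v x) (sum v y) < e)"
      by (intro exI[of _ Q] conjI evQ) simp
  qed
  moreover have "complete (UNIV::'b set)" by (rule complete_UNIV)
  ultimately have "convergent_filter (filtermap (sum v) (finite_subsets_at_top A))"
    using convergent_filter_iff_cauchy by blast
  then obtain x where "filtermap (sum v) (finite_subsets_at_top A) \<le> nhds x"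
    unfolding convergent_filter_iff ..
  then show ?thesis
    unfolding summable_on_def has_sum_def filterlim_def ..
qed

section \<open>Complete systems of orthogonal projections\<close>

locale projection_system =
  fixes P :: "int \<Rightarrow> 'e::complex_hilbert \<Rightarrow>\<^sub>L 'e"
  assumes P_complex: "P l \<in> complex_operators"
    and P_P: "P j (P l x) = (if j = l then P l x else 0)"
    and P_selfadjoint: "cinner (P l x) y = cinner x (P l y)"
    and P_complete: "(\<And>l. P l x = 0) \<Longrightarrow> x = 0"
begin

lemma P_idem [simp]: "P l (P l x) = P l x"
  by (simp add: P_P)

lemma P_scaleC: "P l (c *\<^sub>C x) = c *\<^sub>C P l x"
  by (rule complex_operatorsD[OF P_complex])

lemma vector_eqI: "(\<And>l. P l x = P l y) \<Longrightarrow> x = y"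
  using P_complete[of "x - y"] by (simp add: blinfun.diff_right)

lemma cinner_ranges: "P l x = x \<Longrightarrow> P j y = y \<Longrightarrow> j \<noteq> l \<Longrightarrow> cinner x y = 0"
  by (metis P_P P_selfadjoint cinner.zero_right)

lemma norm_sum_sq:
  assumes "finite F" "\<And>l. l \<in> F \<Longrightarrow> P l (v l) = v l"
  shows "(norm (sum v F))\<^sup>2 = (\<Sum>l\<in>F. (norm (v l))\<^sup>2)"
  using assms
proof (induction F)
  case (insert a F)
  have "cinner (v a) (sum v F) = 0"
    unfolding cinner.sum_right
    by (rule sum.neutral) (use insert in \<open>metis cinner_ranges insertCI\<close>)
  then have "inner (v a) (sum v F) = 0" by (simp add: inner_eq_Re_cinner)
  then have "(norm (v a + sum v F))\<^sup>2 = (norm (v a))\<^sup>2 + (norm (sum v F))\<^sup>2"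
    by (simp add: power2_norm_eq_inner inner_add_left inner_add_right inner_commute)
  then show ?case using insert by simp
qed simp

lemma bessel:
  assumes "finite F" shows "(\<Sum>l\<in>F. (norm (P l x))\<^sup>2) \<le> (norm x)\<^sup>2"
proof -
  let ?y = "\<Sum>l\<in>F. P l x"
  have eq: "(norm ?y)\<^sup>2 = (\<Sum>l\<in>F. (norm (P l x))\<^sup>2)" by (rule norm_sum_sq[OF assms]) simp
  have "cinner (P l x) x = cinner (P l x) (P l x)" for l
    by (metis P_idem P_selfadjoint)
  then have "cinner ?y x = (\<Sum>l\<in>F. complex_of_real ((norm (P l x))\<^sup>2))"
    by (simp add: cinner.sum_left cinner_self)
  then have "cinner ?y x = complex_of_real ((norm ?y)\<^sup>2)"
    by (simp only: eq of_real_sum)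
  then have "(norm ?y)\<^sup>2 = inner ?y x" by (simp add: inner_eq_Re_cinner)
  also have "\<dots> \<le> norm ?y * norm x" by (rule norm_cauchy_schwarz)
  finally have "norm ?y \<le> norm x"
    by (cases "?y = 0") (auto simp: power2_eq_square)
  then show ?thesis by (metis eq norm_ge_zero power_mono)
qed

lemma summable_P_sq: "(\<lambda>l. (norm (P l x))\<^sup>2) summable_on A"
  by (rule nonneg_bdd_above_summable_on) (auto intro!: bdd_aboveI[of _ "(norm x)\<^sup>2"] bessel)

text \<open>Orthogonality turns square summability of the components into convergence of their
  sum.\<close>

lemma riesz_fischer:
  assumes "\<And>l. P l (v l) = v l" "(\<lambda>l. (norm (v l))\<^sup>2) summable_on UNIV"
  shows "\<exists>y. (v has_sum y) UNIV \<and> (\<forall>l. P l y = v l)"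
proof -
  have "v summable_on UNIV"
    by (rule summable_on_if_finite_sums_norm2_le[OF assms(2)]) (simp add: norm_sum_sq assms(1))
  then obtain y where y: "(v has_sum y) UNIV" by (auto simp: summable_on_def)
  have "P l y = v l" for l
  proof -
    have *: "((\<lambda>j. P l (v j)) has_sum P l y) UNIV"
      by (rule has_sum_bounded_linear[OF blinfun.bounded_linear_right y])
    have "P l (v j) = (if j = l then v l else 0)" for j
      by (metis P_P assms(1))
    with * have "((\<lambda>j. if j = l then v l else 0) has_sum P l y) UNIV" by simp
    moreover have "((\<lambda>j. if j = l then v l else 0) has_sum v l) UNIV"
      by (rule has_sum_finite_neutralI[of "{l}"]) auto
    ultimately show ?thesis using has_sum_unique by blast
  qed
  with y show ?thesis by blast
qed

lemma P_has_sum: "((\<lambda>l. P l x) has_sum x) UNIV"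
proof -
  have "\<exists>y. ((\<lambda>l. P l x) has_sum y) UNIV \<and> (\<forall>l. P l y = P l x)"
    by (rule riesz_fischer[of "\<lambda>l. P l x", OF P_idem summable_P_sq])
  then obtain y where y: "((\<lambda>l. P l x) has_sum y) UNIV \<and> (\<forall>l. P l y = P l x)" ..
  then have "y = x" by (metis vector_eqI)
  then show ?thesis using y by simp
qed

lemma parseval: "((\<lambda>l. (norm (P l x))\<^sup>2) has_sum (norm x)\<^sup>2) UNIV"
proof -
  have "((\<lambda>F. (norm (\<Sum>l\<in>F. P l x))\<^sup>2) \<longlongrightarrow> (norm x)\<^sup>2) (finite_subsets_at_top UNIV)"
    using P_has_sum[of x] unfolding has_sum_def by (intro tendsto_intros)
  then have "((\<lambda>F. \<Sum>l\<in>F. (norm (P l x))\<^sup>2) \<longlongrightarrow> (norm x)\<^sup>2) (finite_subsets_at_top UNIV)"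
  proof (rule Lim_transform_eventually)
    show "\<forall>\<^sub>F F in finite_subsets_at_top UNIV. (norm (\<Sum>l\<in>F. P l x))\<^sup>2 = (\<Sum>l\<in>F. (norm (P l x))\<^sup>2)"
      by (rule eventually_finite_subsets_at_top_weakI) (simp add: norm_sum_sq)
  qed
  then show ?thesis by (simp add: has_sum_def)
qed

lemma norm_le_if_P_le:
  assumes "\<And>l. norm (P l y) \<le> K * norm (P l x)" "K \<ge> 0"
  shows "norm y \<le> K * norm x"
proof -
  have "(norm y)\<^sup>2 \<le> K\<^sup>2 * (norm x)\<^sup>2"
  proof (rule has_sum_mono[OF parseval[of y] has_sum_cmult_right[OF parseval[of x]]])
    fix l show "(norm (P l y))\<^sup>2 \<le> K\<^sup>2 * (norm (P l x))\<^sup>2"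
      using power_mono[OF assms(1) norm_ge_zero, of l 2] by (simp add: power_mult_distrib)
  qed
  then have "(norm y)\<^sup>2 \<le> (K * norm x)\<^sup>2" by (simp only: power_mult_distrib)
  then show ?thesis by (rule power2_le_imp_le) (simp add: assms(2))
qed

lemma op_eqI:
  fixes X Y :: "'e \<Rightarrow>\<^sub>L 'e"
  assumes "\<And>j l x. P j (X (P l x)) = P j (Y (P l x))"
  shows "X = Y"
proof (rule blinfun_eqI, rule vector_eqI)
  fix x j
  have "((\<lambda>l. P j (X (P l x))) has_sum P j (X x)) UNIV"
    by (intro has_sum_bounded_linear[OF blinfun.bounded_linear_right] P_has_sum)
  moreover have "((\<lambda>l. P j (Y (P l x))) has_sum P j (Y x)) UNIV"
    by (intro has_sum_bounded_linear[OF blinfun.bounded_linear_right] P_has_sum)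
  ultimately show "P j (X x) = P j (Y x)"
    using has_sum_unique assms by simp
qed

section \<open>Diagonal operators\<close>

definition diag_op :: "(int \<Rightarrow> complex) \<Rightarrow> 'e \<Rightarrow>\<^sub>L 'e" where
  "diag_op m = Blinfun (\<lambda>x. \<Sum>\<^sub>\<infinity>l. m l *\<^sub>C P l x)"

context
  fixes m :: "int \<Rightarrow> complex" and K :: real
  assumes m_le: "\<And>l. cmod (m l) \<le> K"
begin

lemma K_nonneg: "K \<ge> 0"
  using m_le[of 0] norm_ge_zero order_trans by blast

lemma diag_sum_exists: "\<exists>y. ((\<lambda>l. m l *\<^sub>C P l x) has_sum y) UNIV \<and> (\<forall>l. P l y = m l *\<^sub>C P l x)"
proof (rule riesz_fischer[where v = "\<lambda>l. m l *\<^sub>C P l x"])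
  show "(\<lambda>l. (norm (m l *\<^sub>C P l x))\<^sup>2) summable_on UNIV"
  proof (rule summable_on_comparison_test[OF summable_on_cmult_right[OF summable_P_sq[of x]]])
    fix l show "(norm (m l *\<^sub>C P l x))\<^sup>2 \<le> K\<^sup>2 * (norm (P l x))\<^sup>2"
      using power_mono[OF m_le norm_ge_zero, of l 2]
      by (simp add: norm_scaleC power_mult_distrib mult_right_mono)
  qed simp
qed (auto simp: P_scaleC)

lemma P_diag_op: "P l (diag_op m x) = m l *\<^sub>C P l x"
proof -
  define f where "f = (\<lambda>x. \<Sum>\<^sub>\<infinity>l. m l *\<^sub>C P l x)"
  have Pf: "P l (f x) = m l *\<^sub>C P l x" for l x
    unfolding f_def using diag_sum_exists[of x] infsumI by metis
  have "bounded_linear f"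
  proof
    show "f (x + y) = f x + f y" for x y
      by (rule vector_eqI) (simp add: Pf blinfun.add_right scaleC.add_right)
    show "f (r *\<^sub>R x) = r *\<^sub>R f x" for r x
      by (rule vector_eqI) (simp add: Pf blinfun.scaleR_right scaleC.scaleR_right)
    have "norm (f x) \<le> K * norm x" for x
      by (rule norm_le_if_P_le[OF _ K_nonneg])
         (simp add: Pf norm_scaleC mult_right_mono m_le)
    then show "\<exists>K. \<forall>x. norm (f x) \<le> norm x * K"
      by (metis mult.commute)
  qed
  then have "diag_op m x = f x"
    unfolding diag_op_def f_def[symmetric] by (simp only: bounded_linear_Blinfun_apply)
  with Pf show "P l (diag_op m x) = m l *\<^sub>C P l x" by simp
qed

lemma norm_diag_op_le: "norm (diag_op m x) \<le> K * norm x"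
  by (rule norm_le_if_P_le[OF _ K_nonneg]) (simp add: P_diag_op norm_scaleC mult_right_mono m_le)

lemma diag_op_complex: "diag_op m \<in> complex_operators"
  unfolding complex_operators_def
  by (clarify, rule vector_eqI) (simp add: P_diag_op P_scaleC scaleC_scaleC mult.commute)

end

text \<open>Dominated convergence for diagonal operators: up to a small remainder, \<open>x\<close> has
  only finitely many components. Strong continuity of diagonal groups and the convergence of their
  difference quotients are both instances.\<close>

lemma diag_op_tendsto:
  assumes "\<And>t l. cmod (m t l) \<le> K" "\<And>l. cmod (m' l) \<le> K" "\<And>l. ((\<lambda>t. m t l) \<longlongrightarrow> m' l) F"
  shows "((\<lambda>t. diag_op (m t) x) \<longlongrightarrow> diag_op m' x) F"
proof (rule tendstoI)
  fix e :: real assume e: "e > 0"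
  have K: "K \<ge> 0" using assms(2)[of 0] norm_ge_zero order_trans by blast
  obtain S where S: "finite S" "norm (x - (\<Sum>l\<in>S. P l x)) < e / (2 * K + 1) / 2"
  proof -
    have "eventually (\<lambda>S. dist (\<Sum>l\<in>S. P l x) x < e / (2 * K + 1) / 2) (finite_subsets_at_top UNIV)"
      using P_has_sum[of x] unfolding has_sum_def by (rule tendstoD) (use e K in auto)
    then obtain S where "finite S \<and> dist (\<Sum>l\<in>S. P l x) x < e / (2 * K + 1) / 2"
      unfolding eventually_finite_subsets_at_top by (elim exE conjE) (meson order_refl subset_UNIV)
    then show ?thesis using that[of S] by (simp add: dist_norm norm_minus_commute)
  qed
  let ?y = "\<Sum>l\<in>S. P l x"
  have diagP: "diag_op k (P l x) = k l *\<^sub>C P l x" if "\<And>l. cmod (k l) \<le> K" for k l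
    by (rule vector_eqI) (simp add: P_diag_op[OF that] P_P scaleC.zero_right P_scaleC)
  have "((\<lambda>t. diag_op (m t) ?y) \<longlongrightarrow> diag_op m' ?y) F"
    unfolding blinfun.sum_right
    by (intro tendsto_sum) (simp add: diagP assms(1,2) scaleC.tendsto[OF assms(3) tendsto_const])
  then have "eventually (\<lambda>t. dist (diag_op (m t) ?y) (diag_op m' ?y) < e/2) F"
    by (rule tendstoD) (use e in simp)
  then show "eventually (\<lambda>t. dist (diag_op (m t) x) (diag_op m' x) < e) F"
  proof eventually_elim
    case (elim t)
    have "norm (diag_op (m t) (x - ?y)) \<le> K * norm (x - ?y)"
      "norm (diag_op m' (x - ?y)) \<le> K * norm (x - ?y)"
      by (auto intro!: norm_diag_op_le assms)
    moreover have "2 * K * norm (x - ?y) \<le> e/2"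
    proof -
      have "2 * K * norm (x - ?y) \<le> (2 * K + 1) * norm (x - ?y)" by (simp add: algebra_simps)
      also have "\<dots> \<le> (2 * K + 1) * (e / (2 * K + 1) / 2)"
        using S(2) K by (intro mult_left_mono) auto
      also have "\<dots> = e/2"
      proof -
        have "2 * K + 1 \<noteq> 0" using K by linarith
        then show ?thesis by (metis nonzero_mult_div_cancel_left times_divide_eq_right)
      qed
      finally show ?thesis .
    qed
    moreover have eq: "diag_op (m t) x - diag_op m' x
        = diag_op (m t) (x - ?y) - diag_op m' (x - ?y) + (diag_op (m t) ?y - diag_op m' ?y)"
      by (simp add: blinfun.diff_right)
    have "norm (diag_op (m t) x - diag_op m' x)
        \<le> norm (diag_op (m t) (x - ?y)) + norm (diag_op m' (x - ?y)) + norm (diag_op (m t) ?y - diag_op m' ?y)"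
      unfolding eq
      using norm_triangle_ineq[of "diag_op (m t) (x - ?y) - diag_op m' (x - ?y)" "diag_op (m t) ?y - diag_op m' ?y"]
        norm_triangle_ineq4[of "diag_op (m t) (x - ?y)" "diag_op m' (x - ?y)"] by linarith
    ultimately show ?case using elim unfolding dist_norm by linarith
  qed
qed

end

section \<open>Operator blocks\<close>

interpretation blinfun_compose: bounded_bilinear
  "(o\<^sub>L) :: ('b::real_normed_vector \<Rightarrow>\<^sub>L 'c::real_normed_vector) \<Rightarrow> ('a::real_normed_vector \<Rightarrow>\<^sub>L 'b) \<Rightarrow> _"
  by (rule bounded_bilinear_blinfun_compose)

context projection_system begin

definition block :: "int \<Rightarrow> ('e \<Rightarrow>\<^sub>L 'e) \<Rightarrow> int \<Rightarrow> 'e \<Rightarrow>\<^sub>L 'e" where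
  "block j X l = P j o\<^sub>L X o\<^sub>L P l"

lemma block_apply: "block j X l x = P j (X (P l x))"
  by (simp add: block_def)

lemma block_add: "block j (X + Y) l = block j X l + block j Y l"
  by (rule blinfun_eqI) (simp add: block_apply blinfun.add_left blinfun.add_right)

lemma block_diff: "block j (X - Y) l = block j X l - block j Y l"
  by (rule blinfun_eqI) (simp add: block_apply blinfun.diff_left blinfun.diff_right)

lemma block_0: "block j 0 l = 0"
  by (rule blinfun_eqI) (simp add: block_apply)

lemma block_complex: "X \<in> complex_operators \<Longrightarrow> block j X l \<in> complex_operators"
  unfolding block_def by (intro complex_operators_compose P_complex)

lemma block_eqI: "(\<And>j l. block j X l = block j Y l) \<Longrightarrow> X = Y"
  by (rule op_eqI) (metis block_apply)

lemma bounded_linear_block: "bounded_linear (\<lambda>X. block j X l)"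
  unfolding block_def
  by (rule bounded_linear_compose[OF blinfun_compose.bounded_linear_left blinfun_compose.bounded_linear_right])

definition is_block :: "int \<Rightarrow> int \<Rightarrow> ('e \<Rightarrow>\<^sub>L 'e) \<Rightarrow> bool" where
  "is_block j l a \<longleftrightarrow> P j o\<^sub>L a = a \<and> a o\<^sub>L P l = a"

lemma is_blockD: "is_block j l a \<Longrightarrow> P j (a x) = a x" "is_block j l a \<Longrightarrow> a (P l x) = a x"
  unfolding is_block_def by (metis blinfun_apply_blinfun_compose)+

lemma is_block_block: "is_block j l (block j X l)"
  unfolding is_block_def by (auto intro!: blinfun_eqI simp: block_apply)

lemma block_of_block: "is_block j l a \<Longrightarrow> block j' a l' = (if j' = j \<and> l' = l then a else 0)"
proof (rule blinfun_eqI)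
  fix x assume a: "is_block j l a"
  have "block j' a l' x = P j' (P j (a (P l (P l' x))))"
    unfolding block_apply is_blockD[OF a] ..
  also have "\<dots> = (if j' = j then P j (a (if l = l' then P l' x else 0)) else 0)"
    by (simp only: P_P)
  finally show "block j' a l' x = (if j' = j \<and> l' = l then a else 0) x"
    using is_blockD[OF a] by simp
qed

text \<open>Rows have orthogonal ranges, and within a row the Cauchy-Schwarz inequality applies together
  with Bessel's inequality for the components of the argument. Hence families of blocks with square
  summable norms converge in operator norm.\<close>

lemma norm_sum_blocks_le:
  assumes F: "finite F" and a: "\<And>j l. (j, l) \<in> F \<Longrightarrow> is_block j l (a (j, l))"
  shows "(norm (sum a F))\<^sup>2 \<le> (\<Sum>i\<in>F. (norm (a i))\<^sup>2)"
proof -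
  define S where "S = (\<Sum>i\<in>F. (norm (a i))\<^sup>2)"
  have S0: "S \<ge> 0" unfolding S_def by (simp add: sum_nonneg)
  have "norm (sum a F x) \<le> sqrt S * norm x" for x
  proof -
    define J where "J = fst ` F"
    define C where "C j = {l. (j, l) \<in> F}" for j
    have FS: "F = Sigma J C" unfolding J_def C_def by force
    have fJ: "finite J" and fC: "\<And>j. finite (C j)"
      using F unfolding J_def C_def
      by (auto intro: finite_surj[of F _ snd] simp: image_iff) (use F in \<open>force intro: finite_surj[of F _ snd]\<close>)
    define w where "w j = (\<Sum>l\<in>C j. a (j, l) x)" for j
    have "sum a F x = (\<Sum>(j,l)\<in>Sigma J C. a (j, l) x)"
      by (simp add: blinfun.sum_left FS)
    also have "\<dots> = sum w J"
      unfolding w_def using fJ fC by (subst sum.Sigma) auto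
    finally have sw: "sum a F x = sum w J" .
    have "P j (w j) = w j" for j
      unfolding w_def blinfun.sum_right
      by (rule sum.cong) (auto simp: C_def is_blockD(1)[OF a])
    then have "(norm (sum w J))\<^sup>2 = (\<Sum>j\<in>J. (norm (w j))\<^sup>2)"
      by (intro norm_sum_sq fJ)
    also have "\<dots> \<le> (\<Sum>j\<in>J. (\<Sum>l\<in>C j. (norm (a (j, l)))\<^sup>2) * (norm x)\<^sup>2)"
    proof (rule sum_mono)
      fix j
      have "norm (w j) \<le> (\<Sum>l\<in>C j. norm (a (j, l)) * norm (P l x))"
        unfolding w_def
      proof (rule order_trans[OF norm_sum], rule sum_mono)
        fix l assume "l \<in> C j"
        then have "a (j, l) x = a (j, l) (P l x)" using is_blockD(2)[OF a] by (simp add: C_def)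
        then show "norm (a (j, l) x) \<le> norm (a (j, l)) * norm (P l x)"
          by (metis norm_blinfun)
      qed
      then have "(norm (w j))\<^sup>2 \<le> (\<Sum>l\<in>C j. norm (a (j, l)) * norm (P l x))\<^sup>2"
        by (intro power_mono) auto
      also have "\<dots> \<le> (\<Sum>l\<in>C j. (norm (a (j, l)))\<^sup>2) * (\<Sum>l\<in>C j. (norm (P l x))\<^sup>2)"
        by (rule Cauchy_Schwarz_ineq_sum)
      also have "\<dots> \<le> (\<Sum>l\<in>C j. (norm (a (j, l)))\<^sup>2) * (norm x)\<^sup>2"
        by (intro mult_left_mono bessel fC sum_nonneg) simp
      finally show "(norm (w j))\<^sup>2 \<le> (\<Sum>l\<in>C j. (norm (a (j, l)))\<^sup>2) * (norm x)\<^sup>2" .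
    qed
    also have "\<dots> = S * (norm x)\<^sup>2"
      unfolding S_def FS sum_distrib_right[symmetric]
      using fJ fC by (subst sum.Sigma) (auto intro!: sum.cong)
    also have "\<dots> = (sqrt S * norm x)\<^sup>2"
      using S0 by (simp add: power_mult_distrib)
    finally show ?thesis
      unfolding sw by (rule power2_le_imp_le) (simp add: S0)
  qed
  then have "norm (sum a F) \<le> sqrt S"
    by (intro norm_blinfun_bound) (simp_all add: S0)
  then have "(norm (sum a F))\<^sup>2 \<le> (sqrt S)\<^sup>2" by (intro power_mono) auto
  then show ?thesis using S0 by (simp add: S_def)
qed

lemma summable_blocks:
  assumes "(\<lambda>i. (norm (a i))\<^sup>2) summable_on A" "\<And>j l. (j, l) \<in> A \<Longrightarrow> is_block j l (a (j, l))"
  shows "a summable_on A"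
  by (rule summable_on_if_finite_sums_norm2_le[OF assms(1)])
     (rule norm_sum_blocks_le, use assms(2) in auto)

lemma block_infsum:
  assumes "a summable_on A" "\<And>j l. (j, l) \<in> A \<Longrightarrow> is_block j l (a (j, l))"
  shows "block j (infsum a A) l = (if (j, l) \<in> A then a (j, l) else 0)"
proof -
  have "((\<lambda>i. block j (a i) l) has_sum block j (infsum a A) l) A"
    using assms(1) by (intro has_sum_bounded_linear[OF bounded_linear_block]) simp
  moreover have "((\<lambda>i. block j (a i) l) has_sum (if (j, l) \<in> A then a (j, l) else 0)) A"
  proof (rule has_sum_finite_neutralI[of "{(j, l)} \<inter> A"])
    fix i assume "i \<in> A - {(j, l)} \<inter> A"
    then show "block j (a i) l = 0"
      using block_of_block[OF assms(2)[of "fst i" "snd i"]] by (cases i) auto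
  next
    show "(if (j, l) \<in> A then a (j, l) else 0) = (\<Sum>i\<in>{(j, l)} \<inter> A. block j (a i) l)"
      using block_of_block[OF assms(2)[of j l]] by auto
  qed auto
  ultimately show ?thesis using has_sum_unique by blast
qed

section \<open>The ideal of operators with square summable blocks\<close>

text \<open>Boundedness by \<open>r\<close> of the norm of the ideal. The norm itself would be an
  infinite sum whose existence had to be carried along; the predicate only speaks of finite sums, so
  that it passes to limits and records membership and the bound at once.\<close>

definition hs :: "real \<Rightarrow> ('e \<Rightarrow>\<^sub>L 'e) \<Rightarrow> bool" where
  "hs r X \<longleftrightarrow> X \<in> complex_operators \<and> 0 \<le> r \<and>
     (\<forall>F. finite F \<longrightarrow> (\<Sum>(j, l)\<in>F. (norm (block j X l))\<^sup>2) \<le> r\<^sup>2)"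

lemma hsD:
  assumes "hs r X"
  shows "X \<in> complex_operators" "0 \<le> r" "finite F \<Longrightarrow> (\<Sum>(j, l)\<in>F. (norm (block j X l))\<^sup>2) \<le> r\<^sup>2"
  using assms by (auto simp: hs_def)

lemma hs_summable: "hs r X \<Longrightarrow> (\<lambda>(j, l). (norm (block j X l))\<^sup>2) summable_on A"
  by (rule nonneg_bdd_above_summable_on) (auto intro!: bdd_aboveI[of _ "r\<^sup>2"] hsD(3))

lemma hs_weaken: "hs r X \<Longrightarrow> r \<le> s \<Longrightarrow> hs s X"
  unfolding hs_def by (meson order_trans power_mono)

lemma hs_has_sum:
  assumes "hs r X" shows "((\<lambda>(j, l). block j X l) has_sum X) UNIV"
proof -
  let ?a = "\<lambda>(j, l). block j X l"
  have s: "?a summable_on UNIV"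
    by (rule summable_blocks) (use hs_summable[OF assms] in \<open>auto simp: is_block_block split_def\<close>)
  have "infsum ?a UNIV = X"
    by (rule block_eqI) (subst block_infsum[OF s], auto simp: is_block_block)
  with s show ?thesis by (metis has_sum_infsum)
qed

lemma hs_norm: assumes "hs r X" shows "norm X \<le> r"
proof -
  let ?a = "\<lambda>(j, l). block j X l"
  have "((\<lambda>F. norm (sum ?a F)) \<longlongrightarrow> norm X) (finite_subsets_at_top UNIV)"
    using hs_has_sum[OF assms] unfolding has_sum_def by (rule tendsto_norm)
  moreover have "\<forall>\<^sub>F F in finite_subsets_at_top UNIV. norm (sum ?a F) \<le> r"
  proof (rule eventually_finite_subsets_at_top_weakI)
    fix F :: "(int \<times> int) set" assume F: "finite F"
    have "(norm (sum ?a F))\<^sup>2 \<le> (\<Sum>i\<in>F. (norm (?a i))\<^sup>2)"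
      by (rule norm_sum_blocks_le[OF F]) (simp add: is_block_block)
    also have "\<dots> \<le> r\<^sup>2" using hsD(3)[OF assms F] by (simp add: split_def)
    finally show "norm (sum ?a F) \<le> r" using hsD(2)[OF assms] by (rule power2_le_imp_le)
  qed
  ultimately show ?thesis
    using tendsto_upperbound finite_subsets_at_top_neq_bot by blast
qed

text \<open>The ball of the ideal is closed for convergence in operator norm, since each finite sum of
  squared block norms is continuous. This makes the ideal complete enough for fixed point
  iterations.\<close>

lemma hs_tendsto:
  assumes "\<And>n::nat. hs r (X n)" "X \<longlonglongrightarrow> Y"
  shows "hs r Y"
  unfolding hs_def
proof (intro conjI allI impI)
  show "Y \<in> complex_operators"
    by (rule complex_operators_tendsto[of X _ sequentially])
       (use assms in \<open>auto intro: blinfun.tendsto simp: hs_def\<close>)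
  show "0 \<le> r" using assms(1) hsD(2) by blast
  fix F :: "(int \<times> int) set" assume F: "finite F"
  have "(\<lambda>n. \<Sum>(j, l)\<in>F. (norm (block j (X n) l))\<^sup>2) \<longlonglongrightarrow> (\<Sum>(j, l)\<in>F. (norm (block j Y l))\<^sup>2)"
    unfolding split_def
    by (intro tendsto_intros bounded_linear.tendsto[OF bounded_linear_block] assms(2))
  then show "(\<Sum>(j, l)\<in>F. (norm (block j Y l))\<^sup>2) \<le> r\<^sup>2"
    by (rule LIMSEQ_le_const2) (use hsD(3)[OF assms(1) F] in blast)
qed

lemma hs_0: "hs 0 0"
  by (simp add: hs_def complex_operators_0 block_0)

lemma hs_L2_set: "hs r X \<Longrightarrow> finite F \<Longrightarrow> L2_set (\<lambda>(j, l). norm (block j X l)) F \<le> r"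
  unfolding L2_set_def using hsD(2)[of r X] hsD(3)[of r X F]
  by (auto intro!: real_le_lsqrt simp: split_def sum_nonneg)

lemma hs_if_L2_set:
  assumes "X \<in> complex_operators" "0 \<le> r"
    "\<And>F. finite F \<Longrightarrow> L2_set (\<lambda>(j, l). norm (block j X l)) F \<le> r"
  shows "hs r X"
  unfolding hs_def
proof (intro conjI allI impI assms(1,2))
  fix F :: "(int \<times> int) set" assume "finite F"
  from assms(3)[OF this] show "(\<Sum>(j, l)\<in>F. (norm (block j X l))\<^sup>2) \<le> r\<^sup>2"
    unfolding L2_set_def by (metis (mono_tags, lifting) split_def sqrt_le_D sum.cong)
qed

lemma hs_add: assumes "hs r X" "hs s Y" shows "hs (r + s) (X + Y)"
proof (rule hs_if_L2_set)
  show "X + Y \<in> complex_operators" using assms by (auto intro: complex_operators_add hsD)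
  show "0 \<le> r + s" using assms by (simp add: hs_def)
  fix F :: "(int \<times> int) set" assume F: "finite F"
  have "L2_set (\<lambda>(j, l). norm (block j (X + Y) l)) F
      \<le> L2_set (\<lambda>i. (case i of (j, l) \<Rightarrow> norm (block j X l)) + (case i of (j, l) \<Rightarrow> norm (block j Y l))) F"
    by (rule L2_set_mono) (auto simp: block_add norm_triangle_ineq)
  also have "\<dots> \<le> L2_set (\<lambda>(j, l). norm (block j X l)) F + L2_set (\<lambda>(j, l). norm (block j Y l)) F"
    by (rule L2_set_triangle_ineq)
  also have "\<dots> \<le> r + s" by (intro add_mono hs_L2_set assms F)
  finally show "L2_set (\<lambda>(j, l). norm (block j (X + Y) l)) F \<le> r + s" .
qed

lemma hs_uminus: assumes "hs r X" shows "hs r (- X)"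
proof -
  have "block j (- X) l = - block j X l" for j l
    by (rule blinfun_eqI) (simp add: block_apply blinfun.minus_left blinfun.minus_right)
  then show ?thesis using assms by (simp add: hs_def complex_operators_uminus)
qed

lemma hs_diff: "hs r X \<Longrightarrow> hs s Y \<Longrightarrow> hs (r + s) (X - Y)"
  using hs_add[of r X s "- Y"] hs_uminus[of s Y] by simp

lemma hs_diff_commute: "hs r (X - Y) \<Longrightarrow> hs r (Y - X)"
  using hs_uminus[of r "X - Y"] by simp

text \<open>Expanding an operator by columns converges in general only strongly; for an operator with
  range in a single \<open>P j\<close> and square summable columns it converges in norm.\<close>

lemma row_has_sum:
  assumes "P j o\<^sub>L A = A" "(\<lambda>n. (norm (A o\<^sub>L P n))\<^sup>2) summable_on UNIV"
  shows "((\<lambda>n. A o\<^sub>L P n) has_sum A) UNIV"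
proof -
  have PA: "P j (A x) = A x" for x by (metis assms(1) blinfun_apply_blinfun_compose)
  have isb: "is_block j n (A o\<^sub>L P n)" for n
    unfolding is_block_def by (auto intro!: blinfun_eqI simp: PA)
  have s: "(\<lambda>n. A o\<^sub>L P n) summable_on UNIV"
  proof (rule summable_on_if_finite_sums_norm2_le[OF assms(2)])
    fix F :: "int set" assume F: "finite F"
    have inj: "inj_on (Pair j) F" by (simp add: inj_on_def)
    have "(norm (\<Sum>i\<in>Pair j ` F. A o\<^sub>L P (snd i)))\<^sup>2 \<le> (\<Sum>i\<in>Pair j ` F. (norm (A o\<^sub>L P (snd i)))\<^sup>2)"
      by (rule norm_sum_blocks_le) (use F isb in auto)
    then show "(norm (\<Sum>n\<in>F. A o\<^sub>L P n))\<^sup>2 \<le> (\<Sum>n\<in>F. (norm (A o\<^sub>L P n))\<^sup>2)"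
      by (simp add: sum.reindex[OF inj])
  qed
  have "(\<Sum>\<^sub>\<infinity>n. A o\<^sub>L P n) x = A x" for x
  proof -
    have "((\<lambda>n. (A o\<^sub>L P n) x) has_sum (\<Sum>\<^sub>\<infinity>n. A o\<^sub>L P n) x) UNIV"
      using s by (intro has_sum_bounded_linear[OF blinfun.bounded_linear_left]) simp
    moreover have "((\<lambda>n. A (P n x)) has_sum A x) UNIV"
      by (intro has_sum_bounded_linear[OF blinfun.bounded_linear_right] P_has_sum)
    ultimately show ?thesis using has_sum_unique by simp
  qed
  then have "(\<Sum>\<^sub>\<infinity>n. A o\<^sub>L P n) = A" by (rule blinfun_eqI)
  with s show ?thesis by (metis has_sum_infsum)
qed

lemma hs_row_summable: "hs r X \<Longrightarrow> (\<lambda>n. (norm (block j X n))\<^sup>2) summable_on UNIV"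
  by (rule nonneg_bdd_above_summable_on)
     (auto intro!: bdd_aboveI[of _ "r\<^sup>2"] dest: hsD(3)[where F="Pair j ` _"] simp: sum.reindex inj_on_def)

lemma hs_row_has_sum: assumes "hs r X" shows "((\<lambda>n. block j X n) has_sum (P j o\<^sub>L X)) UNIV"
  using row_has_sum[of j "P j o\<^sub>L X"] hs_row_summable[OF assms]
  by (simp add: block_def) (metis (no_types, lifting) P_idem blinfun_apply_blinfun_compose blinfun_eqI)

text \<open>Matrix multiplication and the Cauchy-Schwarz inequality, as for scalar Hilbert-Schmidt
  matrices. The inner sum is first taken over a finite set of indices and then passed to the limit,
  which leaves only finite double sums to rearrange.\<close>

lemma hs_compose: assumes X: "hs r X" and Y: "hs s Y" shows "hs (r * s) (X o\<^sub>L Y)"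
  unfolding hs_def
proof (intro conjI allI impI)
  show "X o\<^sub>L Y \<in> complex_operators" using X Y by (auto intro: complex_operators_compose hsD)
  show "0 \<le> r * s" using X Y by (simp add: hs_def)
  fix F :: "(int \<times> int) set" assume F: "finite F"
  let ?f = "\<lambda>N j l. \<Sum>n\<in>N. block j X n o\<^sub>L block n Y l"
  have eq: "block j X n o\<^sub>L block n Y l = block j X n o\<^sub>L (Y o\<^sub>L P l)" for j n l
    by (rule blinfun_eqI) (simp add: block_apply)
  have "((\<lambda>n. block j X n o\<^sub>L block n Y l) has_sum block j (X o\<^sub>L Y) l) UNIV" for j l
  proof -
    have "((\<lambda>n. block j X n o\<^sub>L (Y o\<^sub>L P l)) has_sum ((P j o\<^sub>L X) o\<^sub>L (Y o\<^sub>L P l))) UNIV"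
      by (intro has_sum_bounded_linear[OF blinfun_compose.bounded_linear_left] hs_row_has_sum[OF X])
    moreover have "(P j o\<^sub>L X) o\<^sub>L (Y o\<^sub>L P l) = block j (X o\<^sub>L Y) l"
      by (rule blinfun_eqI) (simp add: block_apply)
    ultimately show ?thesis by (simp add: eq)
  qed
  then have "((\<lambda>N. \<Sum>(j, l)\<in>F. (norm (?f N j l))\<^sup>2) \<longlongrightarrow> (\<Sum>(j, l)\<in>F. (norm (block j (X o\<^sub>L Y) l))\<^sup>2))
      (finite_subsets_at_top UNIV)"
    unfolding has_sum_def split_def by (intro tendsto_intros)
  moreover have "\<forall>\<^sub>F N in finite_subsets_at_top UNIV. (\<Sum>(j, l)\<in>F. (norm (?f N j l))\<^sup>2) \<le> (r * s)\<^sup>2"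
  proof (rule eventually_finite_subsets_at_top_weakI)
    fix N :: "int set" assume N: "finite N"
    let ?J = "fst ` F" and ?L = "snd ` F"
    have le1: "(norm (?f N j l))\<^sup>2 \<le> (\<Sum>n\<in>N. (norm (block j X n))\<^sup>2) * (\<Sum>n\<in>N. (norm (block n Y l))\<^sup>2)" for j l
    proof -
      have "norm (?f N j l) \<le> (\<Sum>n\<in>N. norm (block j X n) * norm (block n Y l))"
        by (rule order_trans[OF norm_sum sum_mono[OF norm_blinfun_compose]])
      then have "(norm (?f N j l))\<^sup>2 \<le> (\<Sum>n\<in>N. norm (block j X n) * norm (block n Y l))\<^sup>2"
        by (intro power_mono) auto
      also have "\<dots> \<le> (\<Sum>n\<in>N. (norm (block j X n))\<^sup>2) * (\<Sum>n\<in>N. (norm (block n Y l))\<^sup>2)"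
        by (rule Cauchy_Schwarz_ineq_sum)
      finally show ?thesis .
    qed
    have "(\<Sum>(j, l)\<in>F. (norm (?f N j l))\<^sup>2) \<le> (\<Sum>(j, l)\<in>?J \<times> ?L. (norm (?f N j l))\<^sup>2)"
      by (rule sum_mono2) (use F in \<open>auto simp: image_iff, force+\<close>)
    also have "\<dots> \<le> (\<Sum>(j, l)\<in>?J \<times> ?L. (\<Sum>n\<in>N. (norm (block j X n))\<^sup>2) * (\<Sum>n\<in>N. (norm (block n Y l))\<^sup>2))"
      by (rule sum_mono) (use le1 in auto)
    also have "\<dots> = (\<Sum>j\<in>?J. \<Sum>n\<in>N. (norm (block j X n))\<^sup>2) * (\<Sum>l\<in>?L. \<Sum>n\<in>N. (norm (block n Y l))\<^sup>2)"
    proof -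
      have "(\<Sum>(j, l)\<in>?J \<times> ?L. f j * g l) = sum f ?J * sum g ?L" for f g :: "int \<Rightarrow> real"
        by (simp add: sum_product sum.cartesian_product)
      then show ?thesis .
    qed
    also have "\<dots> \<le> r\<^sup>2 * s\<^sup>2"
    proof (rule mult_mono)
      show "(\<Sum>j\<in>?J. \<Sum>n\<in>N. (norm (block j X n))\<^sup>2) \<le> r\<^sup>2"
        using hsD(3)[OF X, of "?J \<times> N"] F N by (simp add: sum.cartesian_product)
      show "(\<Sum>l\<in>?L. \<Sum>n\<in>N. (norm (block n Y l))\<^sup>2) \<le> s\<^sup>2"
        using hsD(3)[OF Y, of "N \<times> ?L"] F N by (subst sum.swap) (simp add: sum.cartesian_product)
    qed (auto intro!: sum_nonneg)
    finally show "(\<Sum>(j, l)\<in>F. (norm (?f N j l))\<^sup>2) \<le> (r * s)\<^sup>2" by (simp add: power_mult_distrib)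
  qed
  ultimately show "(\<Sum>(j, l)\<in>F. (norm (block j (X o\<^sub>L Y) l))\<^sup>2) \<le> (r * s)\<^sup>2"
    using tendsto_upperbound finite_subsets_at_top_neq_bot by blast
qed

lemma hs_from_blocks:
  assumes isb: "\<And>j l. is_block j l (a (j, l))" and c: "\<And>i. a i \<in> complex_operators"
    and r: "0 \<le> r" "\<And>F. finite F \<Longrightarrow> (\<Sum>i\<in>F. (norm (a i))\<^sup>2) \<le> r\<^sup>2"
  shows "\<exists>X. hs r X \<and> (\<forall>j l. block j X l = a (j, l))"
proof -
  have "(\<lambda>i. (norm (a i))\<^sup>2) summable_on UNIV"
    by (rule nonneg_bdd_above_summable_on) (auto intro!: bdd_aboveI[of _ "r\<^sup>2"] r)
  then have s: "a summable_on UNIV" by (rule summable_blocks) (rule isb)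
  have b: "block j (infsum a UNIV) l = a (j, l)" for j l
    by (simp add: block_infsum[OF s] isb)
  have "hs r (infsum a UNIV)"
    unfolding hs_def b using r complex_operators_infsum[OF s c] by (simp add: split_def)
  with b show ?thesis by blast
qed

section \<open>Schur multipliers\<close>

definition schur :: "(int \<Rightarrow> int \<Rightarrow> complex) \<Rightarrow> ('e \<Rightarrow>\<^sub>L 'e) \<Rightarrow> 'e \<Rightarrow>\<^sub>L 'e" where
  "schur w X = (\<Sum>\<^sub>\<infinity>(j, l). scalar_op (w j l) o\<^sub>L block j X l)"

lemma is_block_scalar: "is_block j l a \<Longrightarrow> is_block j l (scalar_op z o\<^sub>L a)"
  unfolding is_block_def
  by (metis (no_types, lifting) P_scaleC blinfun_apply_blinfun_compose blinfun_eqI scalar_op_apply)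

lemma schur:
  assumes X: "hs r X" and K: "\<And>j l. (cmod (w j l)) \<le> K"
  shows hs_schur: "hs (K * r) (schur w X)"
    and block_schur: "block j (schur w X) l = scalar_op (w j l) o\<^sub>L block j X l"
proof -
  let ?a = "\<lambda>(j, l). scalar_op (w j l) o\<^sub>L block j X l"
  have K0: "K \<ge> 0" using K[of 0 0] norm_ge_zero order_trans by blast
  have "\<exists>Y. hs (K * r) Y \<and> (\<forall>j l. block j Y l = ?a (j, l))"
  proof (rule hs_from_blocks)
    show "is_block j l (?a (j, l))" for j l
      by (simp add: is_block_scalar is_block_block)
    show "?a i \<in> complex_operators" for i
      by (auto simp: split_def intro!: complex_operators_compose scalar_op_complex block_complex hsD(1)[OF X])
    show "0 \<le> K * r" using K0 hsD(2)[OF X] by simp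
    fix F :: "(int \<times> int) set" assume F: "finite F"
    have "(\<Sum>i\<in>F. (norm (?a i))\<^sup>2) \<le> (\<Sum>i\<in>F. K\<^sup>2 * (norm (block (fst i) X (snd i)))\<^sup>2)"
    proof (rule sum_mono)
      fix i :: "int \<times> int"
      have "norm (?a i) \<le> K * norm (block (fst i) X (snd i))"
        unfolding split_def
        by (rule order_trans[OF norm_scalar_op_compose_le mult_right_mono[OF K norm_ge_zero]])
      from power_mono[OF this norm_ge_zero, of 2]
      show "(norm (?a i))\<^sup>2 \<le> K\<^sup>2 * (norm (block (fst i) X (snd i)))\<^sup>2"
        by (simp only: power_mult_distrib)
    qed
    also have "\<dots> \<le> K\<^sup>2 * r\<^sup>2"
      unfolding sum_distrib_left[symmetric]
      using hsD(3)[OF X F] by (intro mult_left_mono) (auto simp: split_def)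
    finally show "(\<Sum>i\<in>F. (norm (?a i))\<^sup>2) \<le> (K * r)\<^sup>2" by (simp only: power_mult_distrib)
  qed
  then obtain Y where Y: "hs (K * r) Y \<and> (\<forall>j l. block j Y l = ?a (j, l))" ..
  then have "(\<lambda>(j, l). block j Y l) = ?a" by auto
  then have "schur w X = Y"
    unfolding schur_def using hs_has_sum[of _ Y] Y infsumI by metis
  with Y show "hs (K * r) (schur w X)" "block j (schur w X) l = scalar_op (w j l) o\<^sub>L block j X l"
    by auto
qed

lemma schur_diff:
  assumes "hs r X" "hs s Y" "\<And>j l. (cmod (w j l)) \<le> K"
  shows "schur w (X - Y) = schur w X - schur w Y"
  by (rule block_eqI)
     (simp add: block_diff block_schur[OF assms(1,3)] block_schur[OF assms(2,3)]
       block_schur[OF hs_diff[OF assms(1,2)] assms(3)] blinfun_compose.diff_right)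

end

section \<open>Fixed points and inverses in the ideal\<close>

lemma blinfun_compose_assoc: "(A o\<^sub>L B) o\<^sub>L C = A o\<^sub>L (B o\<^sub>L C)"
  by (rule blinfun_eqI) simp

lemma id_blinfun_compose [simp]: "id_blinfun o\<^sub>L A = A" "A o\<^sub>L id_blinfun = A"
  by (rule blinfun_eqI, simp)+

context projection_system begin

text \<open>Iteration from \<open>0\<close>. Contraction is measured by \<open>hs\<close>, convergence
  by the operator norm: the distance of the \<open>n\<close>-th iterate to all later ones is at most
  \<open>2 r / 2 ^ n\<close>, where \<open>2 r\<close> is a convenient bound for the initial
  distance, and \<open>hs_tendsto\<close> transports this bound to the limit.\<close>

lemma hs_fixed_point:
  assumes r: "0 \<le> r"
    and maps: "\<And>Z. hs r Z \<Longrightarrow> hs r (\<Phi> Z)"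
    and lip: "\<And>Z Z' d. hs r Z \<Longrightarrow> hs r Z' \<Longrightarrow> hs d (Z - Z') \<Longrightarrow> hs (d / 2) (\<Phi> Z - \<Phi> Z')"
  shows "\<exists>Z. hs r Z \<and> \<Phi> Z = Z"
proof -
  define z where "z n = (\<Phi> ^^ n) 0" for n
  have z0: "z 0 = 0" and zS: "z (Suc n) = \<Phi> (z n)" for n by (simp_all add: z_def)
  have hz: "hs r (z n)" for n
    by (induction n) (use r in \<open>auto simp: z0 zS intro: maps hs_weaken[OF hs_0]\<close>)
  have step: "hs (2 * r / 2 ^ n) (z (n + m) - z n)" for n m
  proof (induction n)
    case 0 show ?case using hs_weaken[OF hz[of m], of "2 * r"] r by (simp add: z0)
  next
    case (Suc n) from lip[OF hz hz Suc] show ?case by (simp add: zS mult.commute)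
  qed
  have to0: "(\<lambda>n. 2 * r / 2 ^ n) \<longlonglongrightarrow> 0"
    using tendsto_mult_right_zero[OF LIMSEQ_power_zero[of "1/2::real"], of "2 * r"]
    by (simp add: power_one_over)
  have "Cauchy z"
    unfolding Cauchy_altdef2
  proof (intro allI impI)
    fix e :: real assume e: "e > 0"
    from order_tendstoD(2)[OF to0 e] obtain N where N: "2 * r / 2 ^ N < e"
      by (meson eventually_sequentially order_refl)
    have "dist (z n) (z N) < e" if "n \<ge> N" for n
      using hs_norm[OF step[of N "n - N"]] that N by (simp add: dist_norm)
    then show "\<exists>N. \<forall>n\<ge>N. dist (z n) (z N) < e" by blast
  qed
  then obtain Z where Z: "z \<longlonglongrightarrow> Z" using Cauchy_convergent convergent_def by blast
  have hZ: "hs r Z" by (rule hs_tendsto[OF hz Z])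
  have "hs (2 * r / 2 ^ n) (Z - z n)" for n
  proof (rule hs_tendsto)
    show "hs (2 * r / 2 ^ n) (z (n + m) - z n)" for m by (rule step)
    show "(\<lambda>m. z (n + m) - z n) \<longlonglongrightarrow> Z - z n"
      using LIMSEQ_ignore_initial_segment[OF Z, of n] by (intro tendsto_intros) (simp add: add.commute)
  qed
  from lip[OF hZ hz this] have "norm (\<Phi> Z - z (Suc n)) \<le> 2 * r / 2 ^ Suc n" for n
    using hs_norm by (fastforce simp: zS mult.commute)
  then have "(\<lambda>n. \<Phi> Z - z (Suc n)) \<longlonglongrightarrow> 0"
    by (intro Lim_null_comparison[OF _ LIMSEQ_Suc[OF to0]]) auto
  moreover have "(\<lambda>n. \<Phi> Z - z (Suc n)) \<longlonglongrightarrow> \<Phi> Z - Z"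
    by (intro tendsto_intros LIMSEQ_Suc[OF Z])
  ultimately have "\<Phi> Z = Z" using LIMSEQ_unique by fastforce
  with hZ show ?thesis by blast
qed

text \<open>The geometric series in operator norm would give the inverse, but not that it differs from
  the identity by an element of the ideal. Solving \<open>W = - M - M W\<close> inside the ideal
  gives a right inverse \<open>1 + W\<close>, solving \<open>W = - M - W M\<close> a left
  inverse, and the two coincide.\<close>

lemma hs_neumann:
  assumes M: "hs (1/2) M"
  shows "\<exists>W. hs 1 W \<and> (id_blinfun + M) o\<^sub>L (id_blinfun + W) = id_blinfun \<and>
    (id_blinfun + W) o\<^sub>L (id_blinfun + M) = id_blinfun"
proof -
  have "\<exists>W. hs 1 W \<and> - M - (M o\<^sub>L W) = W"
  proof (rule hs_fixed_point)
    show "hs 1 (- M - (M o\<^sub>L W))" if "hs 1 W" for W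
      using hs_diff[OF hs_uminus[OF M] hs_compose[OF M that]] by simp
    show "hs (d / 2) ((- M - (M o\<^sub>L Z)) - (- M - (M o\<^sub>L Z')))" if "hs d (Z - Z')" for Z Z' d
      using hs_compose[OF M hs_diff_commute[OF that]] by (simp add: blinfun_compose.diff_right)
  qed simp
  then obtain W where W: "hs 1 W" "- M - (M o\<^sub>L W) = W" by blast
  have "\<exists>W. hs 1 W \<and> - M - (W o\<^sub>L M) = W"
  proof (rule hs_fixed_point)
    show "hs 1 (- M - (W o\<^sub>L M))" if "hs 1 W" for W
      using hs_diff[OF hs_uminus[OF M] hs_compose[OF that M]] by simp
    show "hs (d / 2) ((- M - (Z o\<^sub>L M)) - (- M - (Z' o\<^sub>L M)))" if "hs d (Z - Z')" for Z Z' d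
      using hs_compose[OF hs_diff_commute[OF that] M] by (simp add: blinfun_compose.diff_left)
  qed simp
  then obtain W' where W': "- M - (W' o\<^sub>L M) = W'" by blast
  have right: "(id_blinfun + M) o\<^sub>L (id_blinfun + W) = id_blinfun"
  proof -
    have "M + (M o\<^sub>L W) = - W" using W(2) by (metis add.inverse_inverse minus_add_distrib diff_conv_add_uminus)
    then have "W + (M + (M o\<^sub>L W)) = 0" by simp
    then show ?thesis by (simp add: blinfun_compose.add_left blinfun_compose.add_right ac_simps)
  qed
  have left: "(id_blinfun + W') o\<^sub>L (id_blinfun + M) = id_blinfun"
  proof -
    have "M + (W' o\<^sub>L M) = - W'" using W' by (metis add.inverse_inverse minus_add_distrib diff_conv_add_uminus)
    then have "W' + (M + (W' o\<^sub>L M)) = 0" by simp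
    then show ?thesis by (simp add: blinfun_compose.add_left blinfun_compose.add_right ac_simps)
  qed
  have "id_blinfun + W' = id_blinfun + W"
    using blinfun_compose_assoc[of "id_blinfun + W'" "id_blinfun + M" "id_blinfun + W"]
    unfolding left right by simp
  with W(1) left right show ?thesis by metis
qed

end

section \<open>The diagonal operator and its commutators\<close>

locale frequency_system = projection_system P
  for P :: "int \<Rightarrow> 'e::complex_hilbert \<Rightarrow>\<^sub>L 'e" +
  fixes c :: real
  assumes c_pos: "c > 0"
begin

definition freq :: "int \<Rightarrow> complex" where
  "freq l = \<i> * complex_of_real (c * of_int l)"

text \<open>The graph of the diagonal operator with eigenvalues \<open>freq l\<close>. The condition on
  \<open>x\<close> to belong to the domain is hidden in the existence of the vector
  \<open>u\<close>.\<close>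

definition G0 :: "('e \<times> 'e) set" where
  "G0 = {(x, u). \<forall>l. P l u = freq l *\<^sub>C P l x}"

lemma G0_iff: "(x, u) \<in> G0 \<longleftrightarrow> (\<forall>l. P l u = freq l *\<^sub>C P l x)"
  by (simp add: G0_def)

lemma G0_unique: "(x, u) \<in> G0 \<Longrightarrow> (x, u') \<in> G0 \<Longrightarrow> u = u'"
  by (rule vector_eqI) (simp add: G0_iff)

lemma G0_add: "(x, u) \<in> G0 \<Longrightarrow> (y, v) \<in> G0 \<Longrightarrow> (x + y, u + v) \<in> G0"
  by (simp add: G0_iff blinfun.add_right scaleC.add_right)

lemma G0_diff: "(x, u) \<in> G0 \<Longrightarrow> (y, v) \<in> G0 \<Longrightarrow> (x - y, u - v) \<in> G0"
  by (simp add: G0_iff blinfun.diff_right scaleC.diff_right)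

text \<open>The identity \<open>G0 M - M G0 = V - J\<close> for a possibly unbounded
  \<open>V\<close> given by its rows \<open>R j\<close>. If \<open>M\<close> arises from
  \<open>V\<close> by multiplying the entries with \<open>w j l\<close>, then the commutator
  multiplies them by \<open>(freq j - freq l) * w j l\<close>, and \<open>J\<close> collects
  what differs from \<open>V\<close>. In particular, \<open>M\<close> maps the domain of
  \<open>G0\<close> into itself.\<close>

lemma G0_commutator:
  assumes xu: "(x, u) \<in> G0" and R: "\<And>j. R j \<in> complex_operators"
    and M: "\<And>j l. block j M l = scalar_op (w j l) o\<^sub>L (R j o\<^sub>L P l)"
    and J: "\<And>j l. block j J l = scalar_op (1 - (freq j - freq l) * w j l) o\<^sub>L (R j o\<^sub>L P l)"
    and v: "\<And>j. P j v = R j x"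
  shows "(M x, M u + v - J x) \<in> G0"
  unfolding G0_iff
proof
  fix j
  have hsum: "((\<lambda>l. A (P l y)) has_sum A y) UNIV" for A :: "'e \<Rightarrow>\<^sub>L 'e" and y
    by (intro has_sum_bounded_linear[OF blinfun.bounded_linear_right] P_has_sum)
  have M': "P j (M (P l y)) = w j l *\<^sub>C R j (P l y)" for l y
    using arg_cong[OF M[of j l], of "\<lambda>A. A y"] by (simp add: block_apply)
  have J': "P j (J (P l y)) = (1 - (freq j - freq l) * w j l) *\<^sub>C R j (P l y)" for l y
    using arg_cong[OF J[of j l], of "\<lambda>A. A y"] by (simp add: block_apply)
  have Pu: "P l u = freq l *\<^sub>C P l x" for l using xu by (simp add: G0_iff)
  have "((\<lambda>l. w j l *\<^sub>C R j (P l u)) has_sum P j (M u)) UNIV"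
    using hsum[of "P j o\<^sub>L M" u] by (simp add: M')
  moreover have "((\<lambda>l. R j (P l x)) has_sum P j v) UNIV"
    using hsum[of "R j" x] by (simp add: v)
  moreover have "((\<lambda>l. (1 - (freq j - freq l) * w j l) *\<^sub>C R j (P l x)) has_sum P j (J x)) UNIV"
    using hsum[of "P j o\<^sub>L J" x] by (simp add: J')
  ultimately have "((\<lambda>l. w j l *\<^sub>C R j (P l u) + R j (P l x)
      + - ((1 - (freq j - freq l) * w j l) *\<^sub>C R j (P l x))) has_sum (P j (M u) + P j v + - P j (J x))) UNIV"
    by (intro has_sum_add has_sum_uminus[THEN iffD2]) auto
  moreover have "w j l *\<^sub>C R j (P l u) + R j (P l x) + - ((1 - (freq j - freq l) * w j l) *\<^sub>C R j (P l x))
      = freq j *\<^sub>C (w j l *\<^sub>C R j (P l x))" for l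
  proof -
    have "(w j l * freq l) *\<^sub>C y + y - (1 - (freq j - freq l) * w j l) *\<^sub>C y = (freq j * w j l) *\<^sub>C y" for y :: 'e
      by (simp add: scaleC.diff_left scaleC.add_left left_diff_distrib right_diff_distrib mult.commute)
    then show ?thesis
      by (simp add: Pu complex_operatorsD[OF R] scaleC_scaleC)
  qed
  moreover have "((\<lambda>l. freq j *\<^sub>C (w j l *\<^sub>C R j (P l x))) has_sum freq j *\<^sub>C P j (M x)) UNIV"
    using hsum[of "P j o\<^sub>L M" x]
    by (intro has_sum_bounded_linear[OF scaleC.bounded_linear_right]) (simp add: M')
  ultimately show "P j (M u + v - J x) = freq j *\<^sub>C P j (M x)"
    using has_sum_unique by (simp add: blinfun.add_right blinfun.diff_right)
qed

section \<open>Resolvents\<close>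

lemma cmod_freq_diff: "(cmod (freq l - complex_of_real \<mu>))\<^sup>2 = c\<^sup>2 * (of_int l)\<^sup>2 + \<mu>\<^sup>2"
  by (simp add: freq_def cmod_power2 power_mult_distrib)

lemma summable_inverse_square: "(\<lambda>l::int. 1 / (c\<^sup>2 * (of_int l)\<^sup>2 + 1)) summable_on UNIV"
proof -
  let ?f = "\<lambda>l::int. 1 / (c\<^sup>2 * (of_int l)\<^sup>2 + 1 :: real)"
  have pos: "c\<^sup>2 * (of_int l)\<^sup>2 + 1 > (0::real)" for l :: int
    by (simp add: add_nonneg_pos)
  have "summable (\<lambda>n. 1 / c\<^sup>2 * (1 / real n ^ 2))"
    using inverse_power_summable[of 2, where 'a=real] by (intro summable_mult) (simp add: inverse_eq_divide)
  then have "summable (\<lambda>n. ?f (int n))"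
  proof (rule summable_comparison_test_ev[rotated], intro eventually_sequentiallyI[of 1])
    fix n :: nat assume "n \<ge> 1"
    then have "1 / (c\<^sup>2 * (real n)\<^sup>2 + 1) \<le> 1 / (c\<^sup>2 * (real n)\<^sup>2)"
      using c_pos by (intro divide_left_mono mult_pos_pos add_pos_pos) auto
    then show "norm (?f (int n)) \<le> 1 / c\<^sup>2 * (1 / real n ^ 2)"
      using pos[of "int n"] by simp
  qed
  then have nat: "(\<lambda>n. ?f (int n)) summable_on UNIV"
    using pos by (intro summable_nonneg_imp_summable_on) (simp_all add: less_imp_le)
  have 1: "?f summable_on range int"
    using nat by (subst summable_on_reindex) (auto simp: o_def)
  have 2: "?f summable_on range (\<lambda>n. - int n)"
    using nat by (subst summable_on_reindex) (auto simp: o_def inj_on_def)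
  have "range int \<union> range (\<lambda>n. - int n) = UNIV"
    by (auto simp: image_iff) (metis int_cases2)
  with summable_on_union[OF 1 2] show ?thesis by simp
qed

text \<open>The components of \<open>x\<close> are those of \<open>u - \<mu> *\<^sub>R x\<close>
  divided by numbers of modulus \<open>sqrt (c\<^sup>2 l\<^sup>2 + \<mu>\<^sup>2)\<close>; apply the
  Cauchy-Schwarz inequality.\<close>

lemma sum_P_le_resolvent:
  assumes xu: "(x, u) \<in> G0" and F: "finite F" and \<mu>: "\<mu> \<ge> 1"
  shows "(\<Sum>l\<in>F. norm (P l x)) \<le> sqrt (\<Sum>l\<in>F. 1 / (c\<^sup>2 * (of_int l)\<^sup>2 + \<mu>\<^sup>2)) * norm (u - \<mu> *\<^sub>R x)"
proof -
  define w where "w = u - \<mu> *\<^sub>R x"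
  define h where "h l = c\<^sup>2 * (of_int l)\<^sup>2 + \<mu>\<^sup>2" for l :: int
  have h: "h l > 0" for l unfolding h_def using \<mu> by (simp add: add_nonneg_pos)
  have Pw: "norm (P l x) = sqrt (1 / h l) * norm (P l w)" for l
  proof -
    have "P l w = (freq l - complex_of_real \<mu>) *\<^sub>C P l x"
      using xu by (simp add: w_def G0_iff blinfun.diff_right scaleR_scaleC P_scaleC scaleC.diff_left)
    then have "norm (P l w) = sqrt (h l) * norm (P l x)"
      by (simp add: norm_scaleC h_def cmod_freq_diff[symmetric])
    then show ?thesis using h[of l] by (simp add: real_sqrt_divide)
  qed
  have "(\<Sum>l\<in>F. norm (P l x))\<^sup>2 = (\<Sum>l\<in>F. sqrt (1 / h l) * norm (P l w))\<^sup>2" by (simp only: Pw)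
  also have "\<dots> \<le> (\<Sum>l\<in>F. (sqrt (1 / h l))\<^sup>2) * (\<Sum>l\<in>F. (norm (P l w))\<^sup>2)"
    by (rule Cauchy_Schwarz_ineq_sum)
  also have "\<dots> \<le> (\<Sum>l\<in>F. 1 / h l) * (norm w)\<^sup>2"
    using h by (intro mult_mono bessel F sum_nonneg) (auto simp: less_imp_le)
  also have "\<dots> = (sqrt (\<Sum>l\<in>F. 1 / h l) * norm w)\<^sup>2"
    using h by (simp add: power_mult_distrib sum_nonneg less_imp_le)
  finally show ?thesis
    unfolding w_def h_def by (rule power2_le_imp_le) (auto intro!: mult_nonneg_nonneg sum_nonneg add_nonneg_nonneg)
qed

lemma G0_abs_summable: assumes "(x, u) \<in> G0" shows "(\<lambda>l. norm (P l x)) summable_on UNIV"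
proof (rule nonneg_bdd_above_summable_on)
  let ?S = "\<Sum>\<^sub>\<infinity>l::int. 1 / (c\<^sup>2 * (of_int l)\<^sup>2 + 1 :: real)"
  have "(\<Sum>l\<in>F. norm (P l x)) \<le> sqrt ?S * norm (u - x)" if F: "finite F" for F
  proof -
    have "(\<Sum>l\<in>F. norm (P l x)) \<le> sqrt (\<Sum>l\<in>F. 1 / (c\<^sup>2 * (of_int l)\<^sup>2 + 1\<^sup>2)) * norm (u - 1 *\<^sub>R x)"
      by (rule sum_P_le_resolvent[OF assms F]) simp
    also have "\<dots> \<le> sqrt ?S * norm (u - x)"
      using finite_sum_le_infsum[OF summable_inverse_square F] by (auto intro!: mult_right_mono)
    finally show ?thesis .
  qed
  then show "bdd_above (sum (\<lambda>l. norm (P l x)) ` {F. F \<subseteq> UNIV \<and> finite F})"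
    by (auto intro!: bdd_aboveI[of _ "sqrt ?S * norm (u - x)"])
qed simp

text \<open>The sum of \<open>1 / (c\<^sup>2 l\<^sup>2 + \<mu>\<^sup>2)\<close> tends to
  \<open>0\<close> as \<open>\<mu>\<close> grows: a tail is small uniformly in
  \<open>\<mu> \<ge> 1\<close>, and each of the remaining finitely many terms is at most
  \<open>1 / \<mu>\<close>.\<close>

lemma resolvent_gain:
  assumes e: "e > 0"
  shows "\<exists>\<mu>0\<ge>1. \<forall>\<mu>\<ge>\<mu>0. \<forall>x u. (x, u) \<in> G0 \<longrightarrow> (\<Sum>\<^sub>\<infinity>l. norm (P l x)) \<le> e * norm (u - \<mu> *\<^sub>R x)"
proof -
  define h where "h l = 1 / (c\<^sup>2 * (of_int l)\<^sup>2 + 1 :: real)" for l :: int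
  have hs: "h summable_on UNIV" unfolding h_def by (rule summable_inverse_square)
  have h0: "h l \<ge> 0" for l unfolding h_def by simp
  have "eventually (\<lambda>S. dist (sum h S) (infsum h UNIV) < e\<^sup>2/2) (finite_subsets_at_top UNIV)"
    by (rule tendstoD[OF infsum_tendsto[OF hs]]) (use e in simp)
  then obtain S where S: "finite S" "dist (sum h S) (infsum h UNIV) < e\<^sup>2/2"
    unfolding eventually_finite_subsets_at_top by (meson order_refl subset_UNIV)
  define \<mu>0 where "\<mu>0 = 1 + 2 * real (card S) / e\<^sup>2"
  have mu0: "\<mu>0 \<ge> 1" unfolding \<mu>0_def using e by simp
  have "(\<Sum>\<^sub>\<infinity>l. norm (P l x)) \<le> e * norm (u - \<mu> *\<^sub>R x)" if mu: "\<mu> \<ge> \<mu>0" and xu: "(x, u) \<in> G0" for \<mu> x u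
  proof (rule infsum_le_finite_sums[OF G0_abs_summable[OF xu]])
    fix F :: "int set" assume F: "finite F"
    have mu1: "\<mu> \<ge> 1" using mu mu0 by linarith
    let ?h = "\<lambda>l::int. 1 / (c\<^sup>2 * (of_int l)\<^sup>2 + \<mu>\<^sup>2)"
    have "sum ?h F \<le> e\<^sup>2"
    proof -
      have mu2: "\<mu>\<^sup>2 \<ge> \<mu>" using mu1 by (simp add: power2_eq_square)
      have "sum ?h F = sum ?h (F \<inter> S) + sum ?h (F - S)" using F by (simp add: sum.Int_Diff)
      moreover have "sum ?h (F \<inter> S) \<le> e\<^sup>2 / 2"
      proof -
        have "?h l \<le> 1 / \<mu>" for l
          using mu1 mu2 by (intro divide_left_mono mult_pos_pos add_nonneg_pos) (auto intro: order_trans[OF mu2])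
        then have "sum ?h (F \<inter> S) \<le> real (card (F \<inter> S)) * (1 / \<mu>)"
          by (intro sum_bounded_above)
        also have "\<dots> \<le> real (card S) * (1 / \<mu>)"
          using mu1 S(1) by (intro mult_right_mono) (auto intro!: card_mono)
        also have "\<dots> \<le> e\<^sup>2 / 2"
        proof -
          have "2 * real (card S) / e\<^sup>2 \<le> \<mu>" using mu unfolding \<mu>0_def by linarith
          then show ?thesis using mu1 e by (simp add: field_simps)
        qed
        finally show ?thesis .
      qed
      moreover have "sum ?h (F - S) \<le> e\<^sup>2 / 2"
      proof -
        have "1 \<le> \<mu>\<^sup>2" using mu1 mu2 by linarith
        then have "?h l \<le> h l" for l
          unfolding h_def by (intro divide_left_mono mult_pos_pos add_nonneg_pos) auto
        then have "sum ?h (F - S) \<le> sum h (F - S)" by (rule sum_mono)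
        also have "\<dots> = sum h (F \<union> S) - sum h S"
          using F S(1) by (metis Diff_cancel Un_Diff Un_upper2 finite_UnI sum_diff sup_bot.right_neutral)
        also have "\<dots> \<le> infsum h UNIV - sum h S"
          using finite_sum_le_infsum[OF hs, of "F \<union> S"] h0 F S(1) by auto
        also have "\<dots> \<le> e\<^sup>2 / 2" using S(2) unfolding dist_real_def abs_less_iff by linarith
        finally show ?thesis .
      qed
      ultimately show ?thesis by linarith
    qed
    then have "sqrt (sum ?h F) \<le> e" using e by (simp add: real_le_lsqrt real_sqrt_le_iff flip: real_sqrt_abs)
    then have "sqrt (sum ?h F) * norm (u - \<mu> *\<^sub>R x) \<le> e * norm (u - \<mu> *\<^sub>R x)"
      by (rule mult_right_mono) simp
    with sum_P_le_resolvent[OF xu F mu1] show "(\<Sum>l\<in>F. norm (P l x)) \<le> e * norm (u - \<mu> *\<^sub>R x)"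
      by linarith
  qed
  with mu0 show ?thesis by blast
qed

lemma resolvent_exists:
  assumes mu: "\<mu> \<ge> 1"
  obtains R :: "'e \<Rightarrow>\<^sub>L 'e" where "\<And>w. (R w, w + \<mu> *\<^sub>R R w) \<in> G0" "\<And>w. norm (R w) \<le> norm w / \<mu>"
proof -
  define m where "m l = 1 / (freq l - complex_of_real \<mu>)" for l
  have ge: "cmod (freq l - complex_of_real \<mu>) \<ge> \<mu>" for l
    by (rule power2_le_imp_le) (simp_all add: cmod_freq_diff)
  have m: "cmod (m l) \<le> 1 / \<mu>" for l
    unfolding m_def using ge[of l] mu by (simp add: norm_divide frac_le)
  have "P l (w + \<mu> *\<^sub>R diag_op m w) = freq l *\<^sub>C P l (diag_op m w)" for l w
  proof -
    have nz: "freq l - complex_of_real \<mu> \<noteq> 0" using ge[of l] mu by auto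
    have "freq l * m l = 1 + complex_of_real \<mu> * m l"
      using nz by (simp add: m_def field_simps)
    then show ?thesis
      by (simp add: P_diag_op[of m "1 / \<mu>", OF m] blinfun.add_right scaleR_scaleC P_scaleC scaleC_scaleC scaleC_add_left)
  qed
  moreover have "norm (diag_op m w) \<le> norm w / \<mu>" for w
    using norm_diag_op_le[of m "1 / \<mu>" w, OF m] by simp
  ultimately show ?thesis by (intro that[of "diag_op m"]) (auto simp: G0_iff)
qed

text \<open>The assumption on \<open>N\<close> says \<open>G0 (1 + M) = (1 + M) G0 + N\<close>
  on the domain, hence \<open>(G0 - \<mu>) (1 + M) R = 1 + M + N R\<close> for the
  resolvent \<open>R = (G0 - \<mu>)\<^sup>-\<^sup>1\<close>. The right hand side is invertible by
  contraction if \<open>N R\<close> has norm at most \<open>1/4\<close>, which the bound on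
  \<open>N\<close> ensures for large \<open>\<mu>\<close>. So for \<open>y\<close> in the domain there
  is \<open>x\<close> in the domain such that \<open>(G0 - \<mu>) (x + M x - y) = 0\<close>,
  and \<open>G0 - \<mu>\<close> is injective, its eigenvalues being nonzero.\<close>

lemma id_plus_onto_domain:
  fixes M :: "'e \<Rightarrow>\<^sub>L 'e"
  assumes M: "norm M \<le> 1/2"
    and N: "\<And>x u. (x, u) \<in> G0 \<Longrightarrow> (M x, M u + N x) \<in> G0"
    and bound: "\<And>x u. (x, u) \<in> G0 \<Longrightarrow> norm (N x) \<le> Ka * (\<Sum>\<^sub>\<infinity>l. norm (P l x)) + Kb * norm x"
    and K: "Ka \<ge> 0" "Kb \<ge> 0"
    and y: "(y, v) \<in> G0"
  shows "\<exists>x u. (x, u) \<in> G0 \<and> x + M x = y"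
proof -
  obtain \<mu>0 where mu0: "\<mu>0 \<ge> 1"
    "\<And>\<mu> x u. \<mu> \<ge> \<mu>0 \<Longrightarrow> (x, u) \<in> G0 \<Longrightarrow> (\<Sum>\<^sub>\<infinity>l. norm (P l x)) \<le> 1 / (8 * (Ka + 1)) * norm (u - \<mu> *\<^sub>R x)"
    using resolvent_gain[of "1 / (8 * (Ka + 1))"] K by (auto simp: add_nonneg_pos)
  \<comment> \<open>Both terms of the bound on \<open>N\<close> contribute at most \<open>1/8\<close> to the norm of \<open>N R\<close>.\<close>
  define \<mu> where "\<mu> = max \<mu>0 (8 * Kb)"
  have mu: "\<mu> \<ge> 1" "\<mu> \<ge> \<mu>0" "\<mu> \<ge> 8 * Kb" using mu0(1) by (auto simp: \<mu>_def)
  obtain R :: "'e \<Rightarrow>\<^sub>L 'e" where R: "\<And>w. (R w, w + \<mu> *\<^sub>R R w) \<in> G0" "\<And>w. norm (R w) \<le> norm w / \<mu>"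
    using resolvent_exists[OF mu(1)] by metis
  \<comment> \<open>\<open>N\<close> is an arbitrary function, but on the domain it is determined by a linear relation.\<close>
  have Ndiff: "N (x - x') = N x - N x'" if "(x, u) \<in> G0" "(x', u') \<in> G0" for x x' u u'
  proof -
    have "(M (x - x'), M (u - u') + N (x - x')) \<in> G0" by (rule N[OF G0_diff[OF that]])
    moreover have "(M (x - x'), M (u - u') + (N x - N x')) \<in> G0"
      using G0_diff[OF N[OF that(1)] N[OF that(2)]] by (simp add: blinfun.diff_right algebra_simps)
    ultimately have "M (u - u') + N (x - x') = M (u - u') + (N x - N x')" by (rule G0_unique)
    then show ?thesis by simp
  qed
  have NR: "norm (N (R w)) \<le> 1/4 * norm w" for w
  proof -
    have "norm (N (R w)) \<le> Ka * (\<Sum>\<^sub>\<infinity>l. norm (P l (R w))) + Kb * norm (R w)"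
      by (rule bound[OF R(1)])
    also have "\<dots> \<le> Ka * (1 / (8 * (Ka + 1)) * norm w) + Kb * (norm w / \<mu>)"
      using mu0(2)[OF mu(2) R(1)[of w]] R(2)[of w] K by (intro add_mono mult_left_mono) auto
    also have "\<dots> \<le> 1/8 * norm w + 1/8 * norm w"
    proof (rule add_mono)
      have "Ka / (8 * (Ka + 1)) \<le> 1/8" using K by (simp add: field_simps)
      then have "Ka / (8 * (Ka + 1)) * norm w \<le> 1/8 * norm w" by (rule mult_right_mono) simp
      then show "Ka * (1 / (8 * (Ka + 1)) * norm w) \<le> 1/8 * norm w" by simp
      have "Kb / \<mu> \<le> 1/8" using mu by (simp add: field_simps)
      then have "Kb / \<mu> * norm w \<le> 1/8 * norm w" by (rule mult_right_mono) simp
      then show "Kb * (norm w / \<mu>) \<le> 1/8 * norm w" by simp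
    qed
    finally show ?thesis by simp
  qed
  \<comment> \<open>A fixed point of \<open>f\<close> solves \<open>(1 + M + N R) z = (G0 - \<mu>) y\<close>.\<close>
  define w where "w = v - \<mu> *\<^sub>R y"
  define f where "f z = w - M z - N (R z)" for z
  have "\<exists>!z. f z = z"
  proof (rule banach_fix_type[where c = "3/4"])
    show "\<forall>z z'. dist (f z) (f z') \<le> 3/4 * dist z z'"
    proof (intro allI)
      fix z z'
      have eq: "f z - f z' = - (M (z - z') + N (R (z - z')))"
        by (simp add: f_def blinfun.diff_right Ndiff[OF R(1) R(1)])
      have "norm (f z - f z') \<le> norm (M (z - z')) + norm (N (R (z - z')))"
        unfolding eq norm_minus_cancel by (rule norm_triangle_ineq)
      also have "norm (M (z - z')) \<le> 1/2 * norm (z - z')"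
        using norm_blinfun[of M "z - z'"] mult_right_mono[OF M, of "norm (z - z')"] by simp
      finally show "dist (f z) (f z') \<le> 3/4 * dist z z'"
        using NR[of "z - z'"] unfolding dist_norm by linarith
    qed
  qed auto
  then obtain z where z: "f z = z" by blast
  define x where "x = R z"
  have xu: "(x, z + \<mu> *\<^sub>R x) \<in> G0" unfolding x_def by (rule R(1))
  have "(x + M x, (z + \<mu> *\<^sub>R x) + (M (z + \<mu> *\<^sub>R x) + N x)) \<in> G0"
    by (intro G0_add xu N)
  moreover have "(z + \<mu> *\<^sub>R x) + (M (z + \<mu> *\<^sub>R x) + N x) = w + \<mu> *\<^sub>R (x + M x)"
    using z by (simp add: f_def x_def blinfun.add_right blinfun.scaleR_right scaleR_add_right algebra_simps)
  ultimately have "(x + M x - y, w + \<mu> *\<^sub>R (x + M x) - v) \<in> G0"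
    using G0_diff y by metis
  moreover have "w + \<mu> *\<^sub>R (x + M x) - v = \<mu> *\<^sub>R (x + M x - y)"
    by (simp add: w_def scaleR_diff_right)
  ultimately have "(x + M x - y, \<mu> *\<^sub>R (x + M x - y)) \<in> G0" by simp
  define h where "h = x + M x - y"
  have hG: "(h, \<mu> *\<^sub>R h) \<in> G0" unfolding h_def by fact
  have "P l h = 0" for l
    using sum_P_le_resolvent[OF hG, of "{l}" \<mu>] mu(1) by simp
  then have "x + M x = y" using P_complete[of h] by (simp add: h_def)
  with xu show ?thesis by auto
qed

section \<open>Block diagonalization of bounded perturbations\<close>

lemma hs_tail:
  assumes "hs r X" "e > 0"
  shows "\<exists>S. finite S \<and> (\<forall>F. finite F \<longrightarrow> F \<inter> S = {} \<longrightarrow> (\<Sum>(j, l)\<in>F. (norm (block j X l))\<^sup>2) \<le> e\<^sup>2)"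
proof -
  let ?h = "\<lambda>(j, l). (norm (block j X l))\<^sup>2"
  have s: "?h summable_on UNIV" by (rule hs_summable[OF assms(1)])
  have "eventually (\<lambda>S. dist (sum ?h S) (infsum ?h UNIV) < e\<^sup>2) (finite_subsets_at_top UNIV)"
    by (rule tendstoD[OF infsum_tendsto[OF s]]) (use assms(2) in simp)
  then obtain S where S: "finite S" "dist (sum ?h S) (infsum ?h UNIV) < e\<^sup>2"
    unfolding eventually_finite_subsets_at_top by (meson order_refl subset_UNIV)
  have "sum ?h F \<le> e\<^sup>2" if F: "finite F" "F \<inter> S = {}" for F
  proof -
    have "sum ?h F = sum ?h (F \<union> S) - sum ?h S"
      using F S(1) by (simp add: sum.union_disjoint)
    also have "\<dots> \<le> infsum ?h UNIV - sum ?h S"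
      using finite_sum_le_infsum[OF s, of "F \<union> S"] F S(1) by auto
    also have "\<dots> \<le> e\<^sup>2" using S(2) unfolding dist_real_def abs_less_iff by linarith
    finally show ?thesis .
  qed
  with S(1) show ?thesis by blast
qed

lemma hs_restrict:
  assumes X: "hs r X" and e: "0 \<le> e"
    and S: "\<And>F. finite F \<Longrightarrow> F \<inter> S = {} \<Longrightarrow> (\<Sum>(j, l)\<in>F. (norm (block j X l))\<^sup>2) \<le> e\<^sup>2"
  shows "\<exists>Y. hs e Y \<and> (\<forall>j l. block j Y l = (if (j, l) \<in> S then 0 else block j X l))"
proof -
  let ?a = "\<lambda>(j, l). if (j, l) \<in> S then 0 else block j X l"
  have "\<exists>Y. hs e Y \<and> (\<forall>j l. block j Y l = ?a (j, l))"
  proof (rule hs_from_blocks)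
    show "is_block j l (?a (j, l))" for j l
      using is_block_block[of j l X] by (auto simp: is_block_def)
    show "?a i \<in> complex_operators" for i
      by (auto simp: split_def complex_operators_0 intro: block_complex hsD(1)[OF X])
    fix F :: "(int \<times> int) set" assume F: "finite F"
    have "(\<Sum>i\<in>F. (norm (?a i))\<^sup>2) = (\<Sum>i\<in>F - S. (norm (?a i))\<^sup>2)"
      by (rule sum.mono_neutral_right[OF F]) (auto split: prod.splits)
    also have "\<dots> = (\<Sum>(j, l)\<in>F - S. (norm (block j X l))\<^sup>2)"
      by (rule sum.cong) auto
    also have "\<dots> \<le> e\<^sup>2" by (rule S) (use F in auto)
    finally show "(\<Sum>i\<in>F. (norm (?a i))\<^sup>2) \<le> e\<^sup>2" .
  qed (rule e)
  then show ?thesis by simp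
qed

lemma scalar_op_0: "scalar_op 0 o\<^sub>L A = 0"
  by (rule blinfun_eqI) simp

lemma scalar_op_1: "scalar_op 1 o\<^sub>L A = A"
  by (rule blinfun_eqI) simp

lemma norm_freq_diff: "cmod (freq j - freq l) = c * \<bar>of_int (j - l)\<bar>"
proof -
  have "freq j - freq l = \<i> * complex_of_real (c * of_int (j - l))"
    by (simp add: freq_def algebra_simps)
  then show ?thesis using c_pos
    by (simp only: norm_mult norm_ii norm_of_real abs_mult mult_1 abs_of_pos)
qed

lemma freq_eq_iff: "freq j = freq l \<longleftrightarrow> j = l"
  using norm_freq_diff[of j l] c_pos by auto

lemma norm_inverse_freq_diff: "j \<noteq> l \<Longrightarrow> cmod (1 / (freq j - freq l)) \<le> 1 / c"
proof -
  assume "j \<noteq> l"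
  then have "c * 1 \<le> c * \<bar>of_int (j - l)\<bar>" using c_pos by (intro mult_left_mono) auto
  then show ?thesis unfolding norm_divide norm_freq_diff using c_pos by (simp add: frac_le)
qed

text \<open>If \<open>A\<close> only sees the components in \<open>S\<close>, the multiplier matters
  only on the rows in \<open>S\<close>, and a better bound on these rows improves the estimate of the
  product.\<close>

lemma schur_compose_left:
  assumes "hs r Z" "\<And>j l. cmod (w j l) \<le> K" "\<And>j l. cmod (w' j l) \<le> K'"
    and A: "A o\<^sub>L Q = A" and Q: "Q = (\<Sum>j\<in>S. P j)" "finite S"
    and w': "\<And>j l. w' j l = (if j \<in> S then w j l else 0)"
  shows "A o\<^sub>L schur w Z = A o\<^sub>L schur w' Z"
proof -
  have "Q o\<^sub>L schur w Z = schur w' Z"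
  proof (rule block_eqI)
    fix j l
    have PQ: "P j (Q x) = (if j \<in> S then P j x else 0)" for x
    proof -
      have "P j (Q x) = (\<Sum>i\<in>S. if i = j then P j x else 0)"
        unfolding Q(1) blinfun.sum_left blinfun.sum_right by (rule sum.cong) (auto simp: P_P)
      then show ?thesis using Q(2) by simp
    qed
    have "block j (Q o\<^sub>L schur w Z) l = (if j \<in> S then block j (schur w Z) l else 0)"
      by (rule blinfun_eqI) (simp add: block_apply PQ)
    then show "block j (Q o\<^sub>L schur w Z) l = block j (schur w' Z) l"
      by (simp add: block_schur[OF assms(1,2)] block_schur[OF assms(1,3)] w' scalar_op_0)
  qed
  then show ?thesis by (metis A blinfun_compose_assoc)
qed

lemma schur_compose_right:
  assumes "hs r Z" "\<And>j l. cmod (w j l) \<le> K" "\<And>j l. cmod (w' j l) \<le> K'"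
    and A: "Q o\<^sub>L A = A" and Q: "Q = (\<Sum>j\<in>S. P j)" "finite S"
    and w': "\<And>j l. w' j l = (if l \<in> S then w j l else 0)"
  shows "schur w Z o\<^sub>L A = schur w' Z o\<^sub>L A"
proof -
  have "schur w Z o\<^sub>L Q = schur w' Z"
  proof (rule block_eqI)
    fix j l
    have QP: "Q (P l x) = (if l \<in> S then P l x else 0)" for x
    proof -
      have "Q (P l x) = (\<Sum>i\<in>S. if i = l then P l x else 0)"
        unfolding Q(1) blinfun.sum_left by (rule sum.cong) (auto simp: P_P)
      then show ?thesis using Q(2) by simp
    qed
    have "block j (schur w Z o\<^sub>L Q) l = (if l \<in> S then block j (schur w Z) l else 0)"
      by (rule blinfun_eqI) (simp add: block_apply QP)
    then show "block j (schur w Z o\<^sub>L Q) l = block j (schur w' Z) l"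
      by (simp add: block_schur[OF assms(1,2)] block_schur[OF assms(1,3)] w' scalar_op_0)
  qed
  then show ?thesis by (metis A blinfun_compose_assoc)
qed

definition block_diagonal :: "nat \<Rightarrow> ('e \<Rightarrow>\<^sub>L 'e) \<Rightarrow> bool" where
  "block_diagonal k C \<longleftrightarrow> (\<forall>j l. \<not> (j = l \<or> \<bar>j\<bar> \<le> int k \<and> \<bar>l\<bar> \<le> int k) \<longrightarrow> block j C l = 0)"

text \<open>The relation \<open>(G0 - A) (1 + M) = (1 + M) (G0 - C)\<close>, including
  equality of domains: the first part says that \<open>1 + M\<close> maps the domain of
  \<open>G0\<close> into itself, the second that it does so onto. The perturbation \<open>A\<close> is a
  relation because it may be unbounded.\<close>

definition intertwines :: "('e \<Rightarrow>\<^sub>L 'e) \<Rightarrow> ('e \<Rightarrow> 'e \<Rightarrow> bool) \<Rightarrow> ('e \<Rightarrow>\<^sub>L 'e) \<Rightarrow> bool" where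
  "intertwines M A C \<longleftrightarrow>
     (\<forall>x u. (x, u) \<in> G0 \<longrightarrow> (\<exists>u' a. (x + M x, u') \<in> G0 \<and> A (x + M x) a \<and>
        u' - a = (u - C x) + M (u - C x))) \<and>
     (\<forall>y v. (y, v) \<in> G0 \<longrightarrow> (\<exists>x u. (x, u) \<in> G0 \<and> x + M x = y))"

text \<open>With \<open>\<Gamma>\<close> inverting the commutator off the diagonal and off the central
  block \<open>|j|, |l| \<le> k\<close>, and \<open>D\<close> keeping these two parts, the required
  identity reads \<open>X = B + B \<Gamma>X - \<Gamma>X D X\<close> with
  \<open>C = D X\<close>. The frequency gap is \<open>c\<close> for every \<open>k\<close>, so
  \<open>\<Gamma>\<close> does not become small as \<open>k\<close> grows, and \<open>B\<close> may be
  large. Therefore \<open>B\<close> is split into a finite matrix \<open>Bm\<close>, supported in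
  \<open>|j|, |l| \<le> m\<close>, and a small remainder \<open>B'\<close>. If \<open>k\<close>
  exceeds \<open>m\<close> by \<open>N\<close>, then \<open>Bm\<close> meets only entries of
  \<open>\<Gamma>X\<close> with \<open>|j - l| > N\<close>, which gains the factor
  \<open>\<delta> = 1 / (c (N + 1))\<close>. As \<open>\<Gamma>\<close> annihilates
  \<open>Bm\<close> and \<open>D\<close> fixes it, the equation for \<open>Z = X - Bm\<close> has
  only small coefficients.\<close>

lemma bounded_perturbation_block_diagonalization:
  assumes B: "hs b B"
  shows "\<exists>k M C r. hs (1/2) M \<and> hs r C \<and> block_diagonal k C \<and> intertwines M (\<lambda>x a. a = B x) C"
proof -
  \<comment> \<open>Half of the radius \<open>r = c / 16\<close> of the ball in which the fixed point is found; on this ball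
    \<open>\<Gamma>\<close> produces operators of norm at most \<open>1/16\<close>.\<close>
  define e where "e = c / 32"
  have e: "e > 0" using c_pos by (simp add: e_def)
  obtain S where S: "finite S"
    "\<And>F. finite F \<Longrightarrow> F \<inter> S = {} \<Longrightarrow> (\<Sum>(j, l)\<in>F. (norm (block j B l))\<^sup>2) \<le> e\<^sup>2"
    using hs_tail[OF B e] by blast
  define m where "m = nat (Max (insert 0 ((\<lambda>(j, l). max \<bar>j\<bar> \<bar>l\<bar>) ` S)))"
  have S_le: "\<bar>j\<bar> \<le> int m \<and> \<bar>l\<bar> \<le> int m" if "(j, l) \<in> S" for j l
  proof -
    have "max \<bar>j\<bar> \<bar>l\<bar> \<le> Max (insert 0 ((\<lambda>(j, l). max \<bar>j\<bar> \<bar>l\<bar>) ` S))"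
      using S(1) that by (intro Max_ge) force+
    then show ?thesis by (auto simp: m_def)
  qed
  define I where "I = {j. \<bar>j\<bar> \<le> int m}"
  have finI: "finite I"
    unfolding I_def by (rule finite_subset[of _ "{- int m..int m}"]) auto
  have "S \<subseteq> I \<times> I" using S_le unfolding I_def by auto
  obtain B' where B': "hs e B'"
    "\<And>j l. block j B' l = (if (j, l) \<in> I \<times> I then 0 else block j B l)"
    using hs_restrict[OF B less_imp_le[OF e], of "I \<times> I"] S(2) \<open>S \<subseteq> I \<times> I\<close> by blast
  define Bm where "Bm = B - B'"
  have blBm: "block j Bm l = (if j \<in> I \<and> l \<in> I then block j B l else 0)" for j l
    by (simp add: Bm_def block_diff B'(2))
  have hBm: "hs (b + e) Bm" unfolding Bm_def by (rule hs_diff[OF B B'(1)])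
  define Q where "Q = (\<Sum>j\<in>I. P j)"
  have PQ: "P j (Q x) = (if j \<in> I then P j x else 0)" "Q (P j x) = (if j \<in> I then P j x else 0)" for x j
  proof -
    have *: "P j (Q x) = (\<Sum>i\<in>I. if i = j then P j x else 0)"
      unfolding Q_def blinfun.sum_left blinfun.sum_right by (rule sum.cong) (auto simp: P_P)
    then show "P j (Q x) = (if j \<in> I then P j x else 0)" using finI by simp
    have "Q (P j x) = (\<Sum>i\<in>I. if i = j then P j x else 0)"
      unfolding Q_def blinfun.sum_left by (rule sum.cong) (auto simp: P_P)
    then show "Q (P j x) = (if j \<in> I then P j x else 0)" using finI by simp
  qed
  have QB: "Q o\<^sub>L Bm = Bm" and BQ: "Bm o\<^sub>L Q = Bm"
  proof (rule block_eqI)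
    fix j l
    have "block j (Q o\<^sub>L Bm) l = (if j \<in> I then block j Bm l else 0)"
      by (rule blinfun_eqI) (simp add: block_apply PQ)
    then show "block j (Q o\<^sub>L Bm) l = block j Bm l" by (simp add: blBm)
  next
    show "Bm o\<^sub>L Q = Bm"
    proof (rule block_eqI)
      fix j l
      have "block j (Bm o\<^sub>L Q) l = (if l \<in> I then block j Bm l else 0)"
        by (rule blinfun_eqI) (simp add: block_apply PQ)
      then show "block j (Bm o\<^sub>L Q) l = block j Bm l" by (simp add: blBm)
    qed
  qed
  define \<beta> where "\<beta> = b + e"
  have beta: "\<beta> \<ge> 0" using hsD(2)[OF hBm] by (simp add: \<beta>_def)
  obtain N :: nat where N: "real N \<ge> 32 * \<beta> / c" using real_arch_simple by blast
  define k where "k = m + N"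
  define \<delta> where "\<delta> = 1 / (c * (real N + 1))"
  have \<delta>: "\<beta> * \<delta> \<le> 1 / 32"
  proof -
    have "32 * \<beta> \<le> c * real N" using N c_pos by (simp add: field_simps)
    then have "32 * \<beta> \<le> c * (real N + 1)" using c_pos by (simp add: algebra_simps)
    moreover have "c * (real N + 1) > 0" using c_pos by simp
    ultimately have "\<beta> / (c * (real N + 1)) \<le> 1 / 32" by (simp only: pos_divide_le_eq)
    then show ?thesis by (simp add: \<delta>_def)
  qed
  define dia where "dia j l \<longleftrightarrow> j = l \<or> \<bar>j\<bar> \<le> int k \<and> \<bar>l\<bar> \<le> int k" for j l :: int
  define w where "w j l = (if dia j l then 0 else 1 / (freq j - freq l))" for j l
  define d where "d j l = (if dia j l then 1 else 0 :: complex)" for j l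
  have w_le: "cmod (w j l) \<le> 1 / c" for j l
    using norm_inverse_freq_diff[of j l] c_pos by (auto simp: w_def dia_def)
  have d_le: "cmod (d j l) \<le> 1" for j l by (simp add: d_def)
  define wl where "wl j l = (if j \<in> I then w j l else 0)" for j l
  define wr where "wr j l = (if l \<in> I then w j l else 0)" for j l
  have far: "cmod (1 / (freq j - freq l)) \<le> \<delta>" if "int N + 1 \<le> \<bar>j - l\<bar>" for j l
  proof -
    have "real N + 1 \<le> \<bar>of_int (j - l)\<bar>" using that by linarith
    then have "c * (real N + 1) \<le> c * \<bar>of_int (j - l)\<bar>" using c_pos by simp
    then show ?thesis unfolding norm_divide norm_freq_diff \<delta>_def using c_pos by (simp add: frac_le)
  qed
  have \<delta>0: "\<delta> \<ge> 0" unfolding \<delta>_def using c_pos by simp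
  have wl_le: "cmod (wl j l) \<le> \<delta>" for j l
    unfolding wl_def w_def dia_def I_def k_def using far[of j l] \<delta>0 by (auto simp del: norm_divide)
  have wr_le: "cmod (wr j l) \<le> \<delta>" for j l
    unfolding wr_def w_def dia_def I_def k_def using far[of j l] \<delta>0 by (auto simp del: norm_divide)
  define r where "r = c / 16"
  have r: "r \<ge> 0" "1 / c * r = 1/16" "e = r / 2" using c_pos by (simp_all add: r_def e_def)
  define \<Gamma> where "\<Gamma> = schur w"
  define D where "D = schur d"
  have h\<Gamma>: "hs (1 / c * t) (\<Gamma> Z)" if "hs t Z" for t Z
    unfolding \<Gamma>_def by (rule hs_schur[OF that w_le])
  have hD: "hs t (D Z)" if "hs t Z" for t Z
    using hs_schur[OF that d_le] by (simp add: D_def)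
  have hB\<Gamma>: "hs (\<beta> * (\<delta> * t)) (Bm o\<^sub>L \<Gamma> Z)" if "hs t Z" for t Z
  proof -
    have "Bm o\<^sub>L \<Gamma> Z = Bm o\<^sub>L schur wl Z" unfolding \<Gamma>_def
      by (rule schur_compose_left[OF that w_le wl_le BQ Q_def finI wl_def])
    then show ?thesis
      using hs_compose[OF hBm hs_schur[OF that wl_le]] by (simp add: \<beta>_def)
  qed
  have h\<Gamma>B: "hs (\<beta> * (\<delta> * t)) (\<Gamma> Z o\<^sub>L Bm)" if "hs t Z" for t Z
  proof -
    have "\<Gamma> Z o\<^sub>L Bm = schur wr Z o\<^sub>L Bm" unfolding \<Gamma>_def
      by (rule schur_compose_right[OF that w_le wr_le QB Q_def finI wr_def])
    then show ?thesis
      using hs_compose[OF hs_schur[OF that wr_le] hBm] by (simp add: \<beta>_def mult.commute)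
  qed
  define \<Phi> where "\<Phi> Z = B' + (B' o\<^sub>L \<Gamma> Z) + (Bm o\<^sub>L \<Gamma> Z) - (\<Gamma> Z o\<^sub>L Bm) - (\<Gamma> Z o\<^sub>L D Z)" for Z
  have "\<exists>Z. hs r Z \<and> \<Phi> Z = Z"
  proof (rule hs_fixed_point[OF r(1)])
    fix Z assume Z: "hs r Z"
    have "hs (e + e * (1 / c * r) + \<beta> * (\<delta> * r) + \<beta> * (\<delta> * r) + (1 / c * r) * r) (\<Phi> Z)"
      unfolding \<Phi>_def
      by (intro hs_add hs_diff hs_compose B'(1) h\<Gamma> hB\<Gamma> h\<Gamma>B hD Z)
    moreover have "e + e * (1 / c * r) + \<beta> * (\<delta> * r) + \<beta> * (\<delta> * r) + (1 / c * r) * r \<le> r"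
    proof -
      have "\<beta> * (\<delta> * r) \<le> 1/32 * r" using mult_right_mono[OF \<delta> r(1)] by (simp add: mult.assoc)
      then show ?thesis unfolding r(2,3) using r(1) by simp
    qed
    ultimately show "hs r (\<Phi> Z)" by (rule hs_weaken)
  next
    fix Z Z' t assume Z: "hs r Z" "hs r Z'" and t: "hs t (Z - Z')"
    have t0: "t \<ge> 0" using t by (rule hsD)
    have \<Gamma>diff: "\<Gamma> Z - \<Gamma> Z' = \<Gamma> (Z - Z')" and Ddiff: "D Z - D Z' = D (Z - Z')"
      unfolding \<Gamma>_def D_def using schur_diff[OF Z w_le] schur_diff[OF Z d_le] by simp_all
    have eq: "\<Phi> Z - \<Phi> Z' = (B' o\<^sub>L \<Gamma> (Z - Z')) + (Bm o\<^sub>L \<Gamma> (Z - Z')) - (\<Gamma> (Z - Z') o\<^sub>L Bm)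
        - ((\<Gamma> (Z - Z') o\<^sub>L D Z) + (\<Gamma> Z' o\<^sub>L D (Z - Z')))"
      unfolding \<Phi>_def \<Gamma>diff[symmetric] Ddiff[symmetric] blinfun_compose.diff_left blinfun_compose.diff_right
      by (simp add: algebra_simps)
    have "hs (e * (1 / c * t) + \<beta> * (\<delta> * t) + \<beta> * (\<delta> * t) + ((1 / c * t) * r + (1 / c * r) * t)) (\<Phi> Z - \<Phi> Z')"
      unfolding eq
      by (intro hs_add hs_diff hs_compose B'(1) h\<Gamma> hB\<Gamma> h\<Gamma>B hD Z t)
    moreover have "e * (1 / c * t) + \<beta> * (\<delta> * t) + \<beta> * (\<delta> * t) + ((1 / c * t) * r + (1 / c * r) * t) \<le> t / 2"
    proof -
      have "\<beta> * (\<delta> * t) \<le> 1/32 * t" using mult_right_mono[OF \<delta> t0] by (simp add: mult.assoc)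
      moreover have "e * (1 / c * t) = 1/32 * t" "(1 / c * t) * r = 1/16 * t" "(1 / c * r) * t = 1/16 * t"
        using c_pos by (simp_all add: e_def r_def)
      ultimately show ?thesis using t0 by simp
    qed
    ultimately show "hs (t / 2) (\<Phi> Z - \<Phi> Z')" by (rule hs_weaken)
  qed
  then obtain Z where Z: "hs r Z" "\<Phi> Z = Z" by blast
  define M where "M = \<Gamma> Z"
  have hM: "hs (1/16) M" using h\<Gamma>[OF Z(1)] by (simp only: M_def r(2))
  define C where "C = Bm + D Z"
  have hC: "hs (\<beta> + r) C" unfolding C_def \<beta>_def by (intro hs_add hBm hD Z)
  have "block_diagonal k C"
    unfolding block_diagonal_def
  proof (intro allI impI)
    fix j l assume nd: "\<not> (j = l \<or> \<bar>j\<bar> \<le> int k \<and> \<bar>l\<bar> \<le> int k)"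
    have "\<not> (j \<in> I \<and> l \<in> I)" using nd by (auto simp: I_def k_def)
    moreover have "d j l = 0" using nd by (simp add: d_def dia_def)
    ultimately show "block j C l = 0"
      unfolding C_def block_add D_def block_schur[OF Z(1) d_le] blBm by (auto simp: scalar_op_0)
  qed
  moreover have "intertwines M (\<lambda>x a. a = B x) C"
  proof -
    have comm: "(M x, M u + (Z x - D Z x)) \<in> G0" if "(x, u) \<in> G0" for x u
    proof -
      have "(M x, M u + Z x - D Z x) \<in> G0"
      proof (rule G0_commutator[OF that, where R = "\<lambda>j. P j o\<^sub>L Z" and w = w])
        show "P j o\<^sub>L Z \<in> complex_operators" for j
          by (intro complex_operators_compose P_complex hsD(1)[OF Z(1)])
        show "block j M l = scalar_op (w j l) o\<^sub>L ((P j o\<^sub>L Z) o\<^sub>L P l)" for j l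
          unfolding M_def \<Gamma>_def block_schur[OF Z(1) w_le] by (simp only: block_def)
        show "block j (D Z) l = scalar_op (1 - (freq j - freq l) * w j l) o\<^sub>L ((P j o\<^sub>L Z) o\<^sub>L P l)" for j l
        proof -
          have "1 - (freq j - freq l) * w j l = d j l"
            by (auto simp: w_def d_def dia_def freq_eq_iff)
          then show ?thesis
            unfolding D_def block_schur[OF Z(1) d_le] by (simp only: block_def)
        qed
      qed simp
      then show ?thesis by (simp add: add_diff_eq)
    qed
    have "\<exists>u' a. (x + M x, u') \<in> G0 \<and> a = B (x + M x) \<and> u' - a = (u - C x) + M (u - C x)"
      if "(x, u) \<in> G0" for x u
    proof -
      have Zx: "Z x = \<Phi> Z x" by (simp add: Z(2))
      have "B = Bm + B'" by (simp add: Bm_def)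
      then have "u + (M u + (Z x - D Z x)) - B (x + M x) = (u - C x) + M (u - C x)"
        unfolding Zx C_def \<Phi>_def M_def[symmetric]
        by (simp add: blinfun.add_left blinfun.diff_left blinfun.add_right blinfun.diff_right)
      then show ?thesis using G0_add[OF that comm[OF that]] by blast
    qed
    moreover have "\<exists>x u. (x, u) \<in> G0 \<and> x + M x = y" if "(y, v) \<in> G0" for y v
    proof (rule id_plus_onto_domain[OF _ comm, where Ka = 0 and Kb = "2 * r"])
      show "norm M \<le> 1/2" using hs_norm[OF hM] by simp
      show "norm (Z x - D Z x) \<le> 0 * (\<Sum>\<^sub>\<infinity>l. norm (P l x)) + 2 * r * norm x" for x
      proof -
        have "norm (Z - D Z) \<le> r + r" by (rule hs_norm[OF hs_diff[OF Z(1) hD[OF Z(1)]]])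
        then have "norm (Z - D Z) * norm x \<le> (r + r) * norm x" by (rule mult_right_mono) simp
        then show ?thesis using norm_blinfun[of "Z - D Z" x] by (simp add: blinfun.diff_left)
      qed
    qed (use r that in auto)
    ultimately show ?thesis unfolding intertwines_def by blast
  qed
  moreover have "hs (1/2) M" using hM by (rule hs_weaken) simp
  ultimately show ?thesis using hC by blast
qed

end

section \<open>Reduction of the unbounded perturbation to a bounded one\<close>

lemma square_summable_add:
  fixes f g :: "'i \<Rightarrow> 'b::real_normed_vector"
  assumes "(\<lambda>i. (norm (f i))\<^sup>2) summable_on A" "(\<lambda>i. (norm (g i))\<^sup>2) summable_on A"
  shows "(\<lambda>i. (norm (f i + g i))\<^sup>2) summable_on A"
proof (rule summable_on_comparison_test)
  show "(\<lambda>i. 2 * (norm (f i))\<^sup>2 + 2 * (norm (g i))\<^sup>2) summable_on A"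
    by (intro summable_on_add summable_on_cmult_right assms)
  fix i
  have "(norm (f i + g i))\<^sup>2 \<le> (norm (f i) + norm (g i))\<^sup>2"
    by (intro power_mono norm_triangle_ineq) simp
  also have "\<dots> \<le> 2 * (norm (f i))\<^sup>2 + 2 * (norm (g i))\<^sup>2"
    using sum_squares_bound[of "norm (f i)" "norm (g i)"] by (simp add: power2_sum)
  finally show "(norm (f i + g i))\<^sup>2 \<le> 2 * (norm (f i))\<^sup>2 + 2 * (norm (g i))\<^sup>2" .
qed simp

lemma square_summable_sum:
  fixes f :: "'k \<Rightarrow> 'i \<Rightarrow> 'b::real_normed_vector"
  assumes "finite K" "\<And>k. k \<in> K \<Longrightarrow> (\<lambda>i. (norm (f k i))\<^sup>2) summable_on A"
  shows "(\<lambda>i. (norm (\<Sum>k\<in>K. f k i))\<^sup>2) summable_on A"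
  using assms by (induction K) (auto intro: square_summable_add)

context frequency_system begin

lemma hs_from_summable_blocks:
  assumes isb: "\<And>j l. is_block j l (a (j, l))" and c: "\<And>i. a i \<in> complex_operators"
    and s: "(\<lambda>i. (norm (a i))\<^sup>2) summable_on UNIV"
  shows "\<exists>r X. hs r X \<and> (\<forall>j l. block j X l = a (j, l))"
proof (rule exI, rule hs_from_blocks[OF isb c])
  let ?r = "sqrt (\<Sum>\<^sub>\<infinity>i. (norm (a i))\<^sup>2)"
  have nn: "0 \<le> (\<Sum>\<^sub>\<infinity>i. (norm (a i))\<^sup>2)" by (rule infsum_nonneg) simp
  then show "0 \<le> ?r" by simp
  fix F :: "(int \<times> int) set" assume "finite F"
  then show "(\<Sum>i\<in>F. (norm (a i))\<^sup>2) \<le> ?r\<^sup>2"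
    using nn finite_sum_le_infsum[OF s, of F] by simp
qed

lemma is_block_row: "P j o\<^sub>L A = A \<Longrightarrow> is_block j l (A o\<^sub>L P l)"
  unfolding is_block_def by (metis (no_types, lifting) P_idem blinfun_apply_blinfun_compose blinfun_eqI)

lemma is_block_0: "is_block j l 0"
  by (simp add: is_block_def blinfun_compose.zero_left blinfun_compose.zero_right)

text \<open>Take \<open>M = \<Gamma> V\<close> except for a finite set \<open>S\<close> of entries,
  chosen so that the rest is small. Then
  \<open>(G0 - V) (1 + M) = G0 + M G0 - J - V M\<close>, where \<open>J\<close> consists
  of the entries of \<open>V\<close> on the diagonal and in \<open>S\<close>. Here
  \<open>H = V M\<close> is in the ideal: \<open>V \<Gamma>V\<close> is by assumption, and dropping
  an entry of \<open>\<Gamma>V\<close> changes it by a square summable column of \<open>V\<close> times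
  a bounded operator. So the claim holds with
  \<open>B = (1 + M)\<^sup>-\<^sup>1 (J + H)\<close>.\<close>

lemma unbounded_perturbation_similar_bounded:
  fixes R :: "int \<Rightarrow> 'e \<Rightarrow>\<^sub>L 'e"
  assumes R: "\<And>j. R j \<in> complex_operators" and PR: "\<And>j. P j o\<^sub>L R j = R j"
    and V: "\<And>x u. (x, u) \<in> G0 \<Longrightarrow> \<exists>v. (\<forall>j. P j v = R j x) \<and> norm v \<le> K * (\<Sum>\<^sub>\<infinity>l. norm (P l x))"
    and K: "K \<ge> 0"
    and offdiag: "(\<lambda>(j, l). (norm (R j o\<^sub>L P l) / of_int (j - l))\<^sup>2) summable_on {(j, l). j \<noteq> l}"
    and diag: "(\<lambda>j. (norm (R j o\<^sub>L P j))\<^sup>2) summable_on UNIV"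
    and col: "\<And>l. (\<lambda>j. (norm (R j o\<^sub>L P l))\<^sup>2) summable_on UNIV"
    and prod: "\<And>G r. hs r G \<Longrightarrow>
      (\<And>j l. block j G l = (if j = l then 0 else scalar_op (1 / (freq j - freq l)) o\<^sub>L (R j o\<^sub>L P l))) \<Longrightarrow>
      (\<lambda>(j, l). (norm (R j o\<^sub>L G o\<^sub>L P l))\<^sup>2) summable_on UNIV"
  shows "\<exists>M B b. hs (1/2) M \<and> hs b B \<and> intertwines M (\<lambda>x a. \<forall>j. P j a = R j x) B"
proof -
  have blkR: "is_block j l (R j o\<^sub>L P l)" for j l by (rule is_block_row[OF PR])
  have cR: "R j o\<^sub>L P l \<in> complex_operators" for j l by (intro complex_operators_compose R P_complex)
  define g where "g i = (if fst i = snd i then 0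
    else scalar_op (1 / (freq (fst i) - freq (snd i))) o\<^sub>L (R (fst i) o\<^sub>L P (snd i)))" for i
  have "\<exists>r G. hs r G \<and> (\<forall>j l. block j G l = g (j, l))"
  proof (rule hs_from_summable_blocks)
    show "is_block j l (g (j, l))" for j l
      unfolding g_def by (auto simp: is_block_0 intro: is_block_scalar blkR)
    show "g i \<in> complex_operators" for i
      unfolding g_def by (auto intro: complex_operators_0 complex_operators_compose scalar_op_complex R P_complex)
    have "(\<lambda>i. (norm (g i))\<^sup>2) summable_on {(j, l). j \<noteq> l}"
    proof (rule summable_on_comparison_test[OF summable_on_cmult_right[OF offdiag, of "1 / c\<^sup>2"]])
      fix i :: "int \<times> int" assume "i \<in> {(j, l). j \<noteq> l}"
      then obtain j l where i: "i = (j, l)" "j \<noteq> l" by auto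
      have "norm (g i) \<le> 1 / (c * \<bar>of_int (j - l)\<bar>) * norm (R j o\<^sub>L P l)"
        unfolding i g_def using norm_scalar_op_compose_le[of "1 / (freq j - freq l)" "R j o\<^sub>L P l"] i(2)
        by (simp only: norm_divide norm_freq_diff norm_one fst_conv snd_conv if_False)
      then have "(norm (g i))\<^sup>2 \<le> (1 / (c * \<bar>of_int (j - l)\<bar>) * norm (R j o\<^sub>L P l))\<^sup>2"
        by (rule power_mono) simp
      then show "(norm (g i))\<^sup>2 \<le> 1 / c\<^sup>2 * (case i of (j, l) \<Rightarrow> (norm (R j o\<^sub>L P l) / of_int (j - l))\<^sup>2)"
        by (simp add: i power_mult_distrib power_divide)
    qed simp
    then show "(\<lambda>i. (norm (g i))\<^sup>2) summable_on UNIV"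
      by (rule summable_on_cong_neutral[THEN iffD1, rotated -1]) (auto simp: g_def)
  qed
  then obtain r G where G: "hs r G" and "\<And>j l. block j G l = g (j, l)" by blast
  then have blG: "block j G l = (if j = l then 0 else scalar_op (1 / (freq j - freq l)) o\<^sub>L (R j o\<^sub>L P l))" for j l
    by (simp add: g_def)
  obtain S where S: "finite S"
    "\<And>F. finite F \<Longrightarrow> F \<inter> S = {} \<Longrightarrow> (\<Sum>(j, l)\<in>F. (norm (block j G l))\<^sup>2) \<le> (1/2)\<^sup>2"
    using hs_tail[OF G, of "1/2"] by auto
  obtain M where M: "hs (1/2) M" "\<And>j l. block j M l = (if (j, l) \<in> S then 0 else block j G l)"
    using hs_restrict[OF G, of "1/2" S] S(2) by auto
  define w where "w j l = (if j = l \<or> (j, l) \<in> S then 0 else 1 / (freq j - freq l))" for j l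
  have blM: "block j M l = scalar_op (w j l) o\<^sub>L (R j o\<^sub>L P l)" for j l
    by (simp add: M(2) blG w_def scalar_op_0)
  \<comment> \<open>The entries of \<open>V\<close> that survive the first order of the transformation.\<close>
  have "\<exists>r J. hs r J \<and> (\<forall>j l. block j J l = (\<lambda>(j, l). if j = l \<or> (j, l) \<in> S then R j o\<^sub>L P l else 0) (j, l))"
  proof (rule hs_from_summable_blocks)
    let ?a = "\<lambda>(j, l). if j = l \<or> (j, l) \<in> S then R j o\<^sub>L P l else 0"
    show "is_block j l (?a (j, l))" for j l by (auto simp: is_block_0 intro: blkR)
    show "?a i \<in> complex_operators" for i
      by (auto simp: split_def intro: complex_operators_0 cR)
    have "(\<lambda>i. (norm (?a i))\<^sup>2) summable_on range (\<lambda>j. (j, j))"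
      by (subst summable_on_reindex) (use diag in \<open>auto simp: inj_on_def o_def\<close>)
    then have "(\<lambda>i. (norm (?a i))\<^sup>2) summable_on (range (\<lambda>j. (j, j)) \<union> S)"
      by (rule summable_on_union) (simp add: S(1))
    then show "(\<lambda>i. (norm (?a i))\<^sup>2) summable_on UNIV"
      by (rule summable_on_cong_neutral[THEN iffD1, rotated -1]) auto
  qed
  then obtain rJ J where J: "hs rJ J" and blJ: "\<And>j l. block j J l = (if j = l \<or> (j, l) \<in> S then R j o\<^sub>L P l else 0)"
    by auto
  have "\<exists>r H. hs r H \<and> (\<forall>j l. block j H l = (\<lambda>(j, l). R j o\<^sub>L M o\<^sub>L P l) (j, l))"
  proof (rule hs_from_summable_blocks)
    show "is_block j l ((\<lambda>(j, l). R j o\<^sub>L M o\<^sub>L P l) (j, l))" for j l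
      by (simp only: prod.case, rule is_block_row) (metis PR blinfun_compose_assoc)
    show "(\<lambda>(j, l). R j o\<^sub>L M o\<^sub>L P l) i \<in> complex_operators" for i
      by (auto simp: split_def intro!: complex_operators_compose R P_complex hsD(1)[OF M(1)])
    have MG: "M = G + - (\<Sum>(n, m)\<in>S. block n G m)"
    proof (rule block_eqI)
      fix j l
      have "block j (\<Sum>(n, m)\<in>S. block n G m) l = (\<Sum>(n, m)\<in>S. block j (block n G m) l)"
        using linear_sum[OF bounded_linear.linear[OF bounded_linear_block[of j l]], of "\<lambda>(n, m). block n G m" S]
        by (simp add: split_def)
      also have "\<dots> = (\<Sum>i\<in>S. if i = (j, l) then block j G l else 0)"
        by (rule sum.cong) (auto simp: block_of_block[OF is_block_block] split: if_splits)
      also have "\<dots> = (if (j, l) \<in> S then block j G l else 0)" using S(1) by simp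
      finally show "block j M l = block j (G + - (\<Sum>(n, m)\<in>S. block n G m)) l"
        by (simp add: M(2) block_diff)
    qed
    have eq: "R j o\<^sub>L M o\<^sub>L P l = (R j o\<^sub>L G o\<^sub>L P l) + (\<Sum>i\<in>S. - (R j o\<^sub>L block (fst i) G (snd i) o\<^sub>L P l))" for j l
      unfolding MG blinfun_compose.add_right blinfun_compose.add_left blinfun_compose.minus_right
        blinfun_compose.minus_left blinfun_compose.sum_right blinfun_compose.sum_left
      by (simp add: split_def sum_negf)
    have single: "(\<lambda>(j, l). (norm (- (R j o\<^sub>L block n G m o\<^sub>L P l)))\<^sup>2) summable_on UNIV" for n m
    proof -
      have "(\<lambda>j. (norm (R j o\<^sub>L block n G m o\<^sub>L P m))\<^sup>2) summable_on UNIV"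
      proof (rule summable_on_comparison_test[OF summable_on_cmult_left[OF col[of n], of "(norm (G o\<^sub>L P m))\<^sup>2"]])
        fix j
        have "R j o\<^sub>L block n G m o\<^sub>L P m = (R j o\<^sub>L P n) o\<^sub>L (G o\<^sub>L P m)"
          by (rule blinfun_eqI) (simp add: block_apply)
        then have "norm (R j o\<^sub>L block n G m o\<^sub>L P m) \<le> norm (R j o\<^sub>L P n) * norm (G o\<^sub>L P m)"
          by (simp only: norm_blinfun_compose)
        from power_mono[OF this norm_ge_zero, of 2]
        show "(norm (R j o\<^sub>L block n G m o\<^sub>L P m))\<^sup>2 \<le> (norm (R j o\<^sub>L P n))\<^sup>2 * (norm (G o\<^sub>L P m))\<^sup>2"
          by (simp only: power_mult_distrib)
      qed simp
      then have "(\<lambda>(j, l). (norm (- (R j o\<^sub>L block n G m o\<^sub>L P l)))\<^sup>2) summable_on range (\<lambda>j. (j, m))"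
        by (subst summable_on_reindex) (auto simp: inj_on_def o_def)
      then show ?thesis
      proof (rule summable_on_cong_neutral[THEN iffD1, rotated -1])
        fix i :: "int \<times> int" assume "i \<in> UNIV - range (\<lambda>j. (j, m))"
        then have "snd i \<noteq> m" by (cases i) auto
        then have "R (fst i) o\<^sub>L block n G m o\<^sub>L P (snd i) = 0"
          by (intro blinfun_eqI) (simp add: block_apply P_P)
        then show "(case i of (j, l) \<Rightarrow> (norm (- (R j o\<^sub>L block n G m o\<^sub>L P l)))\<^sup>2) = 0"
          by (simp add: split_def)
      qed auto
    qed
    have "(\<lambda>i. (norm ((\<lambda>(j, l). R j o\<^sub>L G o\<^sub>L P l) i
        + (\<Sum>k\<in>S. - (R (fst i) o\<^sub>L block (fst k) G (snd k) o\<^sub>L P (snd i)))))\<^sup>2) summable_on UNIV"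
    proof (intro square_summable_add square_summable_sum S(1))
      show "(\<lambda>i. (norm ((\<lambda>(j, l). R j o\<^sub>L G o\<^sub>L P l) i))\<^sup>2) summable_on UNIV"
        using prod[OF G blG] by (simp add: split_def)
      show "(\<lambda>i. (norm (- (R (fst i) o\<^sub>L block (fst k) G (snd k) o\<^sub>L P (snd i))))\<^sup>2) summable_on UNIV" for k
        using single[of "fst k" "snd k"] by (simp add: split_def)
    qed
    then show "(\<lambda>i. (norm ((\<lambda>(j, l). R j o\<^sub>L M o\<^sub>L P l) i))\<^sup>2) summable_on UNIV"
      by (simp add: split_def eq)
  qed
  then obtain rH H where H: "hs rH H" and blH: "\<And>j l. block j H l = R j o\<^sub>L M o\<^sub>L P l"
    by auto
  obtain W where W: "hs 1 W" "(id_blinfun + M) o\<^sub>L (id_blinfun + W) = id_blinfun"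
    using hs_neumann[OF M(1)] by blast
  define B where "B = (J + H) + (W o\<^sub>L (J + H))"
  have hB: "hs ((rJ + rH) + 1 * (rJ + rH)) B"
    unfolding B_def by (intro hs_add hs_compose J H W)
  have MB: "B x + M (B x) = J x + H x" for x
  proof -
    have "B x = (id_blinfun + W) ((J + H) x)" by (simp add: B_def blinfun.add_left blinfun.add_right)
    then have "B x + M (B x) = ((id_blinfun + M) o\<^sub>L (id_blinfun + W)) ((J + H) x)"
      by (simp add: blinfun.add_left)
    then show ?thesis by (simp add: W(2) blinfun.add_left)
  qed
  have PHx: "P j (H x) = R j (M x)" for j x
  proof -
    have "((\<lambda>l. P j (H (P l x))) has_sum P j (H x)) UNIV"
      by (intro has_sum_bounded_linear[OF blinfun.bounded_linear_right] P_has_sum)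
    moreover have "((\<lambda>l. R j (M (P l x))) has_sum R j (M x)) UNIV"
      by (intro has_sum_bounded_linear[OF blinfun.bounded_linear_right] P_has_sum)
    moreover have "P j (H (P l x)) = R j (M (P l x))" for l
      using arg_cong[OF blH[of j l], of "\<lambda>A. A x"] by (simp add: block_apply)
    ultimately show ?thesis using has_sum_unique by simp
  qed
  define V where "V x = (SOME v. (\<forall>j. P j v = R j x) \<and> norm v \<le> K * (\<Sum>\<^sub>\<infinity>l. norm (P l x)))" for x
  have V: "\<forall>j. P j (V x) = R j x" "norm (V x) \<le> K * (\<Sum>\<^sub>\<infinity>l. norm (P l x))" if "(x, u) \<in> G0" for x u
    using someI_ex[OF assms(3)[OF that]] unfolding V_def by blast+
  have comm: "(M x, M u + (V x - J x)) \<in> G0" if "(x, u) \<in> G0" for x u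
  proof -
    have "(M x, M u + V x - J x) \<in> G0"
    proof (rule G0_commutator[OF that R blM])
      show "P j (V x) = R j x" for j using V(1)[OF that] by blast
      show "block j J l = scalar_op (1 - (freq j - freq l) * w j l) o\<^sub>L (R j o\<^sub>L P l)" for j l
      proof -
        have "1 - (freq j - freq l) * w j l = (if j = l \<or> (j, l) \<in> S then 1 else 0)"
          by (auto simp: w_def freq_eq_iff)
        then show ?thesis by (auto simp: blJ scalar_op_0 scalar_op_1)
      qed
    qed
    then show ?thesis by (simp add: add_diff_eq)
  qed
  have "intertwines M (\<lambda>x a. \<forall>j. P j a = R j x) B"
    unfolding intertwines_def
  proof (intro conjI allI impI)
    fix x u assume xu: "(x, u) \<in> G0"
    show "\<exists>u' a. (x + M x, u') \<in> G0 \<and> (\<forall>j. P j a = R j (x + M x)) \<and> u' - a = (u - B x) + M (u - B x)"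
    proof (intro exI conjI)
      show "(x + M x, u + (M u + (V x - J x))) \<in> G0" by (intro G0_add xu comm)
      show "\<forall>j. P j (V x + H x) = R j (x + M x)"
        using V(1)[OF xu] by (simp add: blinfun.add_right PHx)
      have "(u - B x) + M (u - B x) = u + M u - (B x + M (B x))" by (simp add: blinfun.diff_right)
      then show "u + (M u + (V x - J x)) - (V x + H x) = (u - B x) + M (u - B x)"
        unfolding MB by simp
    qed
  next
    fix y v assume "(y, v) \<in> G0"
    show "\<exists>x u. (x, u) \<in> G0 \<and> x + M x = y"
    proof (rule id_plus_onto_domain[OF _ comm _ K _ \<open>(y, v) \<in> G0\<close>])
      show "norm M \<le> 1/2" by (rule hs_norm[OF M(1)])
      show "norm (V x - J x) \<le> K * (\<Sum>\<^sub>\<infinity>l. norm (P l x)) + norm J * norm x" if "(x, u) \<in> G0" for x u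
        using norm_triangle_ineq4[of "V x" "J x"] V(2)[OF that] norm_blinfun[of J x] by linarith
    qed simp_all
  qed
  with M(1) hB show ?thesis by blast
qed

end

section \<open>The exponential of a bounded operator\<close>

text \<open>A unital Banach algebra has \<open>norm 1 = 1\<close>, whereas the identity on the trivial space has norm \<open>0\<close>.
  Operators on the product with \<open>real\<close> form such an algebra for every Banach space, and contain the
  operators on the given space as those that vanish on the second factor.\<close>

typedef (overloaded) 'a op_alg = "UNIV :: (('a::banach \<times> real) \<Rightarrow>\<^sub>L ('a \<times> real)) set"
  morphisms alg_op Alg by simp

setup_lifting type_definition_op_alg

instantiation op_alg :: (banach) real_normed_algebra_1
begin

lift_definition zero_op_alg :: "'a op_alg" is 0 .
lift_definition one_op_alg :: "'a op_alg" is id_blinfun .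
lift_definition plus_op_alg :: "'a op_alg \<Rightarrow> 'a op_alg \<Rightarrow> 'a op_alg" is "(+)" .
lift_definition minus_op_alg :: "'a op_alg \<Rightarrow> 'a op_alg \<Rightarrow> 'a op_alg" is "(-)" .
lift_definition uminus_op_alg :: "'a op_alg \<Rightarrow> 'a op_alg" is uminus .
lift_definition times_op_alg :: "'a op_alg \<Rightarrow> 'a op_alg \<Rightarrow> 'a op_alg" is "(o\<^sub>L)" .
lift_definition scaleR_op_alg :: "real \<Rightarrow> 'a op_alg \<Rightarrow> 'a op_alg" is "scaleR" .
lift_definition norm_op_alg :: "'a op_alg \<Rightarrow> real" is norm .
definition "dist_op_alg (a :: 'a op_alg) b = norm (a - b)"
definition "sgn_op_alg (a :: 'a op_alg) = scaleR (inverse (norm a)) a"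
definition [code del]:
  "(uniformity :: ('a op_alg \<times> 'a op_alg) filter) = (INF e\<in>{0 <..}. principal {(x, y). dist x y < e})"
definition open_op_alg :: "'a op_alg set \<Rightarrow> bool" where [code del]:
  "open_op_alg U \<longleftrightarrow> (\<forall>x\<in>U. eventually (\<lambda>(x', y). x' = x \<longrightarrow> y \<in> U) uniformity)"

instance
proof
  fix a b c :: "'a op_alg" and r s :: real and U :: "'a op_alg set"
  show "a + b + c = a + (b + c)" by transfer simp
  show "a + b = b + a" by transfer simp
  show "0 + a = a" by transfer simp
  show "- a + a = 0" by transfer simp
  show "a - b = a + - b" by transfer simp
  show "r *\<^sub>R (a + b) = r *\<^sub>R a + r *\<^sub>R b" by transfer (simp add: scaleR_add_right)
  show "(r + s) *\<^sub>R a = r *\<^sub>R a + s *\<^sub>R a" by transfer (simp add: scaleR_add_left)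
  show "r *\<^sub>R s *\<^sub>R a = (r * s) *\<^sub>R a" by transfer simp
  show "1 *\<^sub>R a = a" by transfer simp
  show "a * b * c = a * (b * c)" by transfer (rule blinfun_compose_assoc)
  show "(a + b) * c = a * c + b * c" by transfer (rule blinfun_compose.add_left)
  show "a * (b + c) = a * b + a * c" by transfer (rule blinfun_compose.add_right)
  show "r *\<^sub>R a * b = r *\<^sub>R (a * b)" by transfer (rule blinfun_compose.scaleR_left)
  show "a * r *\<^sub>R b = r *\<^sub>R (a * b)" by transfer (rule blinfun_compose.scaleR_right)
  show "1 * a = a" by transfer simp
  show "a * 1 = a" by transfer simp
  show "(0 :: 'a op_alg) \<noteq> 1"
  proof transfer
    have "(id_blinfun :: ('a \<times> real) \<Rightarrow>\<^sub>L _) (0, 1) \<noteq> 0" by (simp add: zero_prod_def)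
    then show "(0 :: ('a \<times> real) \<Rightarrow>\<^sub>L _) \<noteq> id_blinfun" by (metis blinfun.zero_left)
  qed
  show "dist a b = norm (a - b)" by (rule dist_op_alg_def)
  show "sgn a = scaleR (inverse (norm a)) a" by (rule sgn_op_alg_def)
  show "(uniformity :: ('a op_alg \<times> 'a op_alg) filter) = (INF e\<in>{0 <..}. principal {(x, y). dist x y < e})"
    by (rule uniformity_op_alg_def)
  show "open U \<longleftrightarrow> (\<forall>x\<in>U. eventually (\<lambda>(x', y). x' = x \<longrightarrow> y \<in> U) uniformity)"
    by (rule open_op_alg_def)
  show "norm a = 0 \<longleftrightarrow> a = 0" by transfer simp
  show "norm (a + b) \<le> norm a + norm b" by transfer (rule norm_triangle_ineq)
  show "norm (r *\<^sub>R a) = \<bar>r\<bar> * norm a" by transfer simp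
  show "norm (a * b) \<le> norm a * norm b" by transfer (rule norm_blinfun_compose)
  show "norm (1 :: 'a op_alg) = 1"
  proof transfer
    show "norm (id_blinfun :: ('a \<times> real) \<Rightarrow>\<^sub>L _) = 1"
      by (rule norm_blinfun_eqI[where x = "(0, 1)"]) auto
  qed
qed

end

instance op_alg :: (banach) banach
proof
  fix X :: "nat \<Rightarrow> 'a op_alg" assume "Cauchy X"
  then have "Cauchy (\<lambda>n. alg_op (X n))"
    unfolding Cauchy_def dist_norm by (simp add: norm_op_alg.rep_eq minus_op_alg.rep_eq)
  then obtain L where "(\<lambda>n. alg_op (X n)) \<longlonglongrightarrow> L" using Cauchy_convergent convergent_def by blast
  then have "X \<longlonglongrightarrow> Alg L"
    unfolding LIMSEQ_iff by (simp add: norm_op_alg.rep_eq minus_op_alg.rep_eq Alg_inverse)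
  then show "convergent X" by (rule convergentI)
qed

definition embed_op :: "('a::banach \<Rightarrow>\<^sub>L 'a) \<Rightarrow> 'a op_alg" where
  "embed_op A = Alg (Blinfun (\<lambda>p. (A (fst p), 0)))"

lemma embed_op_apply: "alg_op (embed_op A) p = (A (fst p), 0)"
proof -
  have "bounded_linear (\<lambda>p :: 'a \<times> real. (A (fst p), 0 :: real))"
    by (intro bounded_linear_Pair bounded_linear_zero
        bounded_linear_compose[OF blinfun.bounded_linear_right bounded_linear_fst])
  then show ?thesis by (simp add: embed_op_def Alg_inverse bounded_linear_Blinfun_apply)
qed

lemma op_alg_eqI: "(\<And>p. alg_op a p = alg_op b p) \<Longrightarrow> a = b"
  by (metis alg_op_inject blinfun_eqI)

lemma embed_op_add: "embed_op (A + B) = embed_op A + embed_op B"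
  by (rule op_alg_eqI) (simp add: embed_op_apply plus_op_alg.rep_eq blinfun.add_left)

lemma embed_op_scaleR: "embed_op (r *\<^sub>R A) = r *\<^sub>R embed_op A"
  by (rule op_alg_eqI) (simp add: embed_op_apply scaleR_op_alg.rep_eq blinfun.scaleR_left)

lemma embed_op_compose: "embed_op (A o\<^sub>L B) = embed_op A * embed_op B"
  by (rule op_alg_eqI) (simp add: embed_op_apply times_op_alg.rep_eq)

lemma embed_op_power: "alg_op (embed_op A ^ n) (x, 0) = ((blinfun_apply A ^^ n) x, 0)"
  by (induction n) (simp_all add: one_op_alg.rep_eq times_op_alg.rep_eq embed_op_apply)

lemma bounded_linear_alg_op: "bounded_linear (\<lambda>a. alg_op a p)"
proof
  show "alg_op (a + b) p = alg_op a p + alg_op b p" for a b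
    by (simp add: plus_op_alg.rep_eq blinfun.add_left)
  show "alg_op (r *\<^sub>R a) p = r *\<^sub>R alg_op a p" for r a
    by (simp add: scaleR_op_alg.rep_eq blinfun.scaleR_left)
  show "\<exists>K. \<forall>a. norm (alg_op a p) \<le> norm a * K"
    by (metis norm_blinfun norm_op_alg.rep_eq)
qed

lemma alg_exp_sums:
  "(\<lambda>n. ((blinfun_apply A ^^ n) x /\<^sub>R fact n, 0)) sums alg_op (exp (embed_op A)) (x, 0)"
  using bounded_linear.sums[OF bounded_linear_alg_op exp_converges[of "embed_op A"], of "(x, 0)"]
  by (simp add: scaleR_op_alg.rep_eq blinfun.scaleR_left embed_op_power)

text \<open>The exponential of \<open>embed_op A\<close> is the identity on the second factor; its
  restriction to the first one is the exponential of \<open>A\<close>.\<close>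

definition expo :: "('a::banach \<Rightarrow>\<^sub>L 'a) \<Rightarrow> 'a \<Rightarrow>\<^sub>L 'a" where
  "expo A = Blinfun (\<lambda>x. fst (alg_op (exp (embed_op A)) (x, 0)))"

lemma expo_apply: "expo A x = fst (alg_op (exp (embed_op A)) (x, 0))"
proof -
  have "bounded_linear (\<lambda>x. fst (alg_op (exp (embed_op A)) (x, 0)))"
    by (intro bounded_linear_compose[OF bounded_linear_fst] bounded_linear_compose[OF blinfun.bounded_linear_right]
        bounded_linear_Pair bounded_linear_ident bounded_linear_zero)
  then show ?thesis by (simp add: expo_def bounded_linear_Blinfun_apply)
qed

lemma expo_sums: "(\<lambda>n. (blinfun_apply A ^^ n) x /\<^sub>R fact n) sums expo A x"
  using bounded_linear.sums[OF bounded_linear_fst alg_exp_sums[of A x]] by (simp add: expo_apply)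

lemma alg_exp_apply: "alg_op (exp (embed_op A)) (x, 0) = (expo A x, 0)"
proof -
  have "(\<lambda>n::nat. 0) sums snd (alg_op (exp (embed_op A)) (x, 0))"
    using bounded_linear.sums[OF bounded_linear_snd alg_exp_sums[of A x]] by simp
  then have "snd (alg_op (exp (embed_op A)) (x, 0)) = 0" by (metis sums_unique2 sums_zero)
  then show ?thesis by (simp add: expo_apply prod_eq_iff)
qed

lemma expo_add:
  assumes "A o\<^sub>L B = B o\<^sub>L A" shows "expo (A + B) = expo A o\<^sub>L expo B"
proof (rule blinfun_eqI)
  fix x
  have "exp (embed_op (A + B)) = exp (embed_op A) * exp (embed_op B)"
    unfolding embed_op_add by (rule exp_add_commuting) (metis assms embed_op_compose)
  then show "expo (A + B) x = (expo A o\<^sub>L expo B) x"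
    using alg_exp_apply[of "A + B" x] by (simp add: times_op_alg.rep_eq alg_exp_apply)
qed

lemma expo_0: "expo 0 = id_blinfun"
proof (rule blinfun_eqI)
  fix x :: 'a
  have "embed_op (0 :: 'a \<Rightarrow>\<^sub>L 'a) = 0" using embed_op_scaleR[of 0 0] by simp
  then show "expo 0 x = id_blinfun x" by (simp add: expo_apply one_op_alg.rep_eq)
qed

lemma expo_has_vector_derivative:
  "((\<lambda>t. expo (t *\<^sub>R A) x) has_vector_derivative A (expo (t *\<^sub>R A) x)) (at t)"
proof -
  have bl: "bounded_linear (\<lambda>a. fst (alg_op a (x, 0)))"
    by (intro bounded_linear_compose[OF bounded_linear_fst] bounded_linear_alg_op)
  have "((\<lambda>t. exp (t *\<^sub>R embed_op A)) has_vector_derivative embed_op A * exp (t *\<^sub>R embed_op A)) (at t)"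
    by (rule exp_scaleR_has_vector_derivative_left)
  from bounded_linear.has_vector_derivative[OF bl this]
  show ?thesis
    by (simp add: expo_apply embed_op_scaleR times_op_alg.rep_eq embed_op_apply)
qed

lemma difference_quotient_tendsto:
  assumes "(f has_vector_derivative d) (at 0)"
  shows "((\<lambda>t. (f t - f 0) /\<^sub>R t) \<longlongrightarrow> d) (at 0)"
proof (rule LIM_zero_cancel, rule Lim_null_comparison)
  show "((\<lambda>t. norm ((1 / \<bar>t\<bar>) *\<^sub>R (f t - (f 0 + t *\<^sub>R d)))) \<longlongrightarrow> 0) (at 0)"
    using assms unfolding has_vector_derivative_def has_derivative_at2 by (intro tendsto_norm_zero) simp
  show "\<forall>\<^sub>F t in at 0. norm ((f t - f 0) /\<^sub>R t - d) \<le> norm ((1 / \<bar>t\<bar>) *\<^sub>R (f t - (f 0 + t *\<^sub>R d)))"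
    using eventually_neq_at_within[of 0 0]
  proof eventually_elim
    fix t :: real assume t: "t \<noteq> 0"
    have "(f t - f 0) /\<^sub>R t - d = (f t - f 0 - t *\<^sub>R d) /\<^sub>R t"
      using t by (simp add: scaleR_diff_right)
    then show "norm ((f t - f 0) /\<^sub>R t - d) \<le> norm ((1 / \<bar>t\<bar>) *\<^sub>R (f t - (f 0 + t *\<^sub>R d)))"
      by (simp add: diff_diff_eq divide_inverse)
  qed
qed

lemma expo_difference_quotient: "((\<lambda>t. (expo (t *\<^sub>R A) x - x) /\<^sub>R t) \<longlongrightarrow> A x) (at 0)"
  using difference_quotient_tendsto[OF expo_has_vector_derivative[of A x 0]] by (simp add: expo_0)

lemma continuous_expo: "continuous (at t) (\<lambda>t. expo (t *\<^sub>R A) x)"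
  by (rule has_vector_derivative_continuous[OF expo_has_vector_derivative])

lemma expo_commute:
  assumes "S o\<^sub>L A = A o\<^sub>L S" shows "S o\<^sub>L expo A = expo A o\<^sub>L S"
proof (rule blinfun_eqI)
  fix x
  have SA: "S (A y) = A (S y)" for y by (metis assms blinfun_apply_blinfun_compose)
  have "S ((blinfun_apply A ^^ n) x) = (blinfun_apply A ^^ n) (S x)" for n
    by (induction n) (simp_all add: SA)
  then have "(\<lambda>n. (blinfun_apply A ^^ n) (S x) /\<^sub>R fact n) sums S (expo A x)"
    using bounded_linear.sums[OF blinfun.bounded_linear_right expo_sums[of A x], of S]
    by (simp add: blinfun.scaleR_right)
  then show "(S o\<^sub>L expo A) x = (expo A o\<^sub>L S) x"
    using sums_unique2[OF _ expo_sums[of A "S x"]] by simp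
qed

lemma expo_complex: "A \<in> complex_operators \<Longrightarrow> expo A \<in> complex_operators"
proof -
  assume A: "A \<in> complex_operators"
  have "scalar_op c o\<^sub>L A = A o\<^sub>L scalar_op c" for c
    by (rule blinfun_eqI) (simp add: complex_operatorsD[OF A])
  from expo_commute[OF this] have "(scalar_op c o\<^sub>L expo A) x = (expo A o\<^sub>L scalar_op c) x" for c x
    by simp
  then show ?thesis by (simp add: complex_operators_def)
qed

lemma expo_scalar_op: "expo (scalar_op z) x = exp z *\<^sub>C x"
proof -
  have pow: "(blinfun_apply (scalar_op z) ^^ n) x = z ^ n *\<^sub>C x" for n
    by (induction n) (simp_all add: scaleC_scaleC)
  have "(\<lambda>n. (z ^ n /\<^sub>R fact n) *\<^sub>C x) sums (exp z *\<^sub>C x)"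
    by (rule bounded_linear.sums[OF scaleC.bounded_linear_left exp_converges])
  then show ?thesis
    using expo_sums[of "scalar_op z" x] unfolding pow scaleC.scaleR_left by (rule sums_unique2[symmetric])
qed

text \<open>On an invariant set the exponential series of an operator on the set is that of any
  extension.\<close>

lemma op_exp_eq_expo:
  fixes A :: "'e::complex_hilbert \<Rightarrow>\<^sub>L 'e"
  assumes "\<And>y. y \<in> S \<Longrightarrow> f y = A y" "\<And>y. y \<in> S \<Longrightarrow> A y \<in> S" "x \<in> S"
  shows "op_exp f x = expo A x"
proof -
  have "(f ^^ n) x = (blinfun_apply A ^^ n) x \<and> (f ^^ n) x \<in> S" for n
    by (induction n) (use assms in auto)
  then show ?thesis using sums_unique[OF expo_sums[of A x]] by (simp add: op_exp_def)
qed

section \<open>The decomposition into blocks\<close>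

context frequency_system begin

definition P_upto :: "nat \<Rightarrow> 'e \<Rightarrow>\<^sub>L 'e" where
  "P_upto k = (\<Sum>l\<in>{l. \<bar>l\<bar> \<le> int k}. P l)"

lemma finite_upto: "finite {l::int. \<bar>l\<bar> \<le> int k}"
  by (rule finite_subset[of _ "{- int k..int k}"]) auto

lemma P_P_upto: "P j (P_upto k x) = (if \<bar>j\<bar> \<le> int k then P j x else 0)"
proof -
  have "P j (P_upto k x) = (\<Sum>i\<in>{l. \<bar>l\<bar> \<le> int k}. if i = j then P j x else 0)"
    unfolding P_upto_def blinfun.sum_left blinfun.sum_right by (rule sum.cong) (auto simp: P_P)
  then show ?thesis by (simp add: finite_upto)
qed

lemma P_upto_idem: "P_upto k (P_upto k x) = P_upto k x"
  by (rule vector_eqI) (simp add: P_P_upto)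

lemma P_upto_complex: "P_upto k \<in> complex_operators"
  unfolding P_upto_def by (rule complex_operators_sum) (rule P_complex)

lemma range_projection:
  fixes A :: "'e \<Rightarrow>\<^sub>L 'e"
  assumes "\<And>x. A (A x) = A x" shows "x \<in> range A \<longleftrightarrow> A x = x"
  using assms by (metis rangeE rangeI)

lemma closed_csubspace_range:
  fixes A :: "'e \<Rightarrow>\<^sub>L 'e"
  assumes A: "\<And>x. A (A x) = A x" "A \<in> complex_operators"
  shows "csubspace (range A)" "closed (range A)"
proof -
  have eq: "range A = {x. A x - x = 0}" using range_projection[OF A(1)] by auto
  show "csubspace (range A)"
    unfolding eq csubspace_def by (auto simp: blinfun.add_right complex_operatorsD[OF A(2)])
  have "closed ((\<lambda>x. A x - x) -` {0})"
    by (intro closed_vimage continuous_intros)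
  then show "closed (range A)" unfolding eq vimage_def by simp
qed

lemma P_range_iff: "x \<in> range (P l) \<longleftrightarrow> P l x = x"
  by (rule range_projection) simp

lemma P_upto_range_iff: "x \<in> range (P_upto k) \<longleftrightarrow> P_upto k x = x"
  by (rule range_projection) (rule P_upto_idem)

definition blocks :: "nat \<Rightarrow> int option set" where
  "blocks k = insert None (Some ` {l. \<bar>l\<bar> > int k})"

definition block_space :: "nat \<Rightarrow> int option \<Rightarrow> 'e set" where
  "block_space k = case_option (range (P_upto k)) (\<lambda>l. range (P l))"

lemma block_decomposition: "orthogonal_decomposition (blocks k) (block_space k)"
  unfolding orthogonal_decomposition_def
proof (intro conjI ballI allI impI)
  fix i assume "i \<in> blocks k"
  show "csubspace (block_space k i)" "closed (block_space k i)"
    unfolding block_space_def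
    using closed_csubspace_range[OF P_upto_idem P_upto_complex] closed_csubspace_range[OF P_idem P_complex]
    by (auto split: option.split)
next
  fix i j x y
  assume ij: "i \<in> blocks k" "j \<in> blocks k" "i \<noteq> j" and xy: "x \<in> block_space k i" "y \<in> block_space k j"
  have upto: "cinner a b = 0" if "P_upto k a = a" "P l b = b" "\<bar>l\<bar> > int k" for a b l
  proof -
    have "cinner a b = cinner (P l (P_upto k a)) b" using that by (simp add: P_selfadjoint)
    then show ?thesis using that(3) by (simp add: P_P_upto cinner.zero_left)
  qed
  show "cinner x y = 0"
  proof (cases i)
    case None
    with ij obtain l where "j = Some l" "\<bar>l\<bar> > int k" by (auto simp: blocks_def)
    then show ?thesis using xy None upto by (simp add: block_space_def P_range_iff P_upto_range_iff)
  next
    case (Some l)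
    then have l: "\<bar>l\<bar> > int k" "P l x = x" using ij xy by (auto simp: blocks_def block_space_def P_range_iff)
    show ?thesis
    proof (cases j)
      case None
      then have "cinner y x = 0" using xy l upto by (simp add: block_space_def P_upto_range_iff)
      then show ?thesis by (metis cinner_commute complex_cnj_zero)
    next
      case (Some l')
      then have "P l' y = y" "l' \<noteq> l" using ij xy \<open>i = Some l\<close> by (auto simp: block_space_def P_range_iff)
      then show ?thesis using cinner_ranges[OF l(2)] by simp
    qed
  qed
next
  fix x
  let ?\<xi> = "case_option (P_upto k x) (\<lambda>l. P l x)"
  have in_space: "\<forall>i\<in>blocks k. ?\<xi> i \<in> block_space k i"
    by (auto simp: blocks_def block_space_def)
  have "((\<lambda>l. P l x) has_sum (x - P_upto k x)) {l. \<bar>l\<bar> > int k}"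
  proof -
    have "((\<lambda>l. P l x) has_sum (x - P_upto k x)) (UNIV - {l. \<bar>l\<bar> \<le> int k})"
      unfolding P_upto_def blinfun.sum_left
      by (intro has_sum_Diff P_has_sum has_sum_finite finite_upto) auto
    moreover have "UNIV - {l. \<bar>l\<bar> \<le> int k} = {l. \<bar>l\<bar> > int k}" by auto
    ultimately show ?thesis by simp
  qed
  then have "(?\<xi> has_sum (x - P_upto k x)) (Some ` {l. \<bar>l\<bar> > int k})"
    by (subst has_sum_reindex) (simp_all add: o_def)
  then have "(?\<xi> has_sum (?\<xi> None + (x - P_upto k x))) (blocks k)"
    unfolding blocks_def by (intro has_sum_insert) auto
  then show "\<exists>\<xi>. (\<forall>i\<in>blocks k. \<xi> i \<in> block_space k i) \<and> (\<xi> has_sum x) (blocks k)"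
    using in_space by auto
qed

text \<open>Nonnegativity is part of the claim because a supremum of reals is arbitrary unless the set
  is known to be bounded and nonempty.\<close>

lemma onorm_on_bounds:
  fixes S :: "'e set"
  assumes "\<And>x. x \<in> S \<Longrightarrow> norm (A x) \<le> K * norm x" "0 \<in> S" "K \<ge> 0" "A 0 = 0"
  shows "0 \<le> onorm_on S A" "onorm_on S A \<le> K"
proof -
  have le: "norm (A x) / norm x \<le> K" if "x \<in> S" for x
    using assms(1)[OF that] assms(3) by (cases "x = 0") (auto simp: divide_le_eq)
  then show "onorm_on S A \<le> K"
    unfolding onorm_on_def using assms(2) by (intro cSUP_least) auto
  have "norm (A 0) / norm (0::'e) \<le> onorm_on S A"
    unfolding onorm_on_def
    by (rule cSUP_upper[of 0 S "\<lambda>x. norm (A x) / norm x"]) (use assms(2) le in \<open>auto intro!: bdd_aboveI2\<close>)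
  then show "0 \<le> onorm_on S A" by simp
qed

section \<open>The group generated by a block diagonal perturbation\<close>

lemma norm_difference_quotient_le:
  "t \<noteq> 0 \<Longrightarrow> cmod ((exp (complex_of_real t * (\<i> * complex_of_real a)) - 1) / complex_of_real t) \<le> \<bar>a\<bar>"
proof -
  assume t: "t \<noteq> 0"
  have "cmod (exp (\<i> * complex_of_real (t * a)) - 1) = 2 * \<bar>sin (t * a / 2)\<bar>"
    by (rule dist_exp_i_1)
  also have "\<dots> \<le> \<bar>t\<bar> * \<bar>a\<bar>" using abs_sin_x_le_abs_x[of "t * a / 2"] by (simp add: abs_mult)
  finally show ?thesis using t by (simp add: norm_divide divide_le_eq mult.commute mult.left_commute)
qed

lemma exp_difference_quotient: "((\<lambda>t. (exp (complex_of_real t * z) - 1) / complex_of_real t) \<longlongrightarrow> z) (at 0)"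
proof -
  have "((\<lambda>t. exp (complex_of_real t * z)) has_vector_derivative (z * exp (complex_of_real 0 * z))) (at 0)"
    by (auto intro!: derivative_eq_intros has_vector_derivative_real_field simp: mult.commute)
  from difference_quotient_tendsto[OF this] show ?thesis
    by (simp add: scaleR_conv_of_real divide_inverse mult.commute)
qed

text \<open>A diagonal operator that is scalar on the central block commutes with every block diagonal
  operator. This yields invariance of the block spaces (with indicator functions for
  \<open>\<mu>\<close>) and the commutation of the two factors of the group.\<close>

lemma block_diagonal_commute:
  fixes A D :: "'e \<Rightarrow>\<^sub>L 'e"
  assumes D: "\<And>j l. \<not> (j = l \<or> \<bar>j\<bar> \<le> int k \<and> \<bar>l\<bar> \<le> int k) \<Longrightarrow> block j D l = 0"
    and A: "\<And>l x. P l (A x) = \<mu> l *\<^sub>C P l x" "\<And>j l. \<bar>j\<bar> \<le> int k \<Longrightarrow> \<bar>l\<bar> \<le> int k \<Longrightarrow> \<mu> j = \<mu> l"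
    and Dc: "D \<in> complex_operators"
  shows "A o\<^sub>L D = D o\<^sub>L A"
proof (rule op_eqI)
  fix j l x
  have AP: "A (P l x) = \<mu> l *\<^sub>C P l x"
    by (rule vector_eqI) (simp add: A P_P P_scaleC scaleC.zero_right)
  have 1: "P j ((A o\<^sub>L D) (P l x)) = \<mu> j *\<^sub>C block j D l x" by (simp add: A block_apply)
  have 2: "P j ((D o\<^sub>L A) (P l x)) = \<mu> l *\<^sub>C block j D l x"
    by (simp add: AP complex_operatorsD[OF Dc] P_scaleC block_apply)
  have "block j D l = 0 \<or> \<mu> j = \<mu> l" using D[of j l] A(2)[of j l] by blast
  then show "P j ((A o\<^sub>L D) (P l x)) = P j ((D o\<^sub>L A) (P l x))"
    unfolding 1 2 by (auto simp: scaleC.zero_right)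
qed

text \<open>Move the frequencies of the central block from \<open>G0\<close> into the bounded part: with
  \<open>L\<close> the restriction of \<open>G0\<close> to the central block,
  \<open>G0 - C = (G0 - L) + D\<close> where \<open>D = L - C\<close> is bounded and
  commutes with the diagonal operator \<open>G0 - L\<close>. Hence the group is the product of the
  unitary group of \<open>G0 - L\<close> and the exponential of \<open>t D\<close>. On an outer
  block, \<open>D\<close> equals \<open>- C\<close>, so its norms are square summable.\<close>

lemma block_diagonal_group:
  assumes C: "hs r C" "block_diagonal k C"
  shows "\<exists>T D. C0_group T \<and> generator T = {(x, u - C x) | x u. (x, u) \<in> G0} \<and>
     blinfun_apply D \<in> complex_operators_on (range (P_upto k)) \<and>
     (\<forall>l. \<bar>l\<bar> > int k \<longrightarrow> blinfun_apply D \<in> complex_operators_on (range (P l))) \<and>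
     (\<lambda>l. (onorm_on (range (P l)) D)\<^sup>2) summable_on {l. \<bar>l\<bar> > int k} \<and>
     (\<forall>t. is_orthogonal_direct_sum (blocks k) (block_space k)
       (case_option (op_exp (\<lambda>x. t *\<^sub>R D x)) (\<lambda>l. op_exp (\<lambda>x. t *\<^sub>R (freq l *\<^sub>C x + D x)))) (T t))"
proof -
  let ?U = "{l::int. \<bar>l\<bar> \<le> int k}"
  define L where "L = (\<Sum>l\<in>?U. scalar_op (freq l) o\<^sub>L P l)"
  define D where "D = L - C"
  have PL: "P j (L x) = (if \<bar>j\<bar> \<le> int k then freq j *\<^sub>C P j x else 0)" for j x
  proof -
    have "P j (L x) = (\<Sum>i\<in>?U. if i = j then freq j *\<^sub>C P j x else 0)"
      unfolding L_def blinfun.sum_left blinfun.sum_right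
      by (rule sum.cong) (auto simp: P_P P_scaleC scaleC.zero_right)
    then show ?thesis by (simp add: finite_upto)
  qed
  have Lc: "L \<in> complex_operators"
    unfolding L_def by (intro complex_operators_sum complex_operators_compose scalar_op_complex P_complex)
  have Dc: "D \<in> complex_operators" unfolding D_def by (intro complex_operators_diff Lc hsD(1)[OF C(1)])
  have blD: "block j D l = 0" if "\<not> (j = l \<or> \<bar>j\<bar> \<le> int k \<and> \<bar>l\<bar> \<le> int k)" for j l
  proof -
    have "block j L l = 0"
      by (rule blinfun_eqI) (use that in \<open>auto simp: block_apply PL P_P scaleC.zero_right\<close>)
    moreover have "block j C l = 0" using C(2) that unfolding block_diagonal_def by blast
    ultimately show ?thesis by (simp add: D_def block_diff)
  qed
  \<comment> \<open>The eigenvalues of \<open>G0 - L\<close>.\<close>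
  define \<nu> where "\<nu> l = (if \<bar>l\<bar> \<le> int k then 0 else freq l)" for l
  have \<nu>_im: "\<nu> l = \<i> * complex_of_real (Im (\<nu> l))" for l by (simp add: \<nu>_def freq_def complex_eq_iff)
  define e where "e t l = exp (complex_of_real t * \<nu> l)" for t :: real and l
  have e1: "cmod (e t l) \<le> 1" for t l
    unfolding e_def norm_exp_eq_Re by (subst \<nu>_im) simp
  define T0 where "T0 t = diag_op (e t)" for t
  have PT0: "P l (T0 t x) = e t l *\<^sub>C P l x" for l t x
    unfolding T0_def by (rule P_diag_op[OF e1])
  have T0c: "T0 t \<in> complex_operators" for t unfolding T0_def by (rule diag_op_complex[OF e1])
  have T0_norm: "norm (T0 t x) \<le> norm x" for t x
    unfolding T0_def using norm_diag_op_le[of "e t" 1 x, OF e1] by simp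
  have T0_add: "T0 (s + t) x = T0 s (T0 t x)" for s t x
    by (rule vector_eqI) (simp add: PT0 scaleC_scaleC e_def exp_add distrib_right)
  have T0_0: "T0 0 x = x" for x by (rule vector_eqI) (simp add: PT0 e_def)
  have T0_cont: "((\<lambda>t. T0 t x) \<longlongrightarrow> T0 s x) (at s)" for s x
    unfolding T0_def
  proof (rule diag_op_tendsto[OF e1 e1])
    show "((\<lambda>t. e t l) \<longlongrightarrow> e s l) (at s)" for l unfolding e_def by (intro tendsto_intros)
  qed
  have T0_joint: "((\<lambda>t. T0 t (y t)) \<longlongrightarrow> T0 s y0) (at s)" if "(y \<longlongrightarrow> y0) (at s)" for y y0 s
  proof -
    have "((\<lambda>t. T0 t (y t - y0)) \<longlongrightarrow> 0) (at s)"
      by (rule Lim_null_comparison[OF _ tendsto_norm_zero[OF LIM_zero[OF that]]]) (simp add: T0_norm)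
    from tendsto_add[OF this T0_cont[of y0 s]] show ?thesis by (simp add: blinfun.diff_right)
  qed
  have T0D: "T0 t o\<^sub>L D = D o\<^sub>L T0 t" for t
    by (rule block_diagonal_commute[OF blD PT0 _ Dc]) (auto simp: e_def \<nu>_def)
  have T0E: "T0 t o\<^sub>L expo (s *\<^sub>R D) = expo (s *\<^sub>R D) o\<^sub>L T0 t" for s t
    by (rule expo_commute) (simp add: blinfun_compose.scaleR_left blinfun_compose.scaleR_right T0D)
  define T where "T t = T0 t o\<^sub>L expo (t *\<^sub>R D)" for t
  have E_add: "expo ((s + t) *\<^sub>R D) = expo (s *\<^sub>R D) o\<^sub>L expo (t *\<^sub>R D)" for s t
    unfolding scaleR_add_left
    by (rule expo_add) (simp add: blinfun_compose.scaleR_left blinfun_compose.scaleR_right)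
  have group: "C0_group T"
    unfolding C0_group_def
  proof (intro conjI allI)
    show "T t \<in> complex_operators" for t
      unfolding T_def by (intro complex_operators_compose T0c expo_complex complex_operators_scaleR Dc)
    show "T 0 = id_blinfun"
      by (rule blinfun_eqI) (simp add: T_def expo_0 T0_0)
    show "T (s + t) = T s o\<^sub>L T t" for s t
    proof (rule blinfun_eqI)
      fix x
      have "T0 t (expo (s *\<^sub>R D) y) = expo (s *\<^sub>R D) (T0 t y)" for y
        using arg_cong[OF T0E[of t s], of "\<lambda>A. A y"] by simp
      then show "T (s + t) x = (T s o\<^sub>L T t) x"
        by (simp add: T_def E_add T0_add)
    qed
    show "continuous_on UNIV (\<lambda>t. T t x)" for x
      unfolding continuous_on_def T_def blinfun_apply_blinfun_compose
      using T0_joint[OF continuous_expo[of _ D x, unfolded continuous_at]] by simp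
  qed
  have quotient: "(T t x - x) /\<^sub>R t = T0 t ((expo (t *\<^sub>R D) x - x) /\<^sub>R t) + (T0 t x - x) /\<^sub>R t" for t x
    by (simp add: T_def blinfun.diff_right blinfun.scaleR_right scaleR_diff_right)
  have D_part: "((\<lambda>t. T0 t ((expo (t *\<^sub>R D) x - x) /\<^sub>R t)) \<longlongrightarrow> D x) (at 0)" for x
    using T0_joint[OF expo_difference_quotient[of D x]] by (simp add: T0_0)
  have T0_part: "P l ((T0 t x - x) /\<^sub>R t) = ((e t l - 1) / complex_of_real t) *\<^sub>C P l x" for t l x
  proof -
    have "P l ((T0 t x - x) /\<^sub>R t) = complex_of_real (inverse t) *\<^sub>C (e t l *\<^sub>C P l x - 1 *\<^sub>C P l x)"
      by (simp add: scaleR_scaleC[of "inverse t" "T0 t x - x"] P_scaleC blinfun.diff_right PT0)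
    also have "\<dots> = (complex_of_real (inverse t) * (e t l - 1)) *\<^sub>C P l x"
      by (simp only: scaleC.diff_left[symmetric] scaleC_scaleC)
    also have "complex_of_real (inverse t) * (e t l - 1) = (e t l - 1) / complex_of_real t"
      by (simp add: divide_inverse mult.commute)
    finally show ?thesis .
  qed
  have gen: "generator T = {(x, u - C x) | x u. (x, u) \<in> G0}"
  proof (intro set_eqI iffI)
    fix p assume "p \<in> generator T"
    then obtain x z where p: "p = (x, z)" and lim: "((\<lambda>t. (T t x - x) /\<^sub>R t) \<longlongrightarrow> z) (at 0)"
      by (auto simp: generator_def)
    have lim0: "((\<lambda>t. (T0 t x - x) /\<^sub>R t) \<longlongrightarrow> z - D x) (at 0)"
      using tendsto_diff[OF lim D_part[of x]] by (simp add: quotient)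
    \<comment> \<open>A coordinatewise limit identifies \<open>z - D x\<close>; membership in the domain comes for free, as it only
      means that the vector with these coordinates exists.\<close>
    have "P l (z - D x) = \<nu> l *\<^sub>C P l x" for l
    proof (rule tendsto_unique[OF _ blinfun.tendsto[OF tendsto_const lim0]])
      show "((\<lambda>t. P l ((T0 t x - x) /\<^sub>R t)) \<longlongrightarrow> \<nu> l *\<^sub>C P l x) (at 0)"
        unfolding T0_part e_def by (rule scaleC.tendsto[OF exp_difference_quotient tendsto_const])
    qed simp
    then have "P l (z + C x) = freq l *\<^sub>C P l x" for l
      using PL[of l x] by (simp add: D_def \<nu>_def blinfun.diff_left blinfun.diff_right blinfun.add_right algebra_simps split: if_splits)
    then have "(x, z + C x) \<in> G0" by (simp add: G0_iff)
    then show "p \<in> {(x, u - C x) | x u. (x, u) \<in> G0}" using p by force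
  next
    fix p assume "p \<in> {(x, u - C x) | x u. (x, u) \<in> G0}"
    then obtain x u where p: "p = (x, u - C x)" and xu: "(x, u) \<in> G0" by auto
    \<comment> \<open>The difference quotient of the unitary group at \<open>x\<close> is \<open>\<sigma> t\<close> applied to \<open>(G0 - L) x\<close>. As \<open>\<sigma>\<close> is
      bounded by \<open>1\<close>, dominated convergence applies.\<close>
    define \<sigma> where "\<sigma> t l = (if t = 0 \<or> \<nu> l = 0 then 1 else (e t l - 1) / complex_of_real t / \<nu> l)" for t l
    have \<sigma>1: "cmod (\<sigma> t l) \<le> 1" for t l
    proof (cases "t = 0 \<or> \<nu> l = 0")
      case False
      have "cmod ((e t l - 1) / complex_of_real t) \<le> \<bar>Im (\<nu> l)\<bar>"
        unfolding e_def using False norm_difference_quotient_le[of t "Im (\<nu> l)"] \<nu>_im[of l] by simp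
      also have "\<bar>Im (\<nu> l)\<bar> = cmod (\<nu> l)" by (subst (2) \<nu>_im) (simp add: norm_mult)
      finally show ?thesis using False unfolding \<sigma>_def
        by (simp add: norm_divide norm_mult divide_le_eq mult.commute)
    qed (auto simp: \<sigma>_def)
    have Pu: "P l (u - L x) = \<nu> l *\<^sub>C P l x" for l
      using xu by (auto simp: G0_iff blinfun.diff_right PL \<nu>_def)
    have "((\<lambda>t. diag_op (\<sigma> t) (u - L x)) \<longlongrightarrow> diag_op (\<lambda>l. 1) (u - L x)) (at 0)"
    proof (rule diag_op_tendsto[OF \<sigma>1])
      fix l
      show "((\<lambda>t. \<sigma> t l) \<longlongrightarrow> 1) (at 0)"
      proof (cases "\<nu> l = 0")
        case False
        have "((\<lambda>t. (e t l - 1) / complex_of_real t / \<nu> l) \<longlongrightarrow> \<nu> l / \<nu> l) (at 0)"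
          unfolding e_def using False by (intro tendsto_divide exp_difference_quotient tendsto_const) auto
        then have "((\<lambda>t. (e t l - 1) / complex_of_real t / \<nu> l) \<longlongrightarrow> 1) (at 0)" using False by simp
        then show ?thesis
        proof (rule Lim_transform_eventually)
          show "\<forall>\<^sub>F t in at 0. (e t l - 1) / complex_of_real t / \<nu> l = \<sigma> t l"
            using eventually_neq_at_within[of 0 0] by eventually_elim (simp add: \<sigma>_def False)
        qed
      qed (simp add: \<sigma>_def)
    qed simp
    moreover have "diag_op (\<lambda>l. 1) (u - L x) = u - L x"
      by (rule vector_eqI) (simp add: P_diag_op[of "\<lambda>l. 1" 1])
    moreover have "\<forall>\<^sub>F t in at 0. diag_op (\<sigma> t) (u - L x) = (T0 t x - x) /\<^sub>R t"
      using eventually_neq_at_within[of 0 0]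
    proof eventually_elim
      fix t :: real assume t: "t \<noteq> 0"
      show "diag_op (\<sigma> t) (u - L x) = (T0 t x - x) /\<^sub>R t"
      proof (rule vector_eqI)
        fix l
        have "\<sigma> t l * \<nu> l = (e t l - 1) / complex_of_real t"
          using t by (simp add: \<sigma>_def e_def)
        then show "P l (diag_op (\<sigma> t) (u - L x)) = P l ((T0 t x - x) /\<^sub>R t)"
          by (simp add: P_diag_op[OF \<sigma>1] Pu T0_part scaleC_scaleC)
      qed
    qed
    ultimately have "((\<lambda>t. (T0 t x - x) /\<^sub>R t) \<longlongrightarrow> u - L x) (at 0)"
      using Lim_transform_eventually by force
    from tendsto_add[OF D_part[of x] this]
    have "((\<lambda>t. (T t x - x) /\<^sub>R t) \<longlongrightarrow> u - C x) (at 0)"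
      by (simp add: quotient D_def blinfun.diff_left)
    then show "p \<in> generator T" by (simp add: generator_def p)
  qed
  have D_upto: "P_upto k o\<^sub>L D = D o\<^sub>L P_upto k"
    by (rule block_diagonal_commute[OF blD, where \<mu> = "\<lambda>l. if \<bar>l\<bar> \<le> int k then 1 else 0"])
       (auto simp: P_P_upto Dc)
  have D_P: "P l o\<^sub>L D = D o\<^sub>L P l" if "\<bar>l\<bar> > int k" for l
    by (rule block_diagonal_commute[OF blD, where \<mu> = "\<lambda>j. if j = l then 1 else 0"])
       (use that in \<open>auto simp: P_P Dc\<close>)
  have on: "A \<in> complex_operators \<Longrightarrow> Q o\<^sub>L A = A o\<^sub>L Q \<Longrightarrow> (\<And>x. Q (Q x) = Q x) \<Longrightarrow>
      blinfun_apply A \<in> complex_operators_on (range Q)" for A Q :: "'e \<Rightarrow>\<^sub>L 'e"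
    unfolding complex_operators_on_def
    by (auto simp: blinfun.add_right complex_operatorsD intro: norm_blinfun)
       (metis blinfun_apply_blinfun_compose rangeI)
  have D_on_upto: "blinfun_apply D \<in> complex_operators_on (range (P_upto k))"
    by (rule on[OF Dc D_upto P_upto_idem])
  have D_on: "blinfun_apply D \<in> complex_operators_on (range (P l))" if "\<bar>l\<bar> > int k" for l
    by (rule on[OF Dc D_P[OF that] P_idem])
  have summable: "(\<lambda>l. (onorm_on (range (P l)) D)\<^sup>2) summable_on {l. \<bar>l\<bar> > int k}"
  proof (rule summable_on_comparison_test)
    have "(\<lambda>(j, l). (norm (block j C l))\<^sup>2) summable_on range (\<lambda>l. (l, l))" by (rule hs_summable[OF C(1)])
    then have "(\<lambda>l. (norm (block l C l))\<^sup>2) summable_on UNIV"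
      by (subst (asm) summable_on_reindex) (auto simp: inj_on_def o_def)
    then show "(\<lambda>l. (norm (block l C l))\<^sup>2) summable_on {l. \<bar>l\<bar> > int k}"
      by (rule summable_on_subset_banach) simp
    fix l assume "l \<in> {l. \<bar>l\<bar> > int k}"
    then have l: "\<bar>l\<bar> > int k" by simp
    have bnd: "norm (D x) \<le> norm (block l C l) * norm x" if "x \<in> range (P l)" for x
    proof -
      have x: "P l x = x" using that by (simp add: P_range_iff)
      have Lx: "L x = 0"
        by (rule vector_eqI) (subst x[symmetric], use l in \<open>auto simp: PL P_P scaleC.zero_right\<close>)
      have "D x = P l (D x)" using arg_cong[OF D_P[OF l], of "\<lambda>A. A x"] x by simp
      also have "\<dots> = - block l C l x" by (simp add: D_def blinfun.diff_left Lx blinfun.minus_right block_apply x)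
      finally show ?thesis by (simp add: norm_blinfun)
    qed
    have "0 \<in> range (P l)" by (metis blinfun.zero_right rangeI)
    note bounds = onorm_on_bounds[OF bnd this norm_ge_zero blinfun.zero_right]
    from bounds show "(onorm_on (range (P l)) D)\<^sup>2 \<le> (norm (block l C l))\<^sup>2" by (intro power_mono)
  qed simp
  have sum: "is_orthogonal_direct_sum (blocks k) (block_space k)
       (case_option (op_exp (\<lambda>x. t *\<^sub>R D x)) (\<lambda>l. op_exp (\<lambda>x. t *\<^sub>R (freq l *\<^sub>C x + D x)))) (T t)" (is "is_orthogonal_direct_sum _ _ ?A _") for t
  proof -
    have Tc: "T t \<in> complex_operators"
      using group by (simp add: C0_group_def)
    have eqA: "?A i x = T t x" if i: "i \<in> blocks k" and x: "x \<in> block_space k i" for i x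
    proof (cases i)
      case None
      then have xr: "x \<in> range (P_upto k)" using x by (simp add: block_space_def)
      have "op_exp (\<lambda>x. t *\<^sub>R D x) x = expo (t *\<^sub>R D) x"
      proof (rule op_exp_eq_expo[OF _ _ xr])
        fix y assume "y \<in> range (P_upto k)"
        then have "P_upto k ((t *\<^sub>R D) y) = (t *\<^sub>R D) y"
          using arg_cong[OF D_upto, of "\<lambda>A. A y"] by (simp add: P_upto_range_iff blinfun.scaleR_left blinfun.scaleR_right)
        then show "(t *\<^sub>R D) y \<in> range (P_upto k)" by (simp only: P_upto_range_iff)
      qed (simp add: blinfun.scaleR_left)
      moreover have "T t x = expo (t *\<^sub>R D) x"
      proof -
        have "T0 t x = x"
        proof (rule vector_eqI)
          fix l
          have "P l x = (if \<bar>l\<bar> \<le> int k then P l x else 0)" using xr by (metis P_P_upto P_upto_range_iff)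
          then show "P l (T0 t x) = P l x" by (auto simp: PT0 e_def \<nu>_def scaleC.zero_right split: if_splits)
        qed
        then show ?thesis using arg_cong[OF T0E[of t t], of "\<lambda>A. A x"] by (simp add: T_def)
      qed
      ultimately show ?thesis using None by simp
    next
      case (Some l)
      then have l: "\<bar>l\<bar> > int k" and xr: "x \<in> range (P l)" using i x by (auto simp: blocks_def block_space_def)
      let ?N = "scalar_op (complex_of_real t * freq l) + t *\<^sub>R D"
      have Nc: "scalar_op z o\<^sub>L (t *\<^sub>R D) = (t *\<^sub>R D) o\<^sub>L scalar_op z" for z
        by (rule blinfun_eqI) (simp add: blinfun.scaleR_left complex_operatorsD[OF Dc] scaleC.scaleR_right)
      have "op_exp (\<lambda>x. t *\<^sub>R (freq l *\<^sub>C x + D x)) x = expo ?N x"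
      proof (rule op_exp_eq_expo[OF _ _ xr])
        fix y assume "y \<in> range (P l)"
        then have "P l (?N y) = ?N y"
          using arg_cong[OF D_P[OF l], of "\<lambda>A. A y"]
          by (simp add: P_range_iff blinfun.add_left blinfun.add_right P_scaleC blinfun.scaleR_left blinfun.scaleR_right)
        then show "?N y \<in> range (P l)" by (simp only: P_range_iff)
      qed (simp add: blinfun.add_left blinfun.scaleR_left scaleR_scaleC scaleC_add_right scaleC_scaleC)
      also have "\<dots> = exp (complex_of_real t * freq l) *\<^sub>C expo (t *\<^sub>R D) x"
        unfolding expo_add[OF Nc] by (simp add: expo_scalar_op)
      also have "\<dots> = T t x"
      proof -
        have "T0 t x = exp (complex_of_real t * freq l) *\<^sub>C x"
        proof (rule vector_eqI)
          fix j
          have "P j x = (if j = l then P j x else 0)" using xr by (metis P_P P_range_iff)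
          then show "P j (T0 t x) = P j (exp (complex_of_real t * freq l) *\<^sub>C x)"
            using l by (auto simp: PT0 e_def \<nu>_def P_scaleC scaleC.zero_right split: if_splits)
        qed
        then show ?thesis
          using arg_cong[OF T0E[of t t], of "\<lambda>A. A x"]
          by (simp add: T_def complex_operatorsD[OF expo_complex[OF complex_operators_scaleR[OF Dc]]])
      qed
      finally show ?thesis using Some by simp
    qed
    have TQ: "Q o\<^sub>L T t = T t o\<^sub>L Q" if "Q o\<^sub>L T0 t = T0 t o\<^sub>L Q" "Q o\<^sub>L D = D o\<^sub>L Q" for Q
    proof -
      have "Q o\<^sub>L expo (t *\<^sub>R D) = expo (t *\<^sub>R D) o\<^sub>L Q"
        by (rule expo_commute) (simp add: blinfun_compose.scaleR_left blinfun_compose.scaleR_right that(2))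
      then show ?thesis unfolding T_def by (metis that(1) blinfun_compose_assoc)
    qed
    have T_on: "blinfun_apply (T t) \<in> complex_operators_on (block_space k i)" if "i \<in> blocks k" for i
    proof (cases i)
      case None
      have "P_upto k o\<^sub>L T0 t = T0 t o\<^sub>L P_upto k"
        by (rule blinfun_eqI, rule vector_eqI) (simp add: P_P_upto PT0 scaleC.zero_right)
      then show ?thesis using None on[OF Tc TQ[OF _ D_upto] P_upto_idem] by (simp add: block_space_def)
    next
      case (Some l)
      then have l: "\<bar>l\<bar> > int k" using that by (auto simp: blocks_def)
      have "P l o\<^sub>L T0 t = T0 t o\<^sub>L P l"
        by (rule blinfun_eqI, rule vector_eqI) (simp add: P_P PT0 P_scaleC scaleC.zero_right)
      then show ?thesis using Some on[OF Tc TQ[OF _ D_P[OF l]] P_idem] by (simp add: block_space_def)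
    qed
    show ?thesis
      unfolding is_orthogonal_direct_sum_def
    proof (intro conjI ballI allI impI block_decomposition)
      fix i assume i: "i \<in> blocks k"
      have cs: "csubspace (block_space k i)"
        using block_decomposition[of k] i unfolding orthogonal_decomposition_def by blast
      show "?A i \<in> complex_operators_on (block_space k i)"
        using T_on[OF i] cs unfolding complex_operators_on_def csubspace_def
        by (simp add: eqA[OF i] image_subset_iff)
    next
      fix x \<xi> assume \<xi>: "(\<forall>i\<in>blocks k. \<xi> i \<in> block_space k i) \<and> (\<xi> has_sum x) (blocks k)"
      then have "((\<lambda>i. T t (\<xi> i)) has_sum T t x) (blocks k)"
        by (intro has_sum_bounded_linear[OF blinfun.bounded_linear_right]) simp
      then show "((\<lambda>i. ?A i (\<xi> i)) has_sum T t x) (blocks k)"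
        by (rule has_sum_cong[THEN iffD1, rotated]) (use \<xi> eqA in auto)
    qed
  qed
  show ?thesis
    by (intro exI[of _ T] exI[of _ D] conjI group gen D_on_upto summable allI impI sum D_on)
qed

section \<open>Similarity of the perturbed group to a block diagonal one\<close>

definition block_diagonalizes ::
    "nat \<Rightarrow> ('e \<Rightarrow>\<^sub>L 'e) \<Rightarrow> ('e \<Rightarrow>\<^sub>L 'e) \<Rightarrow> ('e \<Rightarrow>\<^sub>L 'e) \<Rightarrow> ('e \<Rightarrow>\<^sub>L 'e) \<Rightarrow> (real \<Rightarrow> 'e \<Rightarrow>\<^sub>L 'e) \<Rightarrow> bool" where
  "block_diagonalizes k U U' W D T \<longleftrightarrow> U \<in> complex_operators \<and> U' \<in> complex_operators \<and>
    U o\<^sub>L U' = id_blinfun \<and> U' o\<^sub>L U = id_blinfun \<and> U = id_blinfun + W \<and> (\<exists>r. hs r W) \<and>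
    blinfun_apply D \<in> complex_operators_on (range (P_upto k)) \<and>
    (\<forall>l. \<bar>l\<bar> > int k \<longrightarrow> blinfun_apply D \<in> complex_operators_on (range (P l))) \<and>
    (\<lambda>l. (onorm_on (range (P l)) D)\<^sup>2) summable_on {l. \<bar>l\<bar> > int k} \<and>
    (\<forall>t. is_orthogonal_direct_sum (blocks k) (block_space k)
      (case_option (op_exp (\<lambda>x. t *\<^sub>R D x)) (\<lambda>l. op_exp (\<lambda>x. t *\<^sub>R (freq l *\<^sub>C x + D x))))
      (U' o\<^sub>L T t o\<^sub>L U))"

text \<open>The two similarities are composed to \<open>U = (1 + M1) (1 + M2)\<close>, and the
  group of the block diagonal operator is conjugated with \<open>U\<close>. The generator of the
  conjugate is the conjugate of the generator, and it has the right domain since \<open>U\<close> maps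
  the domain of \<open>G0\<close> onto itself.\<close>

lemma perturbed_group_block_diagonalizable:
  fixes R :: "int \<Rightarrow> 'e \<Rightarrow>\<^sub>L 'e"
  assumes R: "\<And>j. R j \<in> complex_operators" and PR: "\<And>j. P j o\<^sub>L R j = R j"
    and V: "\<And>x u. (x, u) \<in> G0 \<Longrightarrow> \<exists>v. (\<forall>j. P j v = R j x) \<and> norm v \<le> K * (\<Sum>\<^sub>\<infinity>l. norm (P l x))"
    and K: "K \<ge> 0"
    and offdiag: "(\<lambda>(j, l). (norm (R j o\<^sub>L P l) / of_int (j - l))\<^sup>2) summable_on {(j, l). j \<noteq> l}"
    and diag: "(\<lambda>j. (norm (R j o\<^sub>L P j))\<^sup>2) summable_on UNIV"
    and col: "\<And>l. (\<lambda>j. (norm (R j o\<^sub>L P l))\<^sup>2) summable_on UNIV"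
    and prod: "\<And>G r. hs r G \<Longrightarrow>
      (\<And>j l. block j G l = (if j = l then 0 else scalar_op (1 / (freq j - freq l)) o\<^sub>L (R j o\<^sub>L P l))) \<Longrightarrow>
      (\<lambda>(j, l). (norm (R j o\<^sub>L G o\<^sub>L P l))\<^sup>2) summable_on UNIV"
  shows "\<exists>T. C0_group T \<and>
    generator T = {(x, u - v) | x u v. (x, u) \<in> G0 \<and> (\<forall>j. P j v = R j x)} \<and>
    (\<exists>k U U' W D. block_diagonalizes k U U' W D T)"
proof -
  have "\<exists>M B b. hs (1/2) M \<and> hs b B \<and> intertwines M (\<lambda>x a. \<forall>j. P j a = R j x) B"
  proof (rule unbounded_perturbation_similar_bounded[OF R PR _ K offdiag diag col])
    show "\<exists>v. (\<forall>j. P j v = R j x) \<and> norm v \<le> K * (\<Sum>\<^sub>\<infinity>l. norm (P l x))" if "(x, u) \<in> G0" for x u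
      by (rule V[OF that])
  qed (rule prod)
  then obtain M1 B b where M1: "hs (1/2) M1" and B: "hs b B"
    and i1: "intertwines M1 (\<lambda>x a. \<forall>j. P j a = R j x) B"
    by blast
  obtain k M2 C r where M2: "hs (1/2) M2" and C: "hs r C" "block_diagonal k C"
    and i2: "intertwines M2 (\<lambda>x a. a = B x) C"
    using bounded_perturbation_block_diagonalization[OF B] by blast
  obtain W1 where W1: "hs 1 W1" "(id_blinfun + M1) o\<^sub>L (id_blinfun + W1) = id_blinfun"
    "(id_blinfun + W1) o\<^sub>L (id_blinfun + M1) = id_blinfun"
    using hs_neumann[OF M1] by blast
  obtain W2 where W2: "hs 1 W2" "(id_blinfun + M2) o\<^sub>L (id_blinfun + W2) = id_blinfun"
    "(id_blinfun + W2) o\<^sub>L (id_blinfun + M2) = id_blinfun"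
    using hs_neumann[OF M2] by blast
  define U where "U = (id_blinfun + M1) o\<^sub>L (id_blinfun + M2)"
  define U' where "U' = (id_blinfun + W2) o\<^sub>L (id_blinfun + W1)"
  \<comment> \<open>\<open>U - 1\<close>, in the ideal because sums and products of its elements are.\<close>
  define W where "W = M1 + M2 + (M1 o\<^sub>L M2)"
  have UW: "U = id_blinfun + W"
    by (simp add: U_def W_def blinfun_compose.add_left blinfun_compose.add_right ac_simps)
  have hW: "hs (1/2 + 1/2 + 1/2 * (1/2)) W" unfolding W_def by (intro hs_add hs_compose M1 M2)
  have UU': "U o\<^sub>L U' = id_blinfun"
  proof -
    have "U o\<^sub>L U' = (id_blinfun + M1) o\<^sub>L (((id_blinfun + M2) o\<^sub>L (id_blinfun + W2)) o\<^sub>L (id_blinfun + W1))"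
      unfolding U_def U'_def by (simp only: blinfun_compose_assoc)
    then show ?thesis by (simp only: W1 W2 id_blinfun_compose)
  qed
  have U'U: "U' o\<^sub>L U = id_blinfun"
  proof -
    have "U' o\<^sub>L U = (id_blinfun + W2) o\<^sub>L (((id_blinfun + W1) o\<^sub>L (id_blinfun + M1)) o\<^sub>L (id_blinfun + M2))"
      unfolding U_def U'_def by (simp only: blinfun_compose_assoc)
    then show ?thesis by (simp only: W1 W2 id_blinfun_compose)
  qed
  have Uc: "U \<in> complex_operators" unfolding UW
    by (intro complex_operators_add complex_operators_id hsD(1)[OF hW])
  have U'c: "U' \<in> complex_operators" unfolding U'_def
    by (intro complex_operators_compose complex_operators_add complex_operators_id hsD(1)[OF W1(1)] hsD(1)[OF W2(1)])
  have UU'x: "U (U' x) = x" "U' (U x) = x" for x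
    using arg_cong[OF UU', of "\<lambda>A. A x"] arg_cong[OF U'U, of "\<lambda>A. A x"] by simp_all
  obtain S D where S: "C0_group S" "generator S = {(x, u - C x) | x u. (x, u) \<in> G0}"
    and D: "blinfun_apply D \<in> complex_operators_on (range (P_upto k))"
      "\<forall>l. \<bar>l\<bar> > int k \<longrightarrow> blinfun_apply D \<in> complex_operators_on (range (P l))"
      "(\<lambda>l. (onorm_on (range (P l)) D)\<^sup>2) summable_on {l. \<bar>l\<bar> > int k}"
    and sum: "\<forall>t. is_orthogonal_direct_sum (blocks k) (block_space k)
       (case_option (op_exp (\<lambda>x. t *\<^sub>R D x)) (\<lambda>l. op_exp (\<lambda>x. t *\<^sub>R (freq l *\<^sub>C x + D x)))) (S t)"
    using block_diagonal_group[OF C] by (elim exE conjE) (rule that; assumption)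
  define T where "T t = U o\<^sub>L S t o\<^sub>L U'" for t
  have TS: "U' o\<^sub>L T t o\<^sub>L U = S t" for t
    by (rule blinfun_eqI) (simp add: T_def UU'x)
  have group: "C0_group T"
    unfolding C0_group_def
  proof (intro conjI allI)
    show "T t \<in> complex_operators" for t
      unfolding T_def using S(1) by (intro complex_operators_compose Uc U'c) (simp add: C0_group_def)
    show "T 0 = id_blinfun"
      using S(1) by (intro blinfun_eqI) (simp add: T_def C0_group_def UU'x)
    show "T (s + t) = T s o\<^sub>L T t" for s t
      using S(1) by (intro blinfun_eqI) (simp add: T_def C0_group_def UU'x)
    show "continuous_on UNIV (\<lambda>t. T t x)" for x
      unfolding T_def blinfun_apply_blinfun_compose using S(1)
      by (intro bounded_linear.continuous_on[OF blinfun.bounded_linear_right]) (simp add: C0_group_def)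
  qed
  have gen_conj: "(x, y) \<in> generator T \<longleftrightarrow> (U' x, U' y) \<in> generator S" for x y
  proof -
    have q: "U' ((T t x - x) /\<^sub>R t) = (S t (U' x) - U' x) /\<^sub>R t" for t
      by (simp add: T_def blinfun.scaleR_right blinfun.diff_right UU'x)
    have q': "U ((S t (U' x) - U' x) /\<^sub>R t) = (T t x - x) /\<^sub>R t" for t
      by (simp add: T_def blinfun.scaleR_right blinfun.diff_right UU'x)
    show ?thesis
    proof
      assume "(x, y) \<in> generator T"
      then have "((\<lambda>t. (T t x - x) /\<^sub>R t) \<longlongrightarrow> y) (at 0)" by (simp add: generator_def)
      from blinfun.tendsto[OF tendsto_const[of U'] this] show "(U' x, U' y) \<in> generator S"
        by (simp only: q generator_def mem_Collect_eq prod.case)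
    next
      assume "(U' x, U' y) \<in> generator S"
      then have "((\<lambda>t. (S t (U' x) - U' x) /\<^sub>R t) \<longlongrightarrow> U' y) (at 0)" by (simp add: generator_def)
      from blinfun.tendsto[OF tendsto_const[of U] this] show "(x, y) \<in> generator T"
        by (simp only: q' UU'x generator_def mem_Collect_eq prod.case)
    qed
  qed
  have U_apply: "U x = (x + M2 x) + M1 (x + M2 x)" for x
    by (simp add: U_def blinfun.add_left)
  have forward: "\<exists>u' v. (U x, u') \<in> G0 \<and> (\<forall>j. P j v = R j (U x)) \<and> u' - v = U (u - C x)"
    if xu: "(x, u) \<in> G0" for x u
  proof -
    obtain u2 where u2: "(x + M2 x, u2) \<in> G0" "u2 - B (x + M2 x) = (u - C x) + M2 (u - C x)"
      using i2 xu unfolding intertwines_def by blast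
    obtain u1 v where u1: "(U x, u1) \<in> G0" "\<forall>j. P j v = R j (U x)"
      "u1 - v = (u2 - B (x + M2 x)) + M1 (u2 - B (x + M2 x))"
      using i1 u2(1) unfolding intertwines_def U_apply by blast
    have "u1 - v = U (u - C x)" unfolding u1(3) u2(2) U_apply ..
    with u1 show ?thesis by blast
  qed
  have onto: "\<exists>x u. (x, u) \<in> G0 \<and> U x = y" if y: "(y, v) \<in> G0" for y v
  proof -
    obtain y2 v2 where y2: "(y2, v2) \<in> G0" "y2 + M1 y2 = y"
      using i1 y unfolding intertwines_def by blast
    obtain x u where "(x, u) \<in> G0" "x + M2 x = y2"
      using i2 y2(1) unfolding intertwines_def by blast
    with y2(2) show ?thesis unfolding U_apply by blast
  qed
  have unique: "u - v = u' - v'"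
    if "(y, u) \<in> G0" "(y, u') \<in> G0" "\<forall>j. P j v = R j y" "\<forall>j. P j v' = R j y" for y u u' v v'
    using G0_unique[OF that(1,2)] vector_eqI[of v v'] that(3,4) by simp
  have gen: "generator T = {(x, u - v) | x u v. (x, u) \<in> G0 \<and> (\<forall>j. P j v = R j x)}"
  proof (intro set_eqI iffI)
    fix p assume "p \<in> generator T"
    then obtain y z where p: "p = (y, z)" "(U' y, U' z) \<in> generator S" by (cases p) (auto simp: gen_conj)
    then obtain u where u: "(U' y, u) \<in> G0" "U' z = u - C (U' y)" unfolding S(2) by auto
    have z: "z = U (u - C (U' y))" using UU'x(1)[of z] u(2) by simp
    obtain u' v where "(y, u') \<in> G0" "\<forall>j. P j v = R j y" "u' - v = z"
      using forward[OF u(1)] unfolding UU'x z by blast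
    then show "p \<in> {(x, u - v) | x u v. (x, u) \<in> G0 \<and> (\<forall>j. P j v = R j x)}" using p(1) by blast
  next
    fix p assume "p \<in> {(x, u - v) | x u v. (x, u) \<in> G0 \<and> (\<forall>j. P j v = R j x)}"
    then obtain y u v where p: "p = (y, u - v)" "(y, u) \<in> G0" "\<forall>j. P j v = R j y" by blast
    obtain x w where x: "(x, w) \<in> G0" "U x = y" using onto[OF p(2)] by blast
    obtain u' v' where "(y, u') \<in> G0" "\<forall>j. P j v' = R j y" "u' - v' = U (w - C x)"
      using forward[OF x(1)] unfolding x(2) by blast
    then have "u - v = U (w - C x)" using unique[OF p(2) _ p(3)] by metis
    then have "(U' y, U' (u - v)) = (x, w - C x)" using x(2) UU'x(2) by metis
    then have "(U' y, U' (u - v)) \<in> generator S" unfolding S(2) using x(1) by blast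
    then show "p \<in> generator T" unfolding p(1) gen_conj .
  qed
  have "block_diagonalizes k U U' W D T"
    unfolding block_diagonalizes_def TS
    by (intro conjI Uc U'c UU' U'U UW exI[of _ "1/2 + 1/2 + 1/2 * (1/2)"] hW D sum)
  with group gen show ?thesis by blast
qed

end

section \<open>Strong measurability and the strong integral\<close>

lemma complete_measure_lebesgue_on: "S \<in> sets lebesgue \<Longrightarrow> complete_measure (lebesgue_on S)"
proof
  fix A B :: "'a set" assume S: "S \<in> sets lebesgue" and BA: "B \<subseteq> A" and A: "A \<in> null_sets (lebesgue_on S)"
  have "A \<subseteq> S" "A \<in> null_sets lebesgue"
    using A null_sets_restrict_space[OF S] by auto
  then have "B \<in> sets lebesgue" "B \<subseteq> S"
    using BA completion.complete[OF BA] by auto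
  then show "B \<in> sets (lebesgue_on S)" using S by (auto simp: sets_restrict_space)
qed

text \<open>Completeness is needed because strong measurability tolerates changes on null sets, while
  Borel measurability does so only for complete measures.\<close>

locale complete_finite_measure = complete_measure M + finite_measure M for M :: "'a measure"
begin

lemma borel_measurable_AE_cong:
  fixes f g :: "'a \<Rightarrow> 'b::topological_space"
  assumes "f \<in> borel_measurable M" "AE x in M. f x = g x"
  shows "g \<in> borel_measurable M"
proof (rule measurableI)
  fix A :: "'b set" assume "A \<in> sets borel"
  then have a: "f -` A \<inter> space M \<in> sets M" using assms(1) by (rule measurable_sets[rotated])
  have b: "AE x in M. x \<in> f -` A \<inter> space M \<longleftrightarrow> x \<in> g -` A \<inter> space M"
    using assms(2) by eventually_elim simp
  show "g -` A \<inter> space M \<in> sets M" by (rule in_sets_AE[OF b a]) auto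
qed simp

lemma strongly_measurable_iff_borel:
  fixes f :: "'a \<Rightarrow> 'b::{banach, second_countable_topology}"
  shows "strongly_measurable M f \<longleftrightarrow> f \<in> borel_measurable M"
proof
  assume "strongly_measurable M f"
  then obtain s where s: "\<And>i. simple_function M (s i)" "AE x in M. (\<lambda>i. s i x) \<longlonglongrightarrow> f x"
    unfolding strongly_measurable_def by blast
  have "(\<lambda>x. lim (\<lambda>i. s i x)) \<in> borel_measurable M"
    by (intro borel_measurable_lim_metric borel_measurable_simple_function s(1))
  moreover have "AE x in M. lim (\<lambda>i. s i x) = f x"
    using s(2) by eventually_elim (rule limI)
  ultimately show "f \<in> borel_measurable M" by (rule borel_measurable_AE_cong)
next
  assume "f \<in> borel_measurable M"
  from borel_measurable_implies_sequence_metric[OF this, of 0]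
  obtain s where s: "\<forall>i. simple_function M (s i)" "\<forall>x\<in>space M. (\<lambda>i. s i x) \<longlonglongrightarrow> f x"
    by (elim exE conjE)
  then show "strongly_measurable M f"
    unfolding strongly_measurable_def by (intro exI[of _ s] conjI AE_I2) auto
qed

lemma strongly_measurable_compose2:
  assumes f: "strongly_measurable M f" and g: "strongly_measurable M g"
    and h: "\<And>X Y a b. X \<longlonglongrightarrow> a \<Longrightarrow> Y \<longlonglongrightarrow> b \<Longrightarrow> (\<lambda>i::nat. h (X i) (Y i)) \<longlonglongrightarrow> h a b"
  shows "strongly_measurable M (\<lambda>x. h (f x) (g x))"
proof -
  obtain s where s: "\<And>i. simple_function M (s i)" "AE x in M. (\<lambda>i. s i x) \<longlonglongrightarrow> f x"
    using f unfolding strongly_measurable_def by blast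
  obtain t where t: "\<And>i. simple_function M (t i)" "AE x in M. (\<lambda>i. t i x) \<longlonglongrightarrow> g x"
    using g unfolding strongly_measurable_def by blast
  have "\<forall>i. simple_function M (\<lambda>x. h (s i x) (t i x))"
    using simple_function_compose2[OF s(1) t(1), where h = h] by blast
  moreover have "AE x in M. (\<lambda>i. h (s i x) (t i x)) \<longlonglongrightarrow> h (f x) (g x)"
    using s(2) t(2) by eventually_elim (rule h; assumption)
  ultimately show ?thesis unfolding strongly_measurable_def
    by (intro exI[of _ "\<lambda>i x. h (s i x) (t i x)"] conjI)
qed

lemma strongly_measurable_simple: "simple_function M f \<Longrightarrow> strongly_measurable M f"
  unfolding strongly_measurable_def by (intro exI[of _ "\<lambda>_. f"]) simp

lemma strongly_measurable_const: "strongly_measurable M (\<lambda>x. c)"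
  by (rule strongly_measurable_simple) simp

lemma strongly_measurable_AE_cong:
  assumes "strongly_measurable M f" "AE x in M. f x = g x" shows "strongly_measurable M g"
proof -
  obtain s where s: "\<And>i. simple_function M (s i)" "AE x in M. (\<lambda>i. s i x) \<longlonglongrightarrow> f x"
    using assms(1) unfolding strongly_measurable_def by blast
  have "AE x in M. (\<lambda>i. s i x) \<longlonglongrightarrow> g x" using s(2) assms(2) by eventually_elim simp
  with s(1) show ?thesis unfolding strongly_measurable_def by blast
qed

lemma strongly_measurable_add:
  "strongly_measurable M f \<Longrightarrow> strongly_measurable M g \<Longrightarrow> strongly_measurable M (\<lambda>x. f x + g x)"
  by (rule strongly_measurable_compose2) (auto intro: tendsto_add)

lemma strongly_measurable_diff:
  "strongly_measurable M f \<Longrightarrow> strongly_measurable M g \<Longrightarrow> strongly_measurable M (\<lambda>x. f x - g x)"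
  by (rule strongly_measurable_compose2) (auto intro: tendsto_diff)

lemma strongly_measurable_scaleC:
  fixes f :: "'a \<Rightarrow> 'h::complex_hilbert"
  assumes "m \<in> borel_measurable M" "strongly_measurable M f"
  shows "strongly_measurable M (\<lambda>x. m x *\<^sub>C f x)"
  by (rule strongly_measurable_compose2[OF strongly_measurable_iff_borel[THEN iffD2, OF assms(1)] assms(2)])
     (rule scaleC.tendsto)

lemma borel_measurable_cinner:
  fixes f g :: "'a \<Rightarrow> 'h::complex_hilbert"
  assumes "strongly_measurable M f" "strongly_measurable M g"
  shows "(\<lambda>x. cinner (f x) (g x)) \<in> borel_measurable M"
  unfolding strongly_measurable_iff_borel[symmetric]
  by (rule strongly_measurable_compose2[OF assms]) (rule cinner.tendsto)

lemma borel_measurable_norm_strong: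
  assumes "strongly_measurable M f" shows "(\<lambda>x. norm (f x)) \<in> borel_measurable M"
  unfolding strongly_measurable_iff_borel[symmetric]
  by (rule strongly_measurable_compose2[OF assms assms]) (rule tendsto_norm)

text \<open>Pairing with a vector maps the approximating simple functions to scalar ones with convergent
  integrals, and so reduces all later computations to integrals of complex functions.\<close>

lemma has_bochner_integral_cinner:
  fixes f :: "'a \<Rightarrow> 'h::complex_hilbert"
  assumes "has_strong_integral M f v"
  shows "has_bochner_integral M (\<lambda>x. cinner (f x) h) (cinner v h)"
proof -
  from assms obtain s where f: "strongly_measurable M f"
    and s: "\<And>i. Bochner_Integration.simple_bochner_integrable M (s i)"
    and lim: "(\<lambda>i. \<integral>\<^sup>+x. norm (f x - s i x) \<partial>M) \<longlonglongrightarrow> 0"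
    and v: "(\<lambda>i. Bochner_Integration.simple_bochner_integral M (s i)) \<longlonglongrightarrow> v"
    unfolding has_strong_integral_def by blast
  have sm: "strongly_measurable M (s i)" for i
    using s[of i] by (auto simp: simple_bochner_integrable.simps intro: strongly_measurable_simple)
  have bl: "bounded_linear (\<lambda>x. cinner x h)" by (rule cinner.bounded_linear_left)
  show ?thesis
  proof (rule has_bochner_integral.intros[where s = "\<lambda>i x. cinner (s i x) h"])
    show "(\<lambda>x. cinner (f x) h) \<in> borel_measurable M"
      by (rule borel_measurable_cinner[OF f strongly_measurable_const])
    show "Bochner_Integration.simple_bochner_integrable M (\<lambda>x. cinner (s i x) h)" for i
      using simple_bochner_integrable_compose2[OF _ s[of i] s[of i], of "\<lambda>x y. cinner x h"]
      by (simp add: cinner.zero_left)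
    show "(\<lambda>i. Bochner_Integration.simple_bochner_integral M (\<lambda>x. cinner (s i x) h)) \<longlonglongrightarrow> cinner v h"
      using cinner.tendsto[OF v tendsto_const]
      by (simp add: simple_bochner_integral_linear[OF bounded_linear.linear[OF bl] s])
    show "(\<lambda>i. \<integral>\<^sup>+ x. ennreal (norm (cinner (f x) h - cinner (s i x) h)) \<partial>M) \<longlonglongrightarrow> 0"
    proof (rule tendsto_sandwich[OF _ _ tendsto_const])
      show "(\<lambda>i. ennreal (norm h) * (\<integral>\<^sup>+x. norm (f x - s i x) \<partial>M)) \<longlonglongrightarrow> 0"
        using ennreal_tendsto_cmult[OF _ lim, of "ennreal (norm h)"] by simp
      show "\<forall>\<^sub>F i in sequentially. (\<integral>\<^sup>+ x. ennreal (norm (cinner (f x) h - cinner (s i x) h)) \<partial>M)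
          \<le> ennreal (norm h) * (\<integral>\<^sup>+x. norm (f x - s i x) \<partial>M)"
      proof (intro always_eventually allI)
        fix i
        have "(\<integral>\<^sup>+ x. ennreal (norm (cinner (f x) h - cinner (s i x) h)) \<partial>M)
            \<le> (\<integral>\<^sup>+x. ennreal (norm h) * ennreal (norm (f x - s i x)) \<partial>M)"
          by (rule nn_integral_mono)
             (simp add: cinner.diff_left[symmetric] ennreal_mult[symmetric],
              metis cinner_norm_le mult.commute)
        also have "\<dots> = ennreal (norm h) * (\<integral>\<^sup>+x. norm (f x - s i x) \<partial>M)"
        proof (rule nn_integral_cmult)
          have "(\<lambda>x. norm (f x - s i x)) \<in> borel_measurable M"
            by (rule borel_measurable_norm_strong[OF strongly_measurable_diff[OF f sm]])
          then show "(\<lambda>x. ennreal (norm (f x - s i x))) \<in> borel_measurable M" by simp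
        qed
        finally show "(\<integral>\<^sup>+ x. ennreal (norm (cinner (f x) h - cinner (s i x) h)) \<partial>M)
          \<le> ennreal (norm h) * (\<integral>\<^sup>+x. norm (f x - s i x) \<partial>M)" .
      qed
    qed simp
  qed
qed

text \<open>The simple functions in the definition of strong measurability converge almost everywhere
  without any domination. They are set to zero where their norm exceeds twice that of a simple function
  \<open>r i\<close> that converges to \<open>norm (f x)\<close> and is at most twice as large; this
  keeps the limit and provides an integrable majorant, so dominated convergence gives convergence in
  mean.\<close>

lemma has_strong_integral_exists:
  fixes f :: "'a \<Rightarrow> 'h::complex_hilbert"
  assumes f: "strongly_measurable M f" and int: "integrable M (\<lambda>x. norm (f x))"
  shows "\<exists>v. has_strong_integral M f v"
proof -
  obtain s where s: "\<And>i. simple_function M (s i)" "AE x in M. (\<lambda>i. s i x) \<longlonglongrightarrow> f x"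
    using f unfolding strongly_measurable_def by blast
  obtain r :: "nat \<Rightarrow> 'a \<Rightarrow> real" where r': "\<forall>i. simple_function M (r i)"
    "\<forall>x\<in>space M. (\<lambda>i. r i x) \<longlonglongrightarrow> norm (f x)"
    "\<forall>i. \<forall>x\<in>space M. dist (r i x) 0 \<le> 2 * dist (norm (f x)) 0"
    using borel_measurable_implies_sequence_metric[OF borel_measurable_norm_strong[OF f], of 0]
    by (elim exE conjE)
  then have r: "\<And>i. simple_function M (r i)"
    "\<And>x. x \<in> space M \<Longrightarrow> (\<lambda>i. r i x) \<longlonglongrightarrow> norm (f x)"
    "\<And>i x. x \<in> space M \<Longrightarrow> \<bar>r i x\<bar> \<le> 2 * norm (f x)"
    by (auto simp: dist_real_def)
  define t where "t i x = (if norm (s i x) \<le> 2 * \<bar>r i x\<bar> then s i x else 0)" for i x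
  have t: "simple_function M (t i)" for i
    unfolding t_def
    using simple_function_compose2[OF s(1) r(1), of "\<lambda>a b. if norm a \<le> 2 * \<bar>b\<bar> then a else 0" i i] by simp
  have t_le: "norm (t i x) \<le> 4 * norm (f x)" if "x \<in> space M" for i x
    using r(3)[OF that, of i] by (auto simp: t_def)
  have t_lim: "AE x in M. (\<lambda>i. t i x) \<longlonglongrightarrow> f x"
    using s(2) AE_space
  proof eventually_elim
    case (elim x)
    show ?case
    proof (cases "f x = 0")
      case True
      then have "t i x = 0" for i using t_le[OF elim(2), of i] by simp
      then show ?thesis using True by simp
    next
      case False
      have "(\<lambda>i. 2 * \<bar>r i x\<bar> - norm (s i x)) \<longlonglongrightarrow> 2 * \<bar>norm (f x)\<bar> - norm (f x)"
        by (intro tendsto_intros r(2) elim)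
      moreover have "2 * \<bar>norm (f x)\<bar> - norm (f x) > 0" using False by simp
      ultimately have "eventually (\<lambda>i. 2 * \<bar>r i x\<bar> - norm (s i x) > 0) sequentially"
        by (rule order_tendstoD(1))
      then have "eventually (\<lambda>i. s i x = t i x) sequentially"
        by eventually_elim (simp add: t_def)
      with elim(1) show ?thesis by (rule Lim_transform_eventually)
    qed
  qed
  have tm: "strongly_measurable M (t i)" for i by (rule strongly_measurable_simple[OF t])
  have diff_meas: "(\<lambda>x. norm (f x - t i x)) \<in> borel_measurable M" for i
    by (rule borel_measurable_norm_strong[OF strongly_measurable_diff[OF f tm]])
  have bound: "norm (norm (f x - t i x)) \<le> 5 * norm (f x)" if "x \<in> space M" for i x
    using norm_triangle_ineq4[of "f x" "t i x"] t_le[OF that, of i] by simp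
  define a where "a i = (LINT x|M. norm (f x - t i x))" for i
  have a0: "a i \<ge> 0" for i unfolding a_def by simp
  have "a \<longlonglongrightarrow> (LINT x|M. 0)"
    unfolding a_def
  proof (rule integral_dominated_convergence[where w = "\<lambda>x. 5 * norm (f x)"])
    show "AE x in M. (\<lambda>i. norm (f x - t i x)) \<longlonglongrightarrow> 0"
      using t_lim by eventually_elim (auto intro!: tendsto_eq_intros)
    show "AE x in M. norm (norm (f x - t i x)) \<le> 5 * norm (f x)" for i
      using bound by (rule AE_I2)
  qed (use diff_meas int in auto)
  then have a: "a \<longlonglongrightarrow> 0" by simp
  have "integrable M (\<lambda>x. norm (f x - t i x))" for i
    by (rule Bochner_Integration.integrable_bound[where f = "\<lambda>x. 5 * norm (f x)"]) (use int diff_meas bound in \<open>auto intro!: AE_I2\<close>)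
  then have nna: "(\<integral>\<^sup>+x. norm (f x - t i x) \<partial>M) = ennreal (a i)" for i
    unfolding a_def by (rule nn_integral_eq_integral) simp
  have sb: "Bochner_Integration.simple_bochner_integrable M (t i)" for i
    by (rule simple_bochner_integrable.intros[OF t]) (simp add: emeasure_finite)
  let ?I = "\<lambda>i. Bochner_Integration.simple_bochner_integral M (t i)"
  have close: "norm (?I i - ?I j) \<le> a i + a j" for i j
  proof -
    have sbd: "Bochner_Integration.simple_bochner_integrable M (\<lambda>x. t i x - t j x)"
      by (rule simple_bochner_integrable_compose2[OF _ sb sb, of "\<lambda>x y. x - y"]) simp
    have sbn: "Bochner_Integration.simple_bochner_integrable M (\<lambda>x. norm (t i x - t j x))"
      by (rule simple_bochner_integrable_compose2[OF _ sbd sbd, of "\<lambda>x y. norm x"]) simp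
    have "ennreal (norm (?I i - ?I j)) = ennreal (norm (Bochner_Integration.simple_bochner_integral M (\<lambda>x. t i x - t j x)))"
      by (simp add: simple_bochner_integral_diff[OF sb sb])
    also have "\<dots> \<le> ennreal (Bochner_Integration.simple_bochner_integral M (\<lambda>x. norm (t i x - t j x)))"
      by (intro ennreal_leI simple_bochner_integral_norm_bound sbd)
    also have "\<dots> = (\<integral>\<^sup>+x. norm (t i x - t j x) \<partial>M)"
      by (rule simple_bochner_integral_eq_nn_integral[OF sbn]) simp
    also have "\<dots> \<le> (\<integral>\<^sup>+x. ennreal (norm (f x - t i x)) + ennreal (norm (f x - t j x)) \<partial>M)"
    proof (rule nn_integral_mono)
      fix x
      have "norm (t i x - t j x) \<le> norm (f x - t i x) + norm (f x - t j x)"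
        using norm_triangle_ineq4[of "f x - t j x" "f x - t i x"] by simp
      then show "ennreal (norm (t i x - t j x)) \<le> ennreal (norm (f x - t i x)) + ennreal (norm (f x - t j x))"
        by (simp flip: ennreal_plus)
    qed
    also have "\<dots> = ennreal (a i) + ennreal (a j)"
      unfolding nna[symmetric] using diff_meas by (intro nn_integral_add) simp_all
    also have "\<dots> = ennreal (a i + a j)" using a0 by (simp only: ennreal_plus)
    finally show ?thesis by (simp only: ennreal_le_iff[OF add_nonneg_nonneg[OF a0 a0]])
  qed
  have "Cauchy ?I"
    unfolding Cauchy_altdef2
  proof (intro allI impI)
    fix e :: real assume e: "e > 0"
    then have "eventually (\<lambda>i. a i < e / 2) sequentially" by (intro order_tendstoD(2)[OF a]) simp
    then obtain N where N: "\<And>n. n \<ge> N \<Longrightarrow> a n < e / 2" by (auto simp: eventually_sequentially)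
    have "dist (?I n) (?I N) < e" if "n \<ge> N" for n
      using close[of n N] N[OF that] N[of N] by (simp add: dist_norm)
    then show "\<exists>N. \<forall>n\<ge>N. dist (?I n) (?I N) < e" by blast
  qed
  then obtain v where v: "?I \<longlonglongrightarrow> v" using Cauchy_convergent convergent_def by blast
  have "(\<lambda>i. \<integral>\<^sup>+x. norm (f x - t i x) \<partial>M) \<longlonglongrightarrow> 0"
    unfolding nna using tendsto_ennrealI[OF a] by simp
  then have "has_strong_integral M f v"
    unfolding has_strong_integral_def using f sb v by blast
  then show ?thesis by blast
qed

lemma cinner_strong_integral:
  fixes f :: "'a \<Rightarrow> 'h::complex_hilbert"
  assumes "strongly_measurable M f" "integrable M (\<lambda>x. norm (f x))"
  shows "cinner (strong_integral M f) h = (LINT x|M. cinner (f x) h)"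
proof -
  obtain v where v: "has_strong_integral M f v" using has_strong_integral_exists[OF assms] by blast
  have *: "cinner w h = (LINT x|M. cinner (f x) h)" if "has_strong_integral M f w" for w h
    using has_bochner_integral_integral_eq[OF has_bochner_integral_cinner[OF that], of h] by (rule sym)
  have uniq: "w = v" if "has_strong_integral M f w" for w
    by (rule cinner_eqI) (simp only: *[OF that] *[OF v])
  have "(THE w. has_strong_integral M f w) = v" by (rule the_equality[of "has_strong_integral M f", OF v uniq])
  then have "strong_integral M f = v"
    unfolding strong_integral_def using has_strong_integral_exists[OF assms] by (simp only: if_True)
  then show ?thesis using *[OF v] by (simp only:)
qed

end

lemma complete_finite_measure_interval: "complete_finite_measure (lebesgue_on {a..b::real})"
  by (intro complete_finite_measure.intro complete_measure_lebesgue_on finite_measure_lebesgue_on) auto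

section \<open>Completeness of the trigonometric system\<close>

text \<open>Lebesgue's differentiation theorem: at almost every point the function is the limit of
  averages over short intervals, all of which vanish.\<close>

lemma ae_zero_if_integrals_zero:
  fixes \<gamma> :: "real \<Rightarrow> complex"
  assumes int: "integrable (lebesgue_on {0..\<omega>}) \<gamma>"
    and zero: "\<And>s. 0 \<le> s \<Longrightarrow> s \<le> \<omega> \<Longrightarrow> integral {0..s} \<gamma> = 0"
  shows "AE s in lebesgue_on {0..\<omega>}. \<gamma> s = 0"
proof -
  define \<gamma>' where "\<gamma>' t = (if t \<in> {0..\<omega>} then \<gamma> t else 0)" for t
  have int1: "\<gamma> integrable_on {0..\<omega>}" by (rule integrable_on_lebesgue_on[OF int]) simp
  then have "\<gamma>' integrable_on UNIV"
    unfolding \<gamma>'_def using integrable_restrict_UNIV by blast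
  then have "\<gamma>' integrable_on cbox a b" for a b
    by (rule integrable_on_subcbox) simp
  then obtain N where N: "negligible N" "\<And>x e. x \<notin> N \<Longrightarrow> 0 < e \<Longrightarrow>
      \<exists>d>0. \<forall>h. 0 < h \<and> h < d \<longrightarrow> norm (integral (cbox x (x + h *\<^sub>R One)) \<gamma>' /\<^sub>R h ^ DIM(real) - \<gamma>' x) < e"
    by (rule integrable_ccontinuous_explicit) (rule that)
  have "\<gamma> x = 0" if x: "x \<notin> N" "0 < x" "x < \<omega>" for x
  proof (rule ccontr)
    assume nz: "\<gamma> x \<noteq> 0"
    obtain d where d: "d > 0" "\<And>h. 0 < h \<and> h < d \<Longrightarrow>
        norm (integral (cbox x (x + h *\<^sub>R One)) \<gamma>' /\<^sub>R h ^ DIM(real) - \<gamma>' x) < norm (\<gamma> x)"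
      using N(2)[OF x(1), of "norm (\<gamma> x)"] nz by auto
    define h where "h = min (d / 2) (\<omega> - x)"
    have h: "0 < h" "h < d" "x + h \<le> \<omega>" using d(1) x by (auto simp: h_def)
    have "integral {x..x + h} \<gamma>' = integral {x..x + h} \<gamma>"
      by (rule integral_cong) (use x h in \<open>auto simp: \<gamma>'_def\<close>)
    also have "\<dots> = 0"
    proof -
      have "\<gamma> integrable_on {0..x + h}" by (rule integrable_on_subinterval[OF int1]) (use h in auto)
      then have "integral {0..x} \<gamma> + integral {x..x + h} \<gamma> = integral {0..x + h} \<gamma>"
        using x h by (intro Henstock_Kurzweil_Integration.integral_combine) auto
      then show ?thesis using zero[of x] zero[of "x + h"] x h by simp
    qed
    finally have "norm (\<gamma>' x) < norm (\<gamma> x)" using d(2)[of h] h by simp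
    then show False using x by (simp add: \<gamma>'_def)
  qed
  then have sub: "{s \<in> {0..\<omega>}. \<gamma> s \<noteq> 0} \<subseteq> N \<union> {0, \<omega>}" by force
  have "N \<union> {0, \<omega>} \<in> null_sets lebesgue"
    using N(1) by (auto simp: negligible_iff_null_sets[symmetric] intro: negligible_Un)
  then have "AE s in lebesgue. s \<in> {0..\<omega>} \<longrightarrow> \<gamma> s = 0"
    by (rule AE_I') (use sub in auto)
  then show ?thesis by (simp add: AE_restrict_space_iff)
qed

lemma cis_eq_iff_period:
  fixes \<omega> t t' :: real
  assumes "\<omega> > 0" "0 \<le> t" "t < \<omega>" "0 \<le> t'" "t' < \<omega>" "cis (2 * pi * t / \<omega>) = cis (2 * pi * t' / \<omega>)"
  shows "t = t'"
proof -
  have "sin (2 * pi * t / \<omega>) = sin (2 * pi * t' / \<omega>)" "cos (2 * pi * t / \<omega>) = cos (2 * pi * t' / \<omega>)"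
    using assms(6) by (auto simp: complex_eq_iff)
  then obtain n :: int where n: "2 * pi * t / \<omega> = 2 * pi * t' / \<omega> + 2 * pi * of_int n"
    using sin_cos_eq_iff[of "2 * pi * t / \<omega>" "2 * pi * t' / \<omega>"] by blast
  have "t = t' + \<omega> * of_int n"
  proof -
    have "(2 * pi) * (t / \<omega>) = (2 * pi) * (t' / \<omega> + of_int n)" using n by (simp add: algebra_simps)
    moreover have "2 * pi \<noteq> 0" by simp
    ultimately have "t / \<omega> = t' / \<omega> + of_int n"
      using mult_left_cancel[of "2 * pi" "t / \<omega>" "t' / \<omega> + of_int n"] by blast
    then show ?thesis using assms(1) by (simp add: field_simps)
  qed
  moreover have "n = 0"
  proof (rule ccontr)
    assume "n \<noteq> 0"
    then have "\<bar>of_int n :: real\<bar> \<ge> 1" by linarith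
    then have "\<omega> * 1 \<le> \<omega> * \<bar>of_int n :: real\<bar>" using assms(1) by (intro mult_left_mono) auto
    then have "\<bar>\<omega> * of_int n\<bar> \<ge> \<omega>" using assms(1) by (simp add: abs_mult)
    then show False using assms(2-5) \<open>t = t' + \<omega> * of_int n\<close> by linarith
  qed
  ultimately show ?thesis by simp
qed

text \<open>Completeness of the exponentials is shown on the dual side, in terms of the integrable
  functions orthogonal to all of them. These form a module over the trigonometric polynomials, which
  avoids describing the span of the exponentials.\<close>

definition trig_annihilator :: "real \<Rightarrow> (real \<Rightarrow> complex) set" where
  "trig_annihilator \<omega> = {\<gamma>. integrable (lebesgue_on {0..\<omega>}) \<gamma> \<and>
     (\<forall>n::int. (LINT s|lebesgue_on {0..\<omega>}. \<gamma> s * cis (2 * pi * of_int n * s / \<omega>)) = 0)}"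

lemma integrable_mult_bounded:
  fixes \<gamma> q :: "real \<Rightarrow> complex"
  assumes "integrable M \<gamma>" "q \<in> borel_measurable M" "\<And>s. s \<in> space M \<Longrightarrow> cmod (q s) \<le> K"
  shows "integrable M (\<lambda>s. \<gamma> s * q s)"
proof (rule Bochner_Integration.integrable_bound[where f = "\<lambda>s. K * norm (\<gamma> s)"])
  show "integrable M (\<lambda>s. K * norm (\<gamma> s))" using assms(1) by simp
  show "(\<lambda>s. \<gamma> s * q s) \<in> borel_measurable M" using assms(1,2) by simp
  show "AE s in M. norm (\<gamma> s * q s) \<le> norm (K * norm (\<gamma> s))"
  proof (rule AE_I2)
    fix s assume "s \<in> space M"
    then have "cmod (\<gamma> s) * cmod (q s) \<le> cmod (\<gamma> s) * K" by (intro mult_left_mono assms) auto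
    also have "\<dots> \<le> norm (K * norm (\<gamma> s))" by (simp add: abs_mult mult.commute mult_right_mono)
    finally show "norm (\<gamma> s * q s) \<le> norm (K * norm (\<gamma> s))" by (simp add: norm_mult)
  qed
qed

lemma cis_measurable: "(\<lambda>s. cis (a * s)) \<in> borel_measurable (lebesgue_on {0..\<omega>::real})"
  by (rule continuous_imp_measurable_on_sets_lebesgue) (auto intro!: continuous_intros)

lemma trig_annihilator_add:
  "\<gamma> \<in> trig_annihilator \<omega> \<Longrightarrow> \<delta> \<in> trig_annihilator \<omega> \<Longrightarrow> (\<lambda>s. \<gamma> s + \<delta> s) \<in> trig_annihilator \<omega>"
proof -
  assume *: "\<gamma> \<in> trig_annihilator \<omega>" "\<delta> \<in> trig_annihilator \<omega>"
  have "integrable (lebesgue_on {0..\<omega>}) (\<lambda>s. \<phi> s * cis (2 * pi * of_int n * s / \<omega>))"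
    if "\<phi> \<in> trig_annihilator \<omega>" for \<phi> n
    using that cis_measurable[of "2 * pi * of_int n / \<omega>" \<omega>]
    by (intro integrable_mult_bounded[where K = 1]) (auto simp: trig_annihilator_def)
  with * show ?thesis by (simp add: trig_annihilator_def distrib_right)
qed

lemma trig_annihilator_cmult:
  "\<gamma> \<in> trig_annihilator \<omega> \<Longrightarrow> (\<lambda>s. c * \<gamma> s) \<in> trig_annihilator \<omega>"
  by (simp add: trig_annihilator_def mult.assoc)

lemma trig_annihilator_cis:
  assumes "\<gamma> \<in> trig_annihilator \<omega>"
  shows "(\<lambda>s. \<gamma> s * cis (2 * pi * of_int k * s / \<omega>)) \<in> trig_annihilator \<omega>"
proof -
  have "integrable (lebesgue_on {0..\<omega>}) (\<lambda>s. \<gamma> s * cis (2 * pi * of_int k * s / \<omega>))"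
    using assms cis_measurable[of "2 * pi * of_int k / \<omega>" \<omega>]
    by (intro integrable_mult_bounded[where K = 1]) (auto simp: trig_annihilator_def)
  moreover have "\<gamma> s * cis (2 * pi * of_int k * s / \<omega>) * cis (2 * pi * of_int n * s / \<omega>)
      = \<gamma> s * cis (2 * pi * of_int (k + n) * s / \<omega>)" for n s
    by (simp add: mult.assoc cis_mult distrib_left distrib_right add_divide_distrib)
  moreover have "(LINT s|lebesgue_on {0..\<omega>}. \<gamma> s * cis (2 * pi * of_int (k + n) * s / \<omega>)) = 0" for n
    using assms unfolding trig_annihilator_def by blast
  ultimately show ?thesis by (simp only: trig_annihilator_def mem_Collect_eq simp_thms)
qed

text \<open>A real linear functional of \<open>z = cis (2 * pi * s / \<omega>)\<close> is a
  combination of \<open>z\<close> and its conjugate, that is, of the exponentials of index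
  \<open>1\<close> and \<open>-1\<close>; the other cases follow from the module property.\<close>

lemma trig_annihilator_polynomial:
  assumes "real_polynomial_function p"
  shows "\<gamma> \<in> trig_annihilator \<omega> \<Longrightarrow>
    (\<lambda>s. \<gamma> s * complex_of_real (p (cis (2 * pi * s / \<omega>)))) \<in> trig_annihilator \<omega>"
  using assms
proof (induction p arbitrary: \<gamma> rule: real_polynomial_function.induct)
  case (linear f)
  interpret bounded_linear f by fact
  let ?u = "\<lambda>s. cis (2 * pi * of_int 1 * s / \<omega>)" and ?v = "\<lambda>s. cis (2 * pi * of_int (-1) * s / \<omega>)"
  have "\<gamma> s * complex_of_real (f (cis (2 * pi * s / \<omega>)))
      = (complex_of_real (f 1) / 2 - \<i> * complex_of_real (f \<i>) / 2) * (\<gamma> s * ?u s)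
        + (complex_of_real (f 1) / 2 + \<i> * complex_of_real (f \<i>) / 2) * (\<gamma> s * ?v s)" for s
  proof -
    define z where "z = cis (2 * pi * s / \<omega>)"
    have uv: "?u s = z" "?v s = cnj z" by (simp_all add: z_def cis_cnj)
    have "z = Re z *\<^sub>R 1 + Im z *\<^sub>R \<i>" by (simp add: complex_eq_iff)
    then have "f z = Re z * f 1 + Im z * f \<i>" by (metis add scaleR real_scaleR_def)
    moreover have "complex_of_real (Re z * f 1 + Im z * f \<i>)
        = (complex_of_real (f 1) / 2 - \<i> * complex_of_real (f \<i>) / 2) * z
        + (complex_of_real (f 1) / 2 + \<i> * complex_of_real (f \<i>) / 2) * cnj z"
      by (simp add: complex_eq_iff field_simps)
    ultimately show ?thesis unfolding uv z_def[symmetric] by (simp only: distrib_left mult.left_commute)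
  qed
  then show ?case
    using trig_annihilator_add[OF trig_annihilator_cmult[OF trig_annihilator_cis[OF linear.prems, of 1]]
        trig_annihilator_cmult[OF trig_annihilator_cis[OF linear.prems, of "-1"]]]
    by (simp only:)
next
  case (const c)
  then show ?case using trig_annihilator_cmult[of \<gamma> \<omega> "complex_of_real c"] by (simp add: mult.commute)
next
  case (add f g)
  then show ?case using trig_annihilator_add[OF add.IH(1)[OF add.prems] add.IH(2)[OF add.prems]]
    by (simp add: distrib_left)
next
  case (mult f g)
  then show ?case by (simp add: mult.assoc[symmetric])
qed

text \<open>Stone-Weierstrass on the unit circle: polynomials in the real and imaginary part of
  \<open>z\<close> approximate \<open>\<phi>\<close> uniformly.\<close>

lemma trig_annihilator_continuous:
  fixes \<phi> :: "complex \<Rightarrow> real"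
  assumes \<gamma>: "\<gamma> \<in> trig_annihilator \<omega>" and \<phi>: "continuous_on UNIV \<phi>"
  shows "(LINT s|lebesgue_on {0..\<omega>}. \<gamma> s * complex_of_real (\<phi> (cis (2 * pi * s / \<omega>)))) = 0"
proof -
  let ?M = "lebesgue_on {0..\<omega>}"
  let ?z = "\<lambda>s. cis (2 * pi * s / \<omega>)"
  have int: "integrable ?M \<gamma>" using \<gamma> by (simp add: trig_annihilator_def)
  have meas: "(\<lambda>s. complex_of_real (\<psi> (?z s))) \<in> borel_measurable ?M" if "continuous_on UNIV \<psi>" for \<psi> :: "complex \<Rightarrow> real"
  proof (rule continuous_imp_measurable_on_sets_lebesgue)
    have "continuous_on {0..\<omega>} (\<lambda>s. \<psi> (cis (2 * pi * s / \<omega>)))"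
    proof (rule continuous_on_compose2[OF that])
      show "continuous_on {0..\<omega>} (\<lambda>s. cis (2 * pi * s / \<omega>))"
        unfolding divide_inverse by (intro continuous_intros)
    qed simp
    then show "continuous_on {0..\<omega>} (\<lambda>s. complex_of_real (\<psi> (?z s)))" by (rule continuous_on_of_real)
  qed simp
  have contb: "\<exists>K. \<forall>s. cmod (complex_of_real (\<psi> (?z s))) \<le> K" if "continuous_on UNIV \<psi>" for \<psi> :: "complex \<Rightarrow> real"
  proof -
    have "compact (\<psi> ` sphere 0 1)"
      by (intro compact_continuous_image continuous_on_subset[OF that]) auto
    then obtain K where "\<And>z. z \<in> sphere 0 1 \<Longrightarrow> norm (\<psi> z) \<le> K"
      using compact_imp_bounded bounded_iff by (metis image_eqI)
    then show ?thesis by (intro exI[of _ K]) simp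
  qed
  have int\<psi>: "integrable ?M (\<lambda>s. \<gamma> s * complex_of_real (\<psi> (?z s)))" if "continuous_on UNIV \<psi>" for \<psi> :: "complex \<Rightarrow> real"
    using contb[OF that] integrable_mult_bounded[OF int meas[OF that]] by blast
  let ?I = "LINT s|?M. \<gamma> s * complex_of_real (\<phi> (?z s))"
  let ?G = "LINT s|?M. norm (\<gamma> s)"
  have "norm ?I \<le> e * ?G" if e: "e > 0" for e
  proof -
    obtain p where p: "real_polynomial_function p" "\<And>z. z \<in> sphere 0 1 \<Longrightarrow> \<bar>\<phi> z - p z\<bar> < e"
      using Stone_Weierstrass_real_polynomial_function[of "sphere (0::complex) 1" \<phi> e] \<phi> e
      by (auto intro: continuous_on_subset)
    have contp: "continuous_on UNIV p"
      using p(1) by (metis continuous_on_polymonial_function real_polynomial_function_eq)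
    have "(LINT s|?M. \<gamma> s * complex_of_real (p (?z s))) = 0"
    proof -
      have "(\<lambda>s. \<gamma> s * complex_of_real (p (?z s))) \<in> trig_annihilator \<omega>"
        by (rule trig_annihilator_polynomial[OF p(1) \<gamma>])
      then have "(LINT s|?M. \<gamma> s * complex_of_real (p (?z s)) * cis (2 * pi * of_int 0 * s / \<omega>)) = 0"
        unfolding trig_annihilator_def by blast
      then show ?thesis by simp
    qed
    then have "norm ?I = norm (LINT s|?M. \<gamma> s * complex_of_real (\<phi> (?z s)) - \<gamma> s * complex_of_real (p (?z s)))"
      by (simp add: Bochner_Integration.integral_diff int\<psi> \<phi> contp)
    also have "\<dots> \<le> (LINT s|?M. norm (\<gamma> s * complex_of_real (\<phi> (?z s)) - \<gamma> s * complex_of_real (p (?z s))))"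
      by (rule integral_norm_bound)
    also have "\<dots> \<le> (LINT s|?M. e * norm (\<gamma> s))"
    proof (rule integral_mono)
      show "integrable ?M (\<lambda>s. norm (\<gamma> s * complex_of_real (\<phi> (?z s)) - \<gamma> s * complex_of_real (p (?z s))))"
        by (intro integrable_norm Bochner_Integration.integrable_diff int\<psi> \<phi> contp)
      show "integrable ?M (\<lambda>s. e * norm (\<gamma> s))" using int by simp
      fix s
      have "norm (\<gamma> s * complex_of_real (\<phi> (?z s)) - \<gamma> s * complex_of_real (p (?z s)))
          = norm (\<gamma> s) * \<bar>\<phi> (?z s) - p (?z s)\<bar>"
        unfolding right_diff_distrib[symmetric] of_real_diff[symmetric] norm_mult norm_of_real ..
      also have "\<dots> \<le> norm (\<gamma> s) * e"
        using p(2)[of "?z s"] by (intro mult_left_mono) auto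
      finally show "norm (\<gamma> s * complex_of_real (\<phi> (?z s)) - \<gamma> s * complex_of_real (p (?z s))) \<le> e * norm (\<gamma> s)"
        by (simp add: mult.commute)
    qed
    finally show ?thesis by simp
  qed
  then have "norm ?I \<le> e * (?G + 1)" if "e > 0" for e
    using that by (smt (verit, best) mult_left_mono)
  from this[of "e / (?G + 1)" for e] have "norm ?I \<le> 0 + e" if "e > 0" for e
  proof -
    have "?G \<ge> 0" by simp
    then have "?G + 1 > 0" by linarith
    with \<open>\<And>e. e > 0 \<Longrightarrow> norm ?I \<le> e * (?G + 1)\<close>[of "e / (?G + 1)"] that show ?thesis by simp
  qed
  then have "norm ?I \<le> 0" by (rule field_le_epsilon)
  then show ?thesis by simp
qed

text \<open>The image of \<open>{0..s}\<close> on the circle is a closed arc, and its indicator function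
  is a bounded pointwise limit of continuous functions on the circle. The end point
  \<open>\<omega>\<close>, which lies over the same point as \<open>0\<close>, is a null set.\<close>

lemma trig_annihilator_interval:
  assumes \<omega>: "\<omega> > 0" and \<gamma>: "\<gamma> \<in> trig_annihilator \<omega>" and s: "0 \<le> s" "s < \<omega>"
  shows "integral {0..s} \<gamma> = 0"
proof -
  let ?M = "lebesgue_on {0..\<omega>}"
  let ?z = "\<lambda>s. cis (2 * pi * s / \<omega>)"
  define K where "K = ?z ` {0..s}"
  have "continuous_on {0..s} (\<lambda>s. cis (2 * pi * s / \<omega>))"
    unfolding divide_inverse by (intro continuous_intros)
  then have K: "closed K" "K \<noteq> {}"
    using s unfolding K_def by (auto intro!: compact_imp_closed compact_continuous_image)
  define \<phi> where "\<phi> i z = max 0 (1 - real i * infdist z K)" for i z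
  have cont: "continuous_on UNIV (\<phi> i)" for i
    unfolding \<phi>_def by (intro continuous_intros)
  have \<phi>1: "\<bar>\<phi> i z\<bar> \<le> 1" for i z unfolding \<phi>_def using infdist_nonneg[of z K] by auto
  have lim: "(\<lambda>i. \<phi> i z) \<longlonglongrightarrow> (if z \<in> K then 1 else 0)" for z
  proof (cases "z \<in> K")
    case True then show ?thesis by (simp add: \<phi>_def)
  next
    case False
    then have pos: "infdist z K > 0"
      using in_closed_iff_infdist_zero[OF K] infdist_nonneg[of z K] by fastforce
    obtain N :: nat where N: "1 < real N * infdist z K" using reals_Archimedean3[OF pos] by blast
    have "\<phi> i z = 0" if "i \<ge> N" for i
    proof -
      have "real N * infdist z K \<le> real i * infdist z K" using that pos by simp
      then show ?thesis using N by (simp add: \<phi>_def)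
    qed
    then have "eventually (\<lambda>i. \<phi> i z = 0) sequentially" unfolding eventually_sequentially by blast
    then show ?thesis using False by (simp add: tendsto_eventually)
  qed
  have int: "integrable ?M \<gamma>" using \<gamma> by (simp add: trig_annihilator_def)
  have inK: "?z t \<in> K \<longleftrightarrow> t \<le> s" if "t \<in> {0..\<omega>}" "t \<noteq> \<omega>" for t
  proof
    assume "?z t \<in> K"
    then obtain t' where "t' \<in> {0..s}" "?z t = ?z t'" by (auto simp: K_def)
    with cis_eq_iff_period[OF \<omega>, of t t'] that s show "t \<le> s" by auto
  qed (use that in \<open>auto simp: K_def\<close>)
  have meas: "(\<lambda>t. complex_of_real (\<phi> i (?z t))) \<in> borel_measurable ?M" for i
  proof (rule continuous_imp_measurable_on_sets_lebesgue)
    have "continuous_on {0..\<omega>} (\<lambda>t. \<phi> i (cis (2 * pi * t / \<omega>)))"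
    proof (rule continuous_on_compose2[OF cont])
      show "continuous_on {0..\<omega>} (\<lambda>s. cis (2 * pi * s / \<omega>))"
        unfolding divide_inverse by (intro continuous_intros)
    qed simp
    then show "continuous_on {0..\<omega>} (\<lambda>t. complex_of_real (\<phi> i (?z t)))" by (rule continuous_on_of_real)
  qed simp
  have ifm: "(\<lambda>t. if t \<in> {0..s} then \<gamma> t else 0) \<in> borel_measurable ?M"
    by (rule measurable_If_set) (use int in \<open>auto simp: sets_restrict_space\<close>)
  have "(\<lambda>i. LINT t|?M. \<gamma> t * complex_of_real (\<phi> i (?z t))) \<longlonglongrightarrow> (LINT t|?M. (if t \<in> {0..s} then \<gamma> t else 0))"
  proof (rule integral_dominated_convergence[where w = "\<lambda>t. norm (\<gamma> t)"])
    show "(\<lambda>t. if t \<in> {0..s} then \<gamma> t else 0) \<in> borel_measurable ?M" by (rule ifm)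
    show "(\<lambda>t. \<gamma> t * complex_of_real (\<phi> i (?z t))) \<in> borel_measurable ?M" for i
      using int meas by (intro borel_measurable_times) auto
    show "AE t in ?M. norm (\<gamma> t * complex_of_real (\<phi> i (?z t))) \<le> norm (\<gamma> t)" for i
      using \<phi>1 by (intro AE_I2) (auto simp: norm_mult intro!: mult_left_le)
    have "{\<omega>} \<in> null_sets lebesgue" by (simp add: negligible_iff_null_sets[symmetric])
    then have "AE t in lebesgue. t \<noteq> \<omega>" by (rule AE_I') auto
    then have "AE t in lebesgue. t \<in> {0..\<omega>} \<longrightarrow> t \<noteq> \<omega>" by (rule eventually_mono) simp
    then have "AE t in ?M. t \<noteq> \<omega>" by (simp add: AE_restrict_space_iff)
    then show "AE t in ?M. ((\<lambda>i. \<gamma> t * complex_of_real (\<phi> i (?z t))) \<longlonglongrightarrow> (if t \<in> {0..s} then \<gamma> t else 0))"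
      using AE_space
    proof eventually_elim
      case (elim t)
      have "(\<lambda>i. \<gamma> t * complex_of_real (\<phi> i (?z t))) \<longlonglongrightarrow> \<gamma> t * complex_of_real (if ?z t \<in> K then 1 else 0)"
        by (intro tendsto_intros lim)
      moreover have "?z t \<in> K \<longleftrightarrow> t \<in> {0..s}" using inK[of t] elim by auto
      ultimately show ?case by (cases "t \<in> {0..s}") (simp_all only: if_True if_False of_real_1 of_real_0 mult_1_right mult_zero_right)
    qed
  qed (use int in simp)
  moreover have "(LINT t|?M. \<gamma> t * complex_of_real (\<phi> i (?z t))) = 0" for i
    by (rule trig_annihilator_continuous[OF \<gamma> cont])
  ultimately have "(\<lambda>i::nat. 0) \<longlonglongrightarrow> (LINT t|?M. (if t \<in> {0..s} then \<gamma> t else 0))"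
    by (simp only:)
  then have zero: "(LINT t|?M. (if t \<in> {0..s} then \<gamma> t else 0)) = 0"
    by (simp only: LIMSEQ_const_iff)
  have "integrable ?M (\<lambda>t. if t \<in> {0..s} then \<gamma> t else 0)"
    by (rule Bochner_Integration.integrable_bound[OF int ifm]) simp
  then have "(LINT t|?M. (if t \<in> {0..s} then \<gamma> t else 0)) = integral {0..\<omega>} (\<lambda>t. if t \<in> {0..s} then \<gamma> t else 0)"
    by (rule lebesgue_integral_eq_integral) simp
  also have "\<dots> = integral {0..s} \<gamma>"
  proof -
    have "{0..s} \<inter> {0..\<omega>} = {0..s}" using s by auto
    then show ?thesis by (simp only: Henstock_Kurzweil_Integration.integral_restrict_Int)
  qed
  finally show ?thesis using zero by simp
qed

lemma trig_system_complete:
  assumes \<omega>: "\<omega> > 0" and \<gamma>: "\<gamma> \<in> trig_annihilator \<omega>"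
  shows "AE s in lebesgue_on {0..\<omega>}. \<gamma> s = 0"
proof (rule ae_zero_if_integrals_zero)
  show int: "integrable (lebesgue_on {0..\<omega>}) \<gamma>" using \<gamma> by (simp add: trig_annihilator_def)
  fix s assume s: "0 \<le> s" "s \<le> \<omega>"
  show "integral {0..s} \<gamma> = 0"
  proof (cases "s < \<omega>")
    case True with trig_annihilator_interval[OF \<omega> \<gamma> s(1)] show ?thesis by simp
  next
    case False
    then have "s = \<omega>" using s by simp
    moreover have "(LINT s|lebesgue_on {0..\<omega>}. \<gamma> s * cis (2 * pi * of_int 0 * s / \<omega>)) = 0"
      using \<gamma> unfolding trig_annihilator_def by blast
    moreover have "(LINT s|lebesgue_on {0..\<omega>}. \<gamma> s) = integral {0..\<omega>} \<gamma>"
      by (rule lebesgue_integral_eq_integral[OF int]) simp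
    ultimately show ?thesis by simp
  qed
qed

section \<open>The space of square integrable functions\<close>

locale L2_setting =
  fixes \<omega> :: real and cls :: "(real \<Rightarrow> 'h::complex_hilbert) \<Rightarrow> 'e::complex_hilbert"
  assumes \<omega>_pos: "\<omega> > 0" and L2_space: "is_L2_space \<omega> cls"
begin

abbreviation M :: "real measure" where "M \<equiv> lebesgue_on {0..\<omega>}"
abbreviation L2 :: "(real \<Rightarrow> 'h) set" where "L2 \<equiv> L2_functions \<omega>"

sublocale M: complete_finite_measure M by (rule complete_finite_measure_interval)

lemma L2I: "strongly_measurable M f \<Longrightarrow> integrable M (\<lambda>s. (norm (f s))\<^sup>2) \<Longrightarrow> f \<in> L2"
  by (simp add: L2_functions_def)

lemma L2D: "f \<in> L2 \<Longrightarrow> strongly_measurable M f" "f \<in> L2 \<Longrightarrow> integrable M (\<lambda>s. (norm (f s))\<^sup>2)"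
  by (simp_all add: L2_functions_def)

lemma L2_norm_measurable: "f \<in> L2 \<Longrightarrow> (\<lambda>s. norm (f s)) \<in> borel_measurable M"
  by (intro M.borel_measurable_norm_strong L2D)

lemma L2_AE_cong: "f \<in> L2 \<Longrightarrow> AE s in M. f s = g s \<Longrightarrow> g \<in> L2"
proof (rule L2I)
  assume f: "f \<in> L2" and fg: "AE s in M. f s = g s"
  show g: "strongly_measurable M g" by (rule M.strongly_measurable_AE_cong[OF L2D(1)[OF f] fg])
  have "(\<lambda>s. (norm (g s))\<^sup>2) \<in> borel_measurable M"
    by (intro borel_measurable_power M.borel_measurable_norm_strong[OF g])
  then show "integrable M (\<lambda>s. (norm (g s))\<^sup>2)"
    by (rule Bochner_Integration.integrable_bound[OF L2D(2)[OF f]]) (use fg in \<open>eventually_elim, simp\<close>)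
qed

lemma L2_mult:
  assumes m: "m \<in> borel_measurable M" "\<And>s. cmod (m s) \<le> K" and f: "f \<in> L2"
  shows "(\<lambda>s. m s *\<^sub>C f s) \<in> L2"
proof (rule L2I)
  show sm: "strongly_measurable M (\<lambda>s. m s *\<^sub>C f s)"
    by (rule M.strongly_measurable_scaleC[OF m(1) L2D(1)[OF f]])
  show "integrable M (\<lambda>s. (norm (m s *\<^sub>C f s))\<^sup>2)"
  proof (rule Bochner_Integration.integrable_bound[where f = "\<lambda>s. K\<^sup>2 * (norm (f s))\<^sup>2"])
    show "integrable M (\<lambda>s. K\<^sup>2 * (norm (f s))\<^sup>2)" using L2D(2)[OF f] by simp
    show "(\<lambda>s. (norm (m s *\<^sub>C f s))\<^sup>2) \<in> borel_measurable M"
      by (intro borel_measurable_power M.borel_measurable_norm_strong[OF sm])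
    show "AE s in M. norm ((norm (m s *\<^sub>C f s))\<^sup>2) \<le> norm (K\<^sup>2 * (norm (f s))\<^sup>2)"
    proof (rule AE_I2)
      fix s
      have "(cmod (m s))\<^sup>2 \<le> K\<^sup>2" by (intro power_mono m) simp
      then have "(cmod (m s))\<^sup>2 * (norm (f s))\<^sup>2 \<le> K\<^sup>2 * (norm (f s))\<^sup>2" by (rule mult_right_mono) simp
      then show "norm ((norm (m s *\<^sub>C f s))\<^sup>2) \<le> norm (K\<^sup>2 * (norm (f s))\<^sup>2)"
        by (simp add: norm_scaleC power_mult_distrib)
    qed
  qed
qed

lemma L2_add: assumes f: "f \<in> L2" and g: "g \<in> L2" shows "(\<lambda>s. f s + g s) \<in> L2"
proof (rule L2I)
  show sm: "strongly_measurable M (\<lambda>s. f s + g s)"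
    by (rule M.strongly_measurable_add[OF L2D(1)[OF f] L2D(1)[OF g]])
  show "integrable M (\<lambda>s. (norm (f s + g s))\<^sup>2)"
  proof (rule Bochner_Integration.integrable_bound[where f = "\<lambda>s. 2 * (norm (f s))\<^sup>2 + 2 * (norm (g s))\<^sup>2"])
    show "integrable M (\<lambda>s. 2 * (norm (f s))\<^sup>2 + 2 * (norm (g s))\<^sup>2)"
      using L2D(2)[OF f] L2D(2)[OF g] by simp
    show "(\<lambda>s. (norm (f s + g s))\<^sup>2) \<in> borel_measurable M"
      by (intro borel_measurable_power M.borel_measurable_norm_strong[OF sm])
    show "AE s in M. norm ((norm (f s + g s))\<^sup>2) \<le> norm (2 * (norm (f s))\<^sup>2 + 2 * (norm (g s))\<^sup>2)"
    proof (rule AE_I2)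
      fix s
      have "(norm (f s + g s))\<^sup>2 \<le> (norm (f s) + norm (g s))\<^sup>2"
        by (intro power_mono norm_triangle_ineq) simp
      also have "\<dots> \<le> 2 * (norm (f s))\<^sup>2 + 2 * (norm (g s))\<^sup>2"
        using sum_squares_bound[of "norm (f s)" "norm (g s)"] by (simp add: power2_sum)
      finally show "norm ((norm (f s + g s))\<^sup>2) \<le> norm (2 * (norm (f s))\<^sup>2 + 2 * (norm (g s))\<^sup>2)"
        by simp
    qed
  qed
qed

lemma L2_const: "(\<lambda>s. h) \<in> L2"
  by (rule L2I) (simp_all add: M.strongly_measurable_const)

lemma L2_mult_const: "m \<in> borel_measurable M \<Longrightarrow> (\<And>s. cmod (m s) \<le> K) \<Longrightarrow> (\<lambda>s. m s *\<^sub>C h) \<in> L2"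
  by (rule L2_mult[OF _ _ L2_const])

lemma L2_scaleC: "f \<in> L2 \<Longrightarrow> (\<lambda>s. c *\<^sub>C f s) \<in> L2"
  by (rule L2_mult[where K = "cmod c"]) auto

lemma L2_diff: "f \<in> L2 \<Longrightarrow> g \<in> L2 \<Longrightarrow> (\<lambda>s. f s - g s) \<in> L2"
  using L2_add[OF _ L2_scaleC[of g "-1"], of f] by (simp add: scaleC.minus_left)

lemma L2_sum: "(\<And>i. i \<in> I \<Longrightarrow> f i \<in> L2) \<Longrightarrow> (\<lambda>s. \<Sum>i\<in>I. f i s) \<in> L2"
  by (induction I rule: infinite_finite_induct) (auto simp: L2_const L2_add)

lemma L2_norm_integrable: assumes f: "f \<in> L2" shows "integrable M (\<lambda>s. norm (f s))"
proof (rule Bochner_Integration.integrable_bound[where f = "\<lambda>s. 1 + (norm (f s))\<^sup>2"])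
  show "integrable M (\<lambda>s. 1 + (norm (f s))\<^sup>2)" using L2D(2)[OF f] by simp
  show "(\<lambda>s. norm (f s)) \<in> borel_measurable M" by (rule L2_norm_measurable[OF f])
  have "x \<le> 1 + x\<^sup>2" for x :: real
    using sum_squares_bound[of x 1] zero_le_power2[of x] by (smt (verit) one_power2)
  then show "AE s in M. norm (norm (f s)) \<le> norm (1 + (norm (f s))\<^sup>2)"
    by (intro AE_I2) simp
qed

lemma cinner_integrable: assumes f: "f \<in> L2" and g: "g \<in> L2" shows "integrable M (\<lambda>s. cinner (f s) (g s))"
proof (rule Bochner_Integration.integrable_bound[where f = "\<lambda>s. (norm (f s))\<^sup>2 + (norm (g s))\<^sup>2"])
  show "integrable M (\<lambda>s. (norm (f s))\<^sup>2 + (norm (g s))\<^sup>2)" using L2D(2)[OF f] L2D(2)[OF g] by simp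
  show "(\<lambda>s. cinner (f s) (g s)) \<in> borel_measurable M"
    by (rule M.borel_measurable_cinner[OF L2D(1)[OF f] L2D(1)[OF g]])
  show "AE s in M. norm (cinner (f s) (g s)) \<le> norm ((norm (f s))\<^sup>2 + (norm (g s))\<^sup>2)"
  proof (rule AE_I2)
    fix s
    have "norm (cinner (f s) (g s)) \<le> norm (f s) * norm (g s)" by (rule cinner_norm_le)
    also have "\<dots> \<le> (norm (f s))\<^sup>2 + (norm (g s))\<^sup>2"
    proof -
      have "2 * (norm (f s) * norm (g s)) \<le> (norm (f s))\<^sup>2 + (norm (g s))\<^sup>2"
        using sum_squares_bound[of "norm (f s)" "norm (g s)"] by (simp add: mult.assoc)
      moreover have "0 \<le> norm (f s) * norm (g s)" by simp
      ultimately show ?thesis by linarith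
    qed
    finally show "norm (cinner (f s) (g s)) \<le> norm ((norm (f s))\<^sup>2 + (norm (g s))\<^sup>2)" by simp
  qed
qed

section \<open>Classes of functions equal almost everywhere\<close>

lemma cls_eq_iff: "f \<in> L2 \<Longrightarrow> g \<in> L2 \<Longrightarrow> cls f = cls g \<longleftrightarrow> (AE s in M. f s = g s)"
  using L2_space unfolding is_L2_space_def by blast

lemma cls_add: "f \<in> L2 \<Longrightarrow> g \<in> L2 \<Longrightarrow> cls (\<lambda>s. f s + g s) = cls f + cls g"
  using L2_space unfolding is_L2_space_def by blast

lemma cls_scaleC: "f \<in> L2 \<Longrightarrow> cls (\<lambda>s. c *\<^sub>C f s) = c *\<^sub>C cls f"
  using L2_space unfolding is_L2_space_def by blast

lemma cinner_cls: "f \<in> L2 \<Longrightarrow> g \<in> L2 \<Longrightarrow>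
    cinner (cls f) (cls g) = complex_of_real (1 / \<omega>) * (LINT s|M. cinner (f s) (g s))"
  using L2_space unfolding is_L2_space_def by blast

lemma cls_cong_AE: "f \<in> L2 \<Longrightarrow> AE s in M. f s = g s \<Longrightarrow> cls g = cls f"
  using cls_eq_iff[OF _ L2_AE_cong] by metis

lemma cls_image: "cls ` L2 = UNIV"
  using L2_space unfolding is_L2_space_def by (elim conjE)

lemma cls_surj: obtains f where "f \<in> L2" "cls f = x"
proof -
  have "x \<in> cls ` L2" by (simp add: cls_image)
  then show ?thesis using that by blast
qed

lemma cls_diff: "f \<in> L2 \<Longrightarrow> g \<in> L2 \<Longrightarrow> cls (\<lambda>s. f s - g s) = cls f - cls g"
  using cls_add[OF _ L2_scaleC[of g "-1"], of f] cls_scaleC[of g "-1"] by (simp add: scaleC.minus_left)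

lemma cls_zero: "cls (\<lambda>s. 0) = 0"
  using cls_scaleC[OF L2_const, of 0] by simp

lemma cls_sum: "(\<And>i. i \<in> I \<Longrightarrow> f i \<in> L2) \<Longrightarrow> cls (\<lambda>s. \<Sum>i\<in>I. f i s) = (\<Sum>i\<in>I. cls (f i))"
  by (induction I rule: infinite_finite_induct) (auto simp: cls_zero cls_add L2_sum)

lemma norm_cls: assumes f: "f \<in> L2" shows "\<omega> * (norm (cls f))\<^sup>2 = (LINT s|M. (norm (f s))\<^sup>2)"
proof -
  have "complex_of_real ((norm (cls f))\<^sup>2) = complex_of_real (1 / \<omega>) * (LINT s|M. complex_of_real ((norm (f s))\<^sup>2))"
    using cinner_cls[OF f f] by (simp only: cinner_self)
  also have "(LINT s|M. complex_of_real ((norm (f s))\<^sup>2)) = complex_of_real (LINT s|M. (norm (f s))\<^sup>2)"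
    by (rule integral_complex_of_real)
  finally have "complex_of_real ((norm (cls f))\<^sup>2) = complex_of_real (1 / \<omega> * (LINT s|M. (norm (f s))\<^sup>2))"
    by (simp only: of_real_mult)
  then have "(norm (cls f))\<^sup>2 = 1 / \<omega> * (LINT s|M. (norm (f s))\<^sup>2)" by (simp only: of_real_eq_iff)
  then show ?thesis using \<omega>_pos by simp
qed

lemma nn_integral_norm_cls: "f \<in> L2 \<Longrightarrow> (\<integral>\<^sup>+s. ennreal ((norm (f s))\<^sup>2) \<partial>M) = ennreal (\<omega> * (norm (cls f))\<^sup>2)"
  using nn_integral_eq_integral[OF L2D(2)] norm_cls by simp

text \<open>Used for closedness of sets given by a bound on the norm, and with bounds tending to
  \<open>0\<close> for the identification of limits.\<close>

lemma L2_fatou: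
  assumes S: "\<And>n. S n \<in> L2" and lim: "AE s in M. (\<lambda>n. S n s) \<longlonglongrightarrow> G s"
    and le: "eventually (\<lambda>n. norm (cls (S n)) \<le> K) sequentially"
  shows "(\<integral>\<^sup>+s. ennreal ((norm (G s))\<^sup>2) \<partial>M) \<le> ennreal (\<omega> * K\<^sup>2)"
proof -
  have "(\<integral>\<^sup>+s. ennreal ((norm (G s))\<^sup>2) \<partial>M) \<le> (\<integral>\<^sup>+s. liminf (\<lambda>n. ennreal ((norm (S n s))\<^sup>2)) \<partial>M)"
  proof (rule nn_integral_mono_AE)
    show "AE s in M. ennreal ((norm (G s))\<^sup>2) \<le> liminf (\<lambda>n. ennreal ((norm (S n s))\<^sup>2))"
      using lim
    proof eventually_elim
      case (elim s)
      have "(\<lambda>n. ennreal ((norm (S n s))\<^sup>2)) \<longlonglongrightarrow> ennreal ((norm (G s))\<^sup>2)"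
        by (intro tendsto_intros elim)
      from lim_imp_Liminf[OF _ this] show ?case by simp
    qed
  qed
  also have "\<dots> \<le> liminf (\<lambda>n. \<integral>\<^sup>+s. ennreal ((norm (S n s))\<^sup>2) \<partial>M)"
    using L2_norm_measurable[OF S] by (intro nn_integral_liminf) simp
  also have "\<dots> = liminf (\<lambda>n. ennreal (\<omega> * (norm (cls (S n)))\<^sup>2))" by (simp add: nn_integral_norm_cls[OF S])
  also have "\<dots> \<le> ennreal (\<omega> * K\<^sup>2)"
  proof (rule Liminf_le)
    show "eventually (\<lambda>n. ennreal (\<omega> * (norm (cls (S n)))\<^sup>2) \<le> ennreal (\<omega> * K\<^sup>2)) sequentially"
      using le
    proof eventually_elim
      case (elim n)
      then have "(norm (cls (S n)))\<^sup>2 \<le> K\<^sup>2" by (intro power_mono) auto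
      then show ?case using \<omega>_pos by (intro ennreal_leI mult_left_mono) auto
    qed
  qed simp
  finally show ?thesis .
qed

text \<open>Limits in mean square and almost everywhere agree: apply Fatou's lemma to
  \<open>S n s - f s\<close>. Fatou's lemma also spares passing to an almost everywhere convergent
  subsequence.\<close>

lemma L2_limit:
  assumes S: "\<And>n. S n \<in> L2" and f: "f \<in> L2" and lim_cls: "(\<lambda>n. cls (S n)) \<longlonglongrightarrow> cls f"
    and lim: "AE s in M. (\<lambda>n. S n s) \<longlonglongrightarrow> G s"
  shows "AE s in M. f s = G s"
proof -
  have le: "(\<integral>\<^sup>+s. ennreal ((norm (G s - f s))\<^sup>2) \<partial>M) \<le> ennreal (\<omega> * e\<^sup>2)" if e: "e > 0" for e
  proof (rule L2_fatou[where S = "\<lambda>n s. S n s - f s"])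
    show "(\<lambda>s. S n s - f s) \<in> L2" for n by (intro L2_diff S f)
    show "AE s in M. (\<lambda>n. S n s - f s) \<longlonglongrightarrow> G s - f s"
      using lim by eventually_elim (intro tendsto_intros)
    have "eventually (\<lambda>n. dist (cls (S n)) (cls f) < e) sequentially" by (rule tendstoD[OF lim_cls e])
    then show "eventually (\<lambda>n. norm (cls (\<lambda>s. S n s - f s)) \<le> e) sequentially"
      by eventually_elim (simp add: cls_diff[OF S f] dist_norm)
  qed
  have "(\<integral>\<^sup>+s. ennreal ((norm (G s - f s))\<^sup>2) \<partial>M) \<le> 0"
  proof (rule tendsto_lowerbound[where F = "at_right 0"])
    have "((\<lambda>e. ennreal (\<omega> * e\<^sup>2)) \<longlongrightarrow> ennreal (\<omega> * 0\<^sup>2)) (at_right 0)" by (intro tendsto_intros)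
    then show "((\<lambda>e. ennreal (\<omega> * e\<^sup>2)) \<longlongrightarrow> 0) (at_right 0)" by simp
    show "\<forall>\<^sub>F e in at_right 0. (\<integral>\<^sup>+s. ennreal ((norm (G s - f s))\<^sup>2) \<partial>M) \<le> ennreal (\<omega> * e\<^sup>2)"
      using eventually_at_right_less[of "0::real"] by eventually_elim (rule le)
  qed simp
  moreover have "(\<lambda>s. (norm (G s - f s))\<^sup>2) \<in> borel_measurable M"
  proof (rule M.strongly_measurable_iff_borel[THEN iffD1])
    have m: "(\<lambda>s. (norm (S n s - f s))\<^sup>2) \<in> borel_measurable M" for n
      by (intro borel_measurable_power L2_norm_measurable L2_diff S f)
    have "(\<lambda>s. lim (\<lambda>n. (norm (S n s - f s))\<^sup>2)) \<in> borel_measurable M"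
      by (rule borel_measurable_lim_metric[OF m])
    moreover have "AE s in M. lim (\<lambda>n. (norm (S n s - f s))\<^sup>2) = (norm (G s - f s))\<^sup>2"
      using lim by eventually_elim (rule limI, intro tendsto_intros)
    ultimately have "(\<lambda>s. (norm (G s - f s))\<^sup>2) \<in> borel_measurable M" by (rule M.borel_measurable_AE_cong)
    then show "strongly_measurable M (\<lambda>s. (norm (G s - f s))\<^sup>2)" by (simp add: M.strongly_measurable_iff_borel)
  qed
  ultimately have "AE s in M. ennreal ((norm (G s - f s))\<^sup>2) = 0"
    by (subst nn_integral_0_iff_AE[symmetric]) auto
  then show ?thesis by eventually_elim simp
qed

text \<open>Evaluating a sum in the Hilbert space pointwise: the classes of the symmetric partial sums
  converge, and their limit has \<open>F\<close> as a representative by \<open>L2_limit\<close>.\<close>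

lemma cls_has_sum:
  assumes f: "\<And>i::int. f i \<in> L2" and sums: "(\<lambda>i. norm (cls (f i))) summable_on UNIV"
    and F: "\<And>s. s \<in> {0..\<omega>} \<Longrightarrow> ((\<lambda>i. f i s) has_sum F s) UNIV"
  shows "F \<in> L2" "((\<lambda>i. cls (f i)) has_sum cls F) UNIV"
proof -
  have "(\<lambda>i. cls (f i)) summable_on UNIV" using sums by (rule abs_summable_summable)
  then obtain x where x: "((\<lambda>i. cls (f i)) has_sum x) UNIV" unfolding summable_on_def by blast
  obtain g where g: "g \<in> L2" "cls g = x" using cls_surj by blast
  have seq: "(\<lambda>n. \<Sum>i\<in>{- int n..int n}. a i) \<longlonglongrightarrow> z" if "(a has_sum z) UNIV" for a :: "int \<Rightarrow> 'b::{comm_monoid_add, topological_space}" and z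
  proof -
    have "filterlim (\<lambda>n. {- int n..int n}) (finite_subsets_at_top UNIV) sequentially"
      unfolding filterlim_finite_subsets_at_top
    proof (intro allI impI)
      fix X :: "int set" assume X: "finite X \<and> X \<subseteq> UNIV"
      define N where "N = nat (Max (insert 0 (abs ` X)))"
      have "x \<in> {- int n..int n}" if "x \<in> X" "n \<ge> N" for x n
      proof -
        have "\<bar>x\<bar> \<le> Max (insert 0 (abs ` X))" using X that(1) by (intro Max_ge) auto
        then show ?thesis using that(2) by (auto simp: N_def)
      qed
      then show "\<forall>\<^sub>F n in sequentially. finite {- int n..int n} \<and> X \<subseteq> {- int n..int n} \<and> {- int n..int n} \<subseteq> UNIV"
        unfolding eventually_sequentially by (intro exI[of _ N]) blast
    qed
    with that show ?thesis unfolding has_sum_def by (rule filterlim_compose)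
  qed
  have "AE s in M. g s = F s"
  proof (rule L2_limit)
    show "(\<lambda>s. \<Sum>i\<in>{- int n..int n}. f i s) \<in> L2" for n by (intro L2_sum f)
    show "g \<in> L2" by fact
    show "(\<lambda>n. cls (\<lambda>s. \<Sum>i\<in>{- int n..int n}. f i s)) \<longlonglongrightarrow> cls g"
      using seq[OF x] by (simp add: cls_sum f g(2))
    show "AE s in M. (\<lambda>n. \<Sum>i\<in>{- int n..int n}. f i s) \<longlonglongrightarrow> F s"
      by (rule AE_I2) (use seq[OF F] in simp)
  qed
  with L2_AE_cong[OF g(1)] cls_cong_AE[OF g(1)] g(2) x
  show "F \<in> L2" "((\<lambda>i. cls (f i)) has_sum cls F) UNIV" by simp_all
qed

section \<open>Fourier coefficients\<close>

definition ex :: "int \<Rightarrow> real \<Rightarrow> complex" where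
  "ex n s = cis (2 * pi * of_int n * s / \<omega>)"

lemma ex_measurable: "ex n \<in> borel_measurable M"
  unfolding ex_def using cis_measurable[of "2 * pi * of_int n / \<omega>" \<omega>] by simp

lemma cmod_ex [simp]: "cmod (ex n s) = 1"
  by (simp add: ex_def)

lemma ex_mult: "ex n s * ex m s = ex (n + m) s"
  by (simp add: ex_def cis_mult distrib_left distrib_right add_divide_distrib)

lemma cnj_ex: "cnj (ex n s) = ex (- n) s"
  by (simp add: ex_def cis_cnj)

lemma ex_0 [simp]: "ex 0 s = 1" "ex n 0 = 1"
  by (simp_all add: ex_def)

lemma ex_reflect: "ex n (\<omega> - s) = ex (- n) s"
proof -
  have "2 * pi * of_int n * (\<omega> - s) / \<omega> = 2 * pi * of_int n + - (2 * pi * of_int n * s / \<omega>)"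
    using \<omega>_pos by (simp add: field_simps)
  then have "ex n (\<omega> - s) = cis (2 * pi * of_int n) * cis (- (2 * pi * of_int n * s / \<omega>))"
    by (simp only: ex_def cis_mult)
  then show ?thesis by (simp add: ex_def cis_multiple_2pi)
qed

lemma ex_integral: assumes "n \<noteq> 0" "0 \<le> s"
  shows "integral {0..s} (ex n) = (ex n s - 1) / (\<i> * complex_of_real (2 * pi * of_int n / \<omega>))"
proof -
  define a where "a = 2 * pi * of_int n / \<omega>"
  have a: "a \<noteq> 0" using assms(1) \<omega>_pos by (simp add: a_def)
  have ex: "ex n t = exp (\<i> * complex_of_real (a * t))" for t
    by (simp add: ex_def a_def cis_conv_exp)
  have "((\<lambda>t. exp (\<i> * complex_of_real (a * t)) / (\<i> * complex_of_real a)) has_vector_derivative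
      exp (\<i> * complex_of_real (a * t))) (at t within {0..s})" for t
  proof -
    have "((\<lambda>t. exp (complex_of_real t * (\<i> * complex_of_real a)) / (\<i> * complex_of_real a)) has_vector_derivative
      exp (complex_of_real t * (\<i> * complex_of_real a))) (at t within {0..s})"
      using a by (auto intro!: derivative_eq_intros has_vector_derivative_real_field)
    then show ?thesis by (simp add: mult.commute mult.left_commute)
  qed
  then have "((\<lambda>t. exp (\<i> * complex_of_real (a * t))) has_integral
      (exp (\<i> * complex_of_real (a * s)) / (\<i> * complex_of_real a) - exp (\<i> * complex_of_real (a * 0)) / (\<i> * complex_of_real a))) {0..s}"
    by (intro fundamental_theorem_of_calculus assms) auto
  then have "integral {0..s} (ex n) = exp (\<i> * complex_of_real (a * s)) / (\<i> * complex_of_real a) - 1 / (\<i> * complex_of_real a)"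
    unfolding ex[abs_def] by (simp add: integral_unique)
  then show ?thesis by (simp only: ex a_def[symmetric] diff_divide_distrib)
qed

lemma ex_orthogonal: "(LINT s|M. ex n s) = (if n = 0 then complex_of_real \<omega> else 0)"
proof (cases "n = 0")
  case True
  then show ?thesis using \<omega>_pos by (simp add: measure_restrict_space scaleR_conv_of_real)
next
  case False
  have "integrable M (ex n)"
    by (rule Bochner_Integration.integrable_bound[of M "\<lambda>s. 1 :: real"]) (simp_all add: ex_measurable)
  then have "(LINT s|M. ex n s) = integral {0..\<omega>} (ex n)" by (rule lebesgue_integral_eq_integral) simp
  also have "ex n \<omega> = 1" using \<omega>_pos by (simp add: ex_def cis_multiple_2pi)
  then have "integral {0..\<omega>} (ex n) = 0" using ex_integral[OF False, of \<omega>] \<omega>_pos by simp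
  finally show ?thesis using False by simp
qed

text \<open>The isometry of \<open>H\<close> onto the range of the \<open>n\<close>-th projection;
  \<open>coef n\<close> will be its adjoint.\<close>

definition emb :: "int \<Rightarrow> 'h \<Rightarrow> 'e" where
  "emb n h = cls (\<lambda>s. ex n s *\<^sub>C h)"

lemma ex_L2: "f \<in> L2 \<Longrightarrow> (\<lambda>s. ex n s *\<^sub>C f s) \<in> L2"
  by (rule L2_mult[OF ex_measurable, where K = 1]) simp_all

lemma ex_const_L2: "(\<lambda>s. ex n s *\<^sub>C h) \<in> L2"
  by (rule ex_L2[OF L2_const])

lemma cinner_emb_emb: "cinner (emb n h) (emb m k) = (if n = m then cinner h k else 0)"
proof -
  have "cinner (emb n h) (emb m k) = complex_of_real (1 / \<omega>) * (LINT s|M. ex (n - m) s * cinner h k)"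
    unfolding emb_def cinner_cls[OF ex_const_L2 ex_const_L2]
    by (simp add: cinner_scaleC_left cinner_scaleC_right cnj_ex mult.assoc[symmetric] ex_mult)
  also have "\<dots> = (if n = m then cinner h k else 0)"
    using \<omega>_pos by (simp add: ex_orthogonal)
  finally show ?thesis .
qed

lemma emb_add: "emb n (h + k) = emb n h + emb n k"
  using cls_add[OF ex_const_L2 ex_const_L2] by (simp add: emb_def scaleC_add_right)

lemma emb_scaleC: "emb n (c *\<^sub>C h) = c *\<^sub>C emb n h"
  using cls_scaleC[OF ex_const_L2, of c] by (simp add: emb_def scaleC_scaleC mult.commute)

lemma norm_emb: "norm (emb n h) = norm h"
proof -
  have "complex_of_real ((norm (emb n h))\<^sup>2) = complex_of_real ((norm h)\<^sup>2)"
    using cinner_emb_emb[of n h n h] by (simp only: cinner_self if_True simp_thms)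
  then show ?thesis by (simp only: of_real_eq_iff power2_eq_iff_nonneg norm_ge_zero)
qed

lemma cinner_fourier_coeff:
  assumes f: "f \<in> L2" shows "cinner (fourier_coeff \<omega> f n) h = cinner (cls f) (emb n h)"
proof -
  have eq: "cis (- (2 * pi * of_int n * s / \<omega>)) = ex (- n) s" for s by (simp add: ex_def)
  have g: "(\<lambda>s. ex (- n) s *\<^sub>C f s) \<in> L2" by (rule ex_L2[OF f])
  have "cinner (fourier_coeff \<omega> f n) h = (1 / \<omega>) *\<^sub>R (LINT s|M. cinner (ex (- n) s *\<^sub>C f s) h)"
    unfolding fourier_coeff_def eq cinner.scaleR_left
      M.cinner_strong_integral[OF L2D(1)[OF g] L2_norm_integrable[OF g]] ..
  also have "\<dots> = cinner (cls f) (emb n h)"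
    unfolding emb_def cinner_cls[OF f ex_const_L2]
    by (simp add: cinner_scaleC_left cinner_scaleC_right cnj_ex scaleR_conv_of_real)
  finally show ?thesis .
qed

definition coef :: "int \<Rightarrow> 'e \<Rightarrow> 'h" where
  "coef n x = fourier_coeff \<omega> (inv_into L2 cls x) n"

lemma cinner_coef: "cinner (coef n x) h = cinner x (emb n h)"
proof -
  have x: "x \<in> cls ` L2" by (simp add: cls_image)
  have "inv_into L2 cls x \<in> L2" "cls (inv_into L2 cls x) = x"
    by (rule inv_into_into[OF x], rule f_inv_into_f[OF x])
  then show ?thesis using cinner_fourier_coeff[of "inv_into L2 cls x"] by (simp add: coef_def)
qed

lemma fourier_coeff_eq_coef: "f \<in> L2 \<Longrightarrow> fourier_coeff \<omega> f n = coef n (cls f)"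
  by (rule cinner_eqI) (simp add: cinner_fourier_coeff cinner_coef)

lemma coef_add: "coef n (x + y) = coef n x + coef n y"
  by (rule cinner_eqI) (simp add: cinner_coef cinner_add_left)

lemma coef_scaleC: "coef n (c *\<^sub>C x) = c *\<^sub>C coef n x"
  by (rule cinner_eqI) (simp add: cinner_coef cinner_scaleC_left)

lemma coef_emb: "coef n (emb m h) = (if n = m then h else 0)"
  by (rule cinner_eqI) (simp add: cinner_coef cinner_emb_emb cinner.zero_left)

lemma norm_coef_le: "norm (coef n x) \<le> norm x"
proof -
  have "complex_of_real ((norm (coef n x))\<^sup>2) = cinner x (emb n (coef n x))"
    by (metis cinner_coef cinner_self)
  then have "(norm (coef n x))\<^sup>2 = inner x (emb n (coef n x))"
    by (metis Re_complex_of_real inner_eq_Re_cinner)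
  also have "\<dots> \<le> norm x * norm (coef n x)"
    using norm_cauchy_schwarz[of x "emb n (coef n x)"] by (simp add: norm_emb)
  finally show ?thesis by (cases "coef n x = 0") (auto simp: power2_eq_square)
qed

lemma bounded_linear_coef: "bounded_linear (coef n)"
  by (rule bounded_linear_intro[where K = 1])
     (auto simp: coef_add scaleR_scaleC coef_scaleC norm_coef_le)

lemma bounded_linear_emb: "bounded_linear (emb n)"
  by (rule bounded_linear_intro[where K = 1])
     (auto simp: emb_add scaleR_scaleC emb_scaleC norm_emb)

lemma fourier_proj_apply: "fourier_proj cls \<omega> n x = emb n (coef n x)"
proof -
  have "bounded_linear (\<lambda>x. emb n (coef n x))"
    by (rule bounded_linear_compose[OF bounded_linear_emb bounded_linear_coef])
  moreover have "fourier_proj cls \<omega> n = Blinfun (\<lambda>x. emb n (coef n x))"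
    unfolding fourier_proj_def emb_def ex_def coef_def ..
  ultimately show ?thesis by (simp add: bounded_linear_Blinfun_apply)
qed

text \<open>For a fixed vector \<open>h\<close> the scalar function \<open>cinner (f s) h\<close>
  vanishes almost everywhere. The null set depends on \<open>h\<close>, but countably many
  \<open>h\<close> suffice: the values of the simple functions approximating \<open>f\<close>, since
  \<open>cinner (f s) (f s)\<close> is a limit of inner products with them.\<close>

lemma coef_complete: assumes "\<And>n. coef n x = 0" shows "x = 0"
proof -
  obtain f where f: "f \<in> L2" "cls f = x" using cls_surj by blast
  have "AE s in M. cinner (f s) h = 0" for h
  proof (rule trig_system_complete[OF \<omega>_pos])
    have "(LINT s|M. cinner (f s) h * ex n s) = 0" for n
    proof -
      have "cinner (cls f) (emb (- n) h) = 0" using assms f(2) cinner_coef[of "- n" x h] by (simp add: cinner.zero_left)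
      then have "(LINT s|M. cinner (f s) (ex (- n) s *\<^sub>C h)) = 0"
        using \<omega>_pos by (simp add: emb_def cinner_cls[OF f(1) ex_const_L2])
      then show ?thesis by (simp add: cinner_scaleC_right cnj_ex mult.commute)
    qed
    then show "(\<lambda>s. cinner (f s) h) \<in> trig_annihilator \<omega>"
      using cinner_integrable[OF f(1) L2_const] by (simp add: trig_annihilator_def ex_def)
  qed
  moreover obtain t where t: "\<And>i. simple_function M (t i)" "AE s in M. (\<lambda>i. t i s) \<longlonglongrightarrow> f s"
    using L2D(1)[OF f(1)] unfolding strongly_measurable_def by blast
  moreover have "AE s in M. \<forall>h\<in>(\<Union>i. t i ` space M). cinner (f s) h = 0"
  proof (rule AE_ball_countable[THEN iffD2])
    show "countable (\<Union>i. t i ` space M)"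
    proof (rule countable_UN)
      show "countable (t i ` space M)" for i
        using t(1)[of i] by (intro countable_finite) (simp only: simple_function_def)
    qed simp
  qed (use calculation(1) in blast)
  then have "AE s in M. f s = 0"
    using t(2) AE_space
  proof eventually_elim
    case (elim s)
    then have "cinner (f s) (t i s) = 0" for i by blast
    then have "(\<lambda>i. 0) \<longlonglongrightarrow> cinner (f s) (f s)"
      using cinner.tendsto[OF tendsto_const elim(2), of "f s"] by simp
    then have "cinner (f s) (f s) = 0" using LIMSEQ_unique tendsto_const by blast
    then show ?case by (simp add: cinner_self)
  qed
  then have "cls f = cls (\<lambda>s. 0)" using cls_eq_iff[OF f(1) L2_const] by blast
  then show ?thesis using f(2) by (simp add: cls_zero)
qed

lemma P_complex: "fourier_proj cls \<omega> l \<in> complex_operators"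
  by (simp add: complex_operators_def fourier_proj_apply coef_scaleC emb_scaleC)

lemma cinner_emb_left: "cinner (emb n h) y = cinner h (coef n y)"
  by (metis cinner_coef cinner_commute)

lemma emb_zero [simp]: "emb n 0 = 0"
  by (metis norm_emb norm_eq_zero)

lemma projection_system_fourier: "projection_system (fourier_proj cls \<omega>)"
proof
  show "fourier_proj cls \<omega> l \<in> complex_operators" for l by (rule P_complex)
  show "fourier_proj cls \<omega> j (fourier_proj cls \<omega> l x) = (if j = l then fourier_proj cls \<omega> l x else 0)" for j l x
    by (simp add: fourier_proj_apply coef_emb)
  show "cinner (fourier_proj cls \<omega> l x) y = cinner x (fourier_proj cls \<omega> l y)" for l x y
    by (simp add: fourier_proj_apply cinner_emb_left cinner_coef[symmetric])
  show "x = 0" if "\<And>l. fourier_proj cls \<omega> l x = 0" for x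
  proof (rule coef_complete)
    fix n
    have "norm (emb n (coef n x)) = 0" using that[of n] by (simp add: fourier_proj_apply)
    then show "coef n x = 0" by (simp add: norm_emb)
  qed
qed

sublocale F: frequency_system "fourier_proj cls \<omega>" "2 * pi / \<omega>"
  by (intro frequency_system.intro projection_system_fourier frequency_system_axioms.intro)
     (use \<omega>_pos in simp)

abbreviation P :: "int \<Rightarrow> 'e \<Rightarrow>\<^sub>L 'e" where "P \<equiv> fourier_proj cls \<omega>"

lemma norm_P: "norm (P n x) = norm (coef n x)"
  by (simp add: fourier_proj_apply norm_emb)

lemma emb_inject: "emb n h = emb n k \<longleftrightarrow> h = k"
  by (metis coef_emb)

lemma G0_coef_iff: "(x, u) \<in> F.G0 \<longleftrightarrow> (\<forall>n. coef n u = F.freq n *\<^sub>C coef n x)"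
  by (simp add: F.G0_iff fourier_proj_apply emb_scaleC[symmetric] emb_inject)

lemma freq_0: "F.freq 0 = 0"
  by (simp add: F.freq_def)

lemma abs_summable_coef: "(x, u) \<in> F.G0 \<Longrightarrow> (\<lambda>n. norm (coef n x)) summable_on UNIV"
  using F.G0_abs_summable by (simp add: norm_P)

section \<open>The periodic derivative\<close>

text \<open>The integral paired with \<open>h\<close> is, up to the factor \<open>\<omega>\<close>, the
  inner product of \<open>g\<close> with the indicator function of \<open>{0..s}\<close> times
  \<open>h\<close>, and \<open>g\<close> is the sum of its projections. This justifies integrating a
  Fourier series term by term although it need not converge pointwise.\<close>

lemma strong_integral_has_sum:
  assumes g: "g \<in> L2" and s: "0 \<le> s" "s \<le> \<omega>"
  shows "((\<lambda>n. integral {0..s} (ex n) * cinner (coef n (cls g)) h) has_sum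
    cinner (strong_integral (lebesgue_on {0..s}) g) h) UNIV"
proof -
  define ind where "ind t = (if t \<in> {0..s} then 1 else 0 :: complex)" for t
  have sub: "{0..s} \<subseteq> {0..\<omega>}" using s by auto
  have Ms: "lebesgue_on {0..s} = restrict_space M {0..s}"
  proof -
    have "restrict_space M {0..s} = lebesgue_on ({0..\<omega>} \<inter> {0..s})"
      by (rule restrict_restrict_space) auto
    also have "{0..\<omega>} \<inter> {0..s} = {0..s}" using sub by (rule Int_absorb1)
    finally show ?thesis by (rule sym)
  qed
  have SM: "{0..s} \<in> sets M" by (subst sets_restrict_space_iff) (use sub in auto)
  interpret Ms: complete_finite_measure "lebesgue_on {0..s}" by (rule complete_finite_measure_interval)
  have ind: "ind \<in> borel_measurable M"
    unfolding ind_def[abs_def] by (rule measurable_If_set) (use SM s in \<open>auto simp: min_absorb1\<close>)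
  have ind_L2: "(\<lambda>t. ind t *\<^sub>C h) \<in> L2" by (rule L2_mult_const[OF ind, where K = 1]) (simp add: ind_def)
  have ind_cut: "(LINT t|M. cinner (f t) (ind t *\<^sub>C h)) = (LINT t|lebesgue_on {0..s}. cinner (f t) h)" for f
  proof -
    have "(LINT t|M. cinner (f t) (ind t *\<^sub>C h)) = (LINT t|M. (if t \<in> {0..s} then cinner (f t) h else 0))"
      by (rule Bochner_Integration.integral_cong) (auto simp: cinner_scaleC_right ind_def)
    also have "\<dots> = (LINT t|lebesgue_on {0..s}. cinner (f t) h)"
      by (rule Lebesgue_Measure.integral_restrict[OF sub]) auto
    finally show ?thesis .
  qed
  have strong: "cinner (strong_integral (lebesgue_on {0..s}) g) h = (LINT t|lebesgue_on {0..s}. cinner (g t) h)"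
  proof (rule Ms.cinner_strong_integral)
    obtain t where t: "\<And>i. simple_function M (t i)" "AE x in M. (\<lambda>i. t i x) \<longlonglongrightarrow> g x"
      using L2D(1)[OF g] unfolding strongly_measurable_def by blast
    have "simple_function (lebesgue_on {0..s}) (t i)" for i
    proof -
      have "simple_function M (\<lambda>x. indicator {0..s} x *\<^sub>R t i x)"
        by (rule simple_function_compose2[OF simple_function_indicator[OF SM] t(1)])
      then show ?thesis
        unfolding Ms by (subst simple_function_restrict_space) (use SM s in \<open>auto simp: min_absorb1\<close>)
    qed
    moreover have "AE x in lebesgue_on {0..s}. (\<lambda>i. t i x) \<longlonglongrightarrow> g x"
      unfolding Ms using t(2) by (subst AE_restrict_space_iff) (use SM s in \<open>auto elim: eventually_mono simp: min_absorb1\<close>)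
    ultimately show "strongly_measurable (lebesgue_on {0..s}) g" unfolding strongly_measurable_def by blast
    show "integrable (lebesgue_on {0..s}) (\<lambda>x. norm (g x))"
      by (rule integrable_subinterval[of 0 \<omega>]) (use s L2_norm_integrable[OF g] in auto)
  qed
  have "((\<lambda>n. complex_of_real \<omega> * cinner (P n (cls g)) (cls (\<lambda>t. ind t *\<^sub>C h))) has_sum
      complex_of_real \<omega> * cinner (cls g) (cls (\<lambda>t. ind t *\<^sub>C h))) UNIV"
    by (intro has_sum_cmult_right has_sum_bounded_linear[OF cinner.bounded_linear_left] F.P_has_sum)
  moreover have "complex_of_real \<omega> * cinner (cls g) (cls (\<lambda>t. ind t *\<^sub>C h)) = cinner (strong_integral (lebesgue_on {0..s}) g) h"
    using \<omega>_pos by (simp add: cinner_cls[OF g ind_L2] ind_cut strong)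
  moreover have "complex_of_real \<omega> * cinner (P n (cls g)) (cls (\<lambda>t. ind t *\<^sub>C h))
      = integral {0..s} (ex n) * cinner (coef n (cls g)) h" for n
  proof -
    have "complex_of_real \<omega> * cinner (P n (cls g)) (cls (\<lambda>t. ind t *\<^sub>C h))
        = (LINT t|lebesgue_on {0..s}. ex n t * cinner (coef n (cls g)) h)"
      using \<omega>_pos ind_cut[of "\<lambda>t. ex n t *\<^sub>C coef n (cls g)"]
      by (simp add: fourier_proj_apply emb_def cinner_cls[OF ex_const_L2 ind_L2] cinner_scaleC_left)
    also have "\<dots> = (LINT t|lebesgue_on {0..s}. ex n t) * cinner (coef n (cls g)) h"
      by (rule integral_mult_left_zero)
    also have "(LINT t|lebesgue_on {0..s}. ex n t) = integral {0..s} (ex n)"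
    proof (rule lebesgue_integral_eq_integral)
      have "ex n \<in> borel_measurable (lebesgue_on {0..s})"
        unfolding ex_def using cis_measurable[of "2 * pi * of_int n / \<omega>" s] by simp
      then show "integrable (lebesgue_on {0..s}) (ex n)"
        by (rule_tac Bochner_Integration.integrable_bound[where f = "\<lambda>s. 1 :: real"]) simp_all
    qed simp
    finally show ?thesis .
  qed
  ultimately show ?thesis by simp
qed

definition fourier_series :: "'e \<Rightarrow> real \<Rightarrow> 'h" where
  "fourier_series x s = (\<Sum>\<^sub>\<infinity>n. ex n s *\<^sub>C coef n x)"

text \<open>The coefficients of an element of the domain are absolutely summable, so its Fourier series
  converges at every point and gives a distinguished representative.\<close>

lemma fourier_series:
  assumes xu: "(x, u) \<in> F.G0"
  shows fourier_series_has_sum: "((\<lambda>n. ex n s *\<^sub>C coef n x) has_sum fourier_series x s) UNIV"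
    and fourier_series_L2: "fourier_series x \<in> L2"
    and cls_fourier_series: "cls (fourier_series x) = x"
    and fourier_series_periodic: "fourier_series x \<omega> = fourier_series x 0"
proof -
  have abs: "(\<lambda>n. norm (coef n x)) summable_on UNIV" by (rule abs_summable_coef[OF xu])
  have hs: "((\<lambda>n. ex n s *\<^sub>C coef n x) has_sum fourier_series x s) UNIV" for s
  proof -
    have "(\<lambda>n. ex n s *\<^sub>C coef n x) summable_on UNIV"
      by (rule abs_summable_summable) (simp add: norm_scaleC abs)
    then show ?thesis unfolding fourier_series_def by simp
  qed
  then show "((\<lambda>n. ex n s *\<^sub>C coef n x) has_sum fourier_series x s) UNIV" .
  have *: "fourier_series x \<in> L2" "((\<lambda>n. cls (\<lambda>s. ex n s *\<^sub>C coef n x)) has_sum cls (fourier_series x)) UNIV"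
    by (rule cls_has_sum[OF ex_const_L2 _ hs], simp add: emb_def[symmetric] norm_emb abs)+
  show "fourier_series x \<in> L2" by (rule *(1))
  have "((\<lambda>n. P n x) has_sum cls (fourier_series x)) UNIV"
    using *(2) by (simp add: emb_def[symmetric] fourier_proj_apply)
  then show "cls (fourier_series x) = x" by (rule has_sum_unique[OF _ F.P_has_sum])
  have "ex n \<omega> = ex n 0" for n using ex_reflect[of n 0] by simp
  then show "fourier_series x \<omega> = fourier_series x 0" by (simp add: fourier_series_def)
qed

lemma fourier_series_increment:
  assumes xu: "(x, cls g) \<in> F.G0" and g: "g \<in> L2" and s: "0 \<le> s" "s \<le> \<omega>"
  shows "fourier_series x s = fourier_series x 0 + strong_integral (lebesgue_on {0..s}) g"
proof -
  have "cinner (strong_integral (lebesgue_on {0..s}) g) h = cinner (fourier_series x s - fourier_series x 0) h" for h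
  proof (rule has_sum_unique[OF strong_integral_has_sum[OF g s]])
    have "((\<lambda>n. cinner (ex n s *\<^sub>C coef n x + - (ex n 0 *\<^sub>C coef n x)) h) has_sum
        cinner (fourier_series x s + - fourier_series x 0) h) UNIV"
      by (intro has_sum_bounded_linear[OF cinner.bounded_linear_left] has_sum_add
          has_sum_uminus[THEN iffD2] fourier_series_has_sum[OF xu]) (subst minus_minus, rule fourier_series_has_sum[OF xu])
    moreover have "cinner (ex n s *\<^sub>C coef n x + - (ex n 0 *\<^sub>C coef n x)) h
        = integral {0..s} (ex n) * cinner (coef n (cls g)) h" for n
    proof -
      have c: "coef n (cls g) = F.freq n *\<^sub>C coef n x" using xu by (simp add: G0_coef_iff)
      have "integral {0..s} (ex n) * F.freq n = ex n s - 1"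
      proof (cases "n = 0")
        case False
        then have "F.freq n \<noteq> 0" using F.freq_eq_iff[of n 0] by (simp add: freq_0)
        moreover have "F.freq n = \<i> * complex_of_real (2 * pi * of_int n / \<omega>)" by (simp add: F.freq_def)
        ultimately show ?thesis using ex_integral[OF False s(1)] by simp
      qed (simp add: freq_0)
      then have "integral {0..s} (ex n) * cinner (coef n (cls g)) h = (ex n s - 1) * cinner (coef n x) h"
        by (simp add: c cinner_scaleC_left mult.assoc[symmetric])
      then show ?thesis
        by (simp add: cinner.diff_left cinner_scaleC_left left_diff_distrib)
    qed
    ultimately show "((\<lambda>n. integral {0..s} (ex n) * cinner (coef n (cls g)) h) has_sum
        cinner (fourier_series x s - fourier_series x 0) h) UNIV" by simp
  qed
  then have "strong_integral (lebesgue_on {0..s}) g = fourier_series x s - fourier_series x 0"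
    by (rule cinner_eqI)
  then show ?thesis by simp
qed

lemma emb_0_G0: "(emb 0 k, 0) \<in> F.G0"
  by (simp add: F.G0_iff fourier_proj_apply coef_emb freq_0 scaleC.zero_right)

text \<open>The derivative \<open>g\<close> of a periodic function has mean zero, so dividing its
  coefficients by the frequencies defines an element \<open>x\<close> of the domain of
  \<open>G0\<close>. The Fourier series of \<open>x\<close> has the same increments as \<open>y\<close>,
  hence \<open>y\<close> differs from it by a constant, and is itself the sum of its Fourier
  series.\<close>

lemma W21_periodic:
  assumes W: "W21_deriv \<omega> y g" and per: "y 0 = y \<omega>"
  shows "y \<in> L2" "(cls y, cls g) \<in> F.G0"
    "\<And>s. s \<in> {0..\<omega>} \<Longrightarrow> ((\<lambda>n. ex n s *\<^sub>C coef n (cls y)) has_sum y s) UNIV"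
proof -
  have g: "g \<in> L2" using W unfolding W21_deriv_def by (rule conjunct1)
  have "\<forall>s\<in>{0..\<omega>}. y s = y 0 + strong_integral (lebesgue_on {0..s}) g"
    using W unfolding W21_deriv_def by (rule conjunct2)
  then have y: "y s = y 0 + strong_integral (lebesgue_on {0..s}) g" if "s \<in> {0..\<omega>}" for s
    using that by (rule bspec)
  have "strong_integral M g = 0" using y[of \<omega>] per \<omega>_pos by simp
  then have "fourier_coeff \<omega> g 0 = 0" by (simp add: fourier_coeff_def)
  then have u0: "coef 0 (cls g) = 0" by (simp add: fourier_coeff_eq_coef[OF g])
  \<comment> \<open>The subtrahend \<open>F.freq 0\<close> is zero; it makes the gap estimate applicable.\<close>
  define m where "m n = (if n = 0 then 0 else 1 / (F.freq n - F.freq 0))" for n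
  have m: "cmod (m n) \<le> 1 / (2 * pi / \<omega>)" for n
    using F.norm_inverse_freq_diff[of n 0] \<omega>_pos by (auto simp: m_def simp del: norm_divide)
  define x where "x = F.diag_op m (cls g)"
  have "P n (cls g) = F.freq n *\<^sub>C P n x" for n
  proof (cases "n = 0")
    case True then show ?thesis using u0 by (simp add: fourier_proj_apply freq_0)
  next
    case False
    then have "F.freq n \<noteq> 0" using F.freq_eq_iff[of n 0] by (simp add: freq_0)
    then have "F.freq n * m n = 1" using False by (simp add: m_def freq_0)
    then show ?thesis unfolding x_def F.P_diag_op[of m, OF m] by (simp add: scaleC_scaleC)
  qed
  then have xu: "(x, cls g) \<in> F.G0" by (simp add: F.G0_iff)
  define k where "k = y 0 - fourier_series x 0"
  have yF: "y s = fourier_series x s + k" if "s \<in> {0..\<omega>}" for s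
    using y[OF that] fourier_series_increment[OF xu g, of s] that by (simp add: k_def)
  have Fk: "(\<lambda>s. fourier_series x s + k) \<in> L2" by (intro L2_add fourier_series_L2[OF xu] L2_const)
  have ae: "AE s in M. fourier_series x s + k = y s" by (rule AE_I2) (simp add: yF)
  show "y \<in> L2" by (rule L2_AE_cong[OF Fk ae])
  have "emb 0 k = cls (\<lambda>s. k)" by (simp add: emb_def)
  then have cy: "cls y = x + emb 0 k"
    using cls_cong_AE[OF Fk ae] by (simp add: cls_add[OF fourier_series_L2[OF xu] L2_const] cls_fourier_series[OF xu])
  show "(cls y, cls g) \<in> F.G0" unfolding cy using F.G0_add[OF xu emb_0_G0] by simp
  show "((\<lambda>n. ex n s *\<^sub>C coef n (cls y)) has_sum y s) UNIV" if "s \<in> {0..\<omega>}" for s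
  proof -
    have "((\<lambda>n. if n = 0 then k else 0) has_sum k) (UNIV :: int set)"
      by (rule has_sum_finite_neutralI[of "{0}"]) auto
    from has_sum_add[OF fourier_series_has_sum[OF xu, of s] this]
    have "((\<lambda>n. ex n s *\<^sub>C coef n x + (if n = 0 then k else 0)) has_sum y s) UNIV"
      by (simp add: yF[OF that])
    moreover have "ex n s *\<^sub>C coef n x + (if n = 0 then k else 0) = ex n s *\<^sub>C coef n (cls y)" for n
      by (simp add: cy coef_add coef_emb scaleC_add_right scaleC.zero_right)
    ultimately show ?thesis by simp
  qed
qed

lemma G0_W21:
  assumes "(x, u) \<in> F.G0"
  obtains g where "g \<in> L2" "cls g = u" "W21_deriv \<omega> (fourier_series x) g"
proof -
  obtain g where g: "g \<in> L2" "cls g = u" using cls_surj by blast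
  have "W21_deriv \<omega> (fourier_series x) g"
    unfolding W21_deriv_def
  proof (intro conjI ballI g(1))
    fix s assume "s \<in> {0..\<omega>}"
    then show "fourier_series x s = fourier_series x 0 + strong_integral (lebesgue_on {0..s}) g"
      using assms g by (intro fourier_series_increment) auto
  qed
  with g that show ?thesis by blast
qed

lemma op_L0_eq: "op_L0 cls \<omega> = F.G0"
proof (intro set_eqI iffI)
  fix p assume "p \<in> op_L0 cls \<omega>"
  then show "p \<in> F.G0" unfolding op_L0_def using W21_periodic(2) by auto
next
  fix p assume p: "p \<in> F.G0"
  obtain x u where xu: "p = (x, u)" by (cases p)
  obtain g where "g \<in> L2" "cls g = u" "W21_deriv \<omega> (fourier_series x) g"
    using G0_W21 p xu by blast
  then have "(cls (fourier_series x), cls g) \<in> op_L0 cls \<omega>"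
    unfolding op_L0_def using fourier_series_periodic p xu by force
  then show "p \<in> op_L0 cls \<omega>" using cls_fourier_series p xu \<open>cls g = u\<close> by simp
qed

end

section \<open>The perturbation in Fourier coordinates\<close>

text \<open>The uniform boundedness principle in the form for a single seminorm. By Baire's theorem one
  of the closed sets \<open>N x \<le> K\<close>, which cover the space, contains a ball; by
  subadditivity \<open>N\<close> is bounded on the ball of the same radius about
  \<open>0\<close>.\<close>

lemma pointwise_bounded_imp_bounded:
  fixes N :: "'a::banach \<Rightarrow> real"
  assumes tri: "\<And>x y. N (x + y) \<le> N x + N y" and hom: "\<And>r x. N (r *\<^sub>R x) = \<bar>r\<bar> * N x"
    and closed: "\<And>K::nat. closed {x. N x \<le> real K}"
  shows "\<exists>C\<ge>0. \<forall>x. N x \<le> C * norm x"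
proof -
  define E where "E K = {x. N x \<le> real K}" for K :: nat
  have cover: "(\<Union>K. E K) = UNIV"
    unfolding E_def by (auto intro: real_arch_simple)
  obtain K where K: "interior (E K) \<noteq> {}"
  proof (rule ccontr)
    assume "\<not> thesis"
    then have empty: "interior (E K) = {}" for K using that by blast
    have "Met_TC.mtopology interior_of \<Union>(range E) = {}"
    proof (rule Met_TC.metric_Baire_category_alt)
      show "Met_TC.mcomplete TYPE('a)" using complete_UNIV by simp
      show "countable (range E)" by simp
      fix T assume "T \<in> range E"
      then show "closedin Met_TC.mtopology T \<and> Met_TC.mtopology interior_of T = {}"
        using empty closed by (auto simp: E_def)
    qed
    then show False using cover by simp
  qed
  then obtain x0 r where r: "r > 0" "cball x0 r \<subseteq> E K"
    by (metis all_not_in_conv mem_interior_cball)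
  have N_neg: "N (- x) = N x" for x using hom[of "-1" x] by simp
  have N0: "N 0 = 0" using hom[of 0 0] by simp
  have Npos: "N x \<ge> 0" for x using tri[of x "- x"] N_neg[of x] N0 by simp
  have small: "N x \<le> 2 * real K" if "norm x \<le> r" for x
  proof -
    have "x0 + x \<in> E K" "x0 \<in> E K" using r that by (auto simp: dist_norm subset_iff)
    then have "N (x0 + x) \<le> real K" "N x0 \<le> real K" by (simp_all add: E_def)
    moreover have "N x \<le> N (x0 + x) + N (- x0)" using tri[of "x0 + x" "- x0"] by simp
    ultimately show ?thesis by (simp add: N_neg)
  qed
  have "N x \<le> 2 * real K / r * norm x" for x
  proof (cases "x = 0")
    case False
    have "N ((r / norm x) *\<^sub>R x) \<le> 2 * real K" by (rule small) (use False r in simp)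
    then have "r / norm x * N x \<le> 2 * real K" unfolding hom using r by simp
    then show ?thesis using False r by (simp add: field_simps)
  qed (simp add: N0)
  then show ?thesis using r by (intro exI[of _ "2 * real K / r"]) auto
qed

lemma summable_on_product_nonneg:
  fixes f :: "'i \<Rightarrow> real" and g :: "'j \<Rightarrow> real"
  assumes f: "f summable_on UNIV" "\<And>i. f i \<ge> 0" and g: "g summable_on UNIV" "\<And>j. g j \<ge> 0"
  shows "(\<lambda>(i, j). f i * g j) summable_on UNIV"
proof (rule nonneg_bdd_above_summable_on)
  show "bdd_above (sum (\<lambda>(i, j). f i * g j) ` {F. F \<subseteq> UNIV \<and> finite F})"
  proof (rule bdd_aboveI2)
    fix F :: "('i \<times> 'j) set" assume "F \<in> {F. F \<subseteq> UNIV \<and> finite F}"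
    then have F: "finite F" by simp
    have "sum (\<lambda>(i, j). f i * g j) F \<le> sum (\<lambda>(i, j). f i * g j) (fst ` F \<times> snd ` F)"
      using F f g by (intro sum_mono2) (auto simp: image_iff, force+)
    also have "\<dots> = sum f (fst ` F) * sum g (snd ` F)"
      by (simp add: sum_product sum.cartesian_product)
    also have "\<dots> \<le> infsum f UNIV * infsum g UNIV"
      using F f g by (intro mult_mono finite_sum_le_infsum sum_nonneg infsum_nonneg) auto
    finally show "sum (\<lambda>(i, j). f i * g j) F \<le> infsum f UNIV * infsum g UNIV" .
  qed
qed (use f g in auto)

lemma summable_on_inj:
  fixes f :: "'j \<Rightarrow> real"
  assumes "f summable_on UNIV" "inj_on h A"
  shows "(\<lambda>i. f (h i)) summable_on A"
proof -
  have "f summable_on h ` A" by (rule summable_on_subset_banach[OF assms(1)]) simp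
  then show ?thesis by (subst (asm) summable_on_reindex[OF assms(2)]) (simp add: o_def)
qed

locale perturbation = L2_setting \<omega> cls
  for \<omega> :: real and cls :: "(real \<Rightarrow> 'h::complex_hilbert) \<Rightarrow> 'e::complex_hilbert" +
  fixes \<V> :: "real \<Rightarrow> 'h \<Rightarrow>\<^sub>L 'h"
  assumes V_values: "\<And>s. s \<in> {0..\<omega>} \<Longrightarrow> \<V> s \<in> complex_operators"
    and V_L2: "\<And>x. (\<lambda>s. \<V> s x) \<in> L2_functions \<omega>"
begin

definition V_cls :: "'h \<Rightarrow> 'e" where
  "V_cls x = cls (\<lambda>s. \<V> s x)"

lemma V_cls_add: "V_cls (x + y) = V_cls x + V_cls y"
  unfolding V_cls_def by (simp add: cls_add[OF V_L2 V_L2, symmetric] blinfun.add_right)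

lemma V_cls_scaleC: "V_cls (c *\<^sub>C x) = c *\<^sub>C V_cls x"
proof -
  have "V_cls (c *\<^sub>C x) = cls (\<lambda>s. c *\<^sub>C \<V> s x)"
    unfolding V_cls_def
    by (rule cls_cong_AE[OF L2_scaleC[OF V_L2]]) (rule AE_I2, simp add: complex_operatorsD[OF V_values])
  then show ?thesis by (simp add: cls_scaleC[OF V_L2] V_cls_def)
qed

text \<open>Pointwise convergence \<open>\<V> s (x n) \<longlonglongrightarrow> \<V> s l\<close>
  holds at every \<open>s\<close> because \<open>\<V> s\<close> is bounded, so by Fatou's lemma the
  sublevel sets of \<open>norm (V_cls x)\<close> are closed.\<close>

lemma V_cls_bounded: "\<exists>C\<ge>0. \<forall>x. norm (V_cls x) \<le> C * norm x"
proof (rule pointwise_bounded_imp_bounded)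
  show "norm (V_cls (x + y)) \<le> norm (V_cls x) + norm (V_cls y)" for x y
    by (simp add: V_cls_add norm_triangle_ineq)
  show "norm (V_cls (r *\<^sub>R x)) = \<bar>r\<bar> * norm (V_cls x)" for r x
    by (simp add: scaleR_scaleC[of r x] V_cls_scaleC norm_scaleC)
  fix K :: nat
  show "closed {x. norm (V_cls x) \<le> real K}"
    unfolding closed_sequential_limits
  proof (intro allI impI, elim conjE)
    fix x :: "nat \<Rightarrow> 'h" and l
    assume x: "\<forall>n. x n \<in> {x. norm (V_cls x) \<le> real K}" and lim: "x \<longlonglongrightarrow> l"
    have "ennreal (\<omega> * (norm (V_cls l))\<^sup>2) \<le> ennreal (\<omega> * (real K)\<^sup>2)"
      unfolding V_cls_def nn_integral_norm_cls[OF V_L2, symmetric]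
    proof (rule L2_fatou[OF V_L2])
      show "AE s in M. (\<lambda>n. \<V> s (x n)) \<longlonglongrightarrow> \<V> s l"
        by (rule AE_I2, rule blinfun.tendsto[OF tendsto_const lim])
      show "\<forall>\<^sub>F n in sequentially. norm (cls (\<lambda>s. \<V> s (x n))) \<le> real K"
        using x by (intro always_eventually allI) (simp add: V_cls_def)
    qed
    then have "\<omega> * (norm (V_cls l))\<^sup>2 \<le> \<omega> * (real K)\<^sup>2"
      using \<omega>_pos by (subst (asm) ennreal_le_iff) auto
    then have "(norm (V_cls l))\<^sup>2 \<le> (real K)\<^sup>2" using \<omega>_pos by simp
    then have "norm (V_cls l) \<le> real K" by (rule power2_le_imp_le) simp
    then show "l \<in> {x. norm (V_cls x) \<le> real K}" by (rule CollectI)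
  qed
qed

lemma bounded_linear_V_cls: "bounded_linear V_cls"
proof -
  obtain C where C: "\<And>x. norm (V_cls x) \<le> C * norm x" using V_cls_bounded by blast
  show ?thesis
  proof (rule bounded_linear_intro)
    show "norm (V_cls x) \<le> norm x * C" for x using C[of x] by (simp add: mult.commute)
    show "V_cls (r *\<^sub>R x) = r *\<^sub>R V_cls x" for r x
      by (simp add: scaleR_scaleC[of r x] scaleR_scaleC[of r "V_cls x"] V_cls_scaleC)
  qed (rule V_cls_add)
qed

abbreviation Vhat :: "int \<Rightarrow> 'h \<Rightarrow>\<^sub>L 'h" where
  "Vhat \<equiv> op_fourier_coeff \<omega> \<V>"

lemma Vhat_apply: "Vhat n x = coef n (V_cls x)"
proof -
  have eq: "fourier_coeff \<omega> (\<lambda>s. \<V> s x) n = coef n (V_cls x)" for x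
    by (simp add: fourier_coeff_eq_coef[OF V_L2] V_cls_def)
  have "bounded_linear (\<lambda>x. coef n (V_cls x))"
    by (rule bounded_linear_compose[OF bounded_linear_coef bounded_linear_V_cls])
  then show ?thesis by (simp add: op_fourier_coeff_def eq bounded_linear_Blinfun_apply)
qed

lemma Vhat_complex: "Vhat n \<in> complex_operators"
  by (simp add: complex_operators_def Vhat_apply V_cls_scaleC coef_scaleC)

lemma coef_cls_ex:
  assumes f: "f \<in> L2" shows "coef j (cls (\<lambda>s. ex n s *\<^sub>C f s)) = coef (j - n) (cls f)"
proof (rule cinner_eqI)
  fix h
  have "cinner (ex n s *\<^sub>C f s) (ex j s *\<^sub>C h) = cinner (f s) (ex (j - n) s *\<^sub>C h)" for s
    by (simp add: cinner_scaleC_left cinner_scaleC_right cnj_ex mult.assoc[symmetric] ex_mult)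
  then show "cinner (coef j (cls (\<lambda>s. ex n s *\<^sub>C f s))) h = cinner (coef (j - n) (cls f)) h"
    by (simp add: cinner_coef emb_def cinner_cls[OF ex_L2[OF f] ex_const_L2] cinner_cls[OF f ex_const_L2])
qed

text \<open>Expand \<open>y (\<omega> - s)\<close> in its absolutely convergent Fourier series. The
  reflection turns the exponential of index \<open>n\<close> into that of index \<open>-n\<close>, and
  multiplying with the latter shifts the Fourier coefficients of \<open>\<V>\<close> by
  \<open>n\<close>. The series of classes converges absolutely since \<open>V_cls\<close> is
  bounded.\<close>

lemma V_fourier:
  assumes W: "W21_deriv \<omega> y g" and per: "y 0 = y \<omega>"
    and C: "C \<ge> 0" "\<And>x. norm (V_cls x) \<le> C * norm x"
  defines "v \<equiv> cls (\<lambda>s. \<V> s (y (\<omega> - s)))"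
  shows "((\<lambda>n. Vhat (j + n) (coef n (cls y))) has_sum coef j v) UNIV"
    and "norm v \<le> C * (\<Sum>\<^sub>\<infinity>n. norm (P n (cls y)))"
proof -
  define f where "f n s = ex (- n) s *\<^sub>C \<V> s (coef n (cls y))" for n s
  have fL2: "f n \<in> L2" for n unfolding f_def by (rule ex_L2[OF V_L2])
  have abs: "(\<lambda>n. norm (coef n (cls y))) summable_on UNIV"
    by (rule abs_summable_coef[OF W21_periodic(2)[OF W per]])
  have cf: "coef j (cls (f n)) = Vhat (j + n) (coef n (cls y))" for j n
    unfolding f_def coef_cls_ex[OF V_L2] by (simp add: Vhat_apply V_cls_def)
  have nf: "norm (cls (f n)) \<le> C * norm (coef n (cls y))" for n
  proof -
    have "norm (ex (- n) s *\<^sub>C \<V> s (coef n (cls y))) = norm (\<V> s (coef n (cls y)))" for s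
      by (simp add: norm_scaleC)
    then have "\<omega> * (norm (cls (f n)))\<^sup>2 = \<omega> * (norm (V_cls (coef n (cls y))))\<^sup>2"
      unfolding norm_cls[OF fL2] V_cls_def norm_cls[OF V_L2] by (simp add: f_def)
    then have "norm (cls (f n)) = norm (V_cls (coef n (cls y)))" using \<omega>_pos by simp
    then show ?thesis using C(2) by simp
  qed
  have abs_f: "(\<lambda>n. norm (cls (f n))) summable_on UNIV"
    by (rule summable_on_comparison_test[OF summable_on_cmult_right[OF abs] nf]) simp
  have sums: "((\<lambda>n. f n s) has_sum \<V> s (y (\<omega> - s))) UNIV" if s: "s \<in> {0..\<omega>}" for s
  proof -
    have "((\<lambda>n. ex n (\<omega> - s) *\<^sub>C coef n (cls y)) has_sum y (\<omega> - s)) UNIV"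
      by (rule W21_periodic(3)[OF W per]) (use s in auto)
    from has_sum_bounded_linear[OF blinfun.bounded_linear_right[of "\<V> s"] this] show ?thesis
      by (simp add: f_def ex_reflect complex_operatorsD[OF V_values[OF s]])
  qed
  have v: "((\<lambda>n. cls (f n)) has_sum v) UNIV"
    unfolding v_def by (rule cls_has_sum(2)[OF fL2 abs_f sums])
  from has_sum_bounded_linear[OF bounded_linear_coef this]
  show "((\<lambda>n. Vhat (j + n) (coef n (cls y))) has_sum coef j v) UNIV" by (simp add: cf)
  have "norm v \<le> (\<Sum>\<^sub>\<infinity>n. norm (cls (f n)))"
    using norm_infsum_bound[OF abs_f] infsumI[OF v] by simp
  also have "\<dots> \<le> (\<Sum>\<^sub>\<infinity>n. C * norm (coef n (cls y)))"
    by (rule infsum_mono[OF abs_f summable_on_cmult_right[OF abs] nf])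
  also have "\<dots> = C * (\<Sum>\<^sub>\<infinity>n. norm (P n (cls y)))"
    by (simp add: norm_P infsum_cmult_right')
  finally show "norm v \<le> C * (\<Sum>\<^sub>\<infinity>n. norm (P n (cls y)))" .
qed

end

section \<open>The matrix of the perturbation\<close>

locale summable_perturbation = perturbation \<omega> cls \<V>
  for \<omega> :: real and cls :: "(real \<Rightarrow> 'h::complex_hilbert) \<Rightarrow> 'e::complex_hilbert" and \<V> +
  assumes V_coeff_summable: "(\<lambda>n. (norm (Vhat n))\<^sup>2) summable_on UNIV"
begin

definition Vblock :: "int \<Rightarrow> int \<Rightarrow> 'e \<Rightarrow>\<^sub>L 'e" where
  "Vblock j n = Blinfun (\<lambda>x. emb j (Vhat (j + n) (coef n x)))"

lemma Vblock_apply: "Vblock j n x = emb j (Vhat (j + n) (coef n x))"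
proof -
  have "bounded_linear (\<lambda>x. emb j (Vhat (j + n) (coef n x)))"
    by (intro bounded_linear_compose[OF bounded_linear_emb] bounded_linear_compose[OF blinfun.bounded_linear_right]
        bounded_linear_coef)
  then show ?thesis by (simp add: Vblock_def bounded_linear_Blinfun_apply)
qed

lemma norm_Vblock_le: "norm (Vblock j n) \<le> norm (Vhat (j + n))"
proof (rule norm_blinfun_bound)
  fix x
  have "norm (Vhat (j + n) (coef n x)) \<le> norm (Vhat (j + n)) * norm (coef n x)" by (rule norm_blinfun)
  also have "\<dots> \<le> norm (Vhat (j + n)) * norm x" by (intro mult_left_mono norm_coef_le) simp
  finally show "norm (Vblock j n x) \<le> norm (Vhat (j + n)) * norm x" by (simp add: Vblock_apply norm_emb)
qed simp

lemma Vblock_complex: "Vblock j n \<in> complex_operators"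
  by (simp add: complex_operators_def Vblock_apply coef_scaleC complex_operatorsD[OF Vhat_complex] emb_scaleC)

lemma is_block_Vblock: "F.is_block j n (Vblock j n)"
  unfolding F.is_block_def
  by (auto intro!: blinfun_eqI simp: Vblock_apply fourier_proj_apply coef_emb)

definition Vrow :: "int \<Rightarrow> 'e \<Rightarrow>\<^sub>L 'e" where
  "Vrow j = (\<Sum>\<^sub>\<infinity>(i, n)\<in>{j} \<times> UNIV. Vblock i n)"

text \<open>The row of index \<open>j\<close> is a bounded operator because its entries have square
  summable norms, although the whole matrix need not be bounded.\<close>

lemma Vrow:
  shows block_Vrow: "F.block i (Vrow j) n = (if i = j then Vblock j n else 0)"
    and Vrow_complex: "Vrow j \<in> complex_operators"
proof -
  have row: "(\<lambda>n. (norm (Vhat (j + n)))\<^sup>2) summable_on UNIV"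
    by (rule summable_on_inj[OF V_coeff_summable]) (simp add: inj_on_def)
  have row': "(\<lambda>n. (norm (Vblock j n))\<^sup>2) summable_on UNIV"
    by (rule summable_on_comparison_test[OF row]) (auto intro: power_mono norm_Vblock_le)
  have eq: "range (Pair j) = {j} \<times> UNIV" by auto
  have "(\<lambda>i. (norm ((\<lambda>(i, n). Vblock i n) i))\<^sup>2) summable_on range (Pair j)"
    by (subst summable_on_reindex) (use row' in \<open>auto simp: inj_on_def o_def\<close>)
  then have s: "(\<lambda>(i, n). Vblock i n) summable_on {j} \<times> UNIV"
    unfolding eq by (rule F.summable_blocks) (auto intro: is_block_Vblock)
  show "F.block i (Vrow j) n = (if i = j then Vblock j n else 0)"
    unfolding Vrow_def by (subst F.block_infsum[OF s]) (auto intro: is_block_Vblock)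
  show "Vrow j \<in> complex_operators"
    unfolding Vrow_def by (rule complex_operators_infsum[OF s]) (auto intro: Vblock_complex)
qed

lemma P_Vrow: "P j o\<^sub>L Vrow j = Vrow j"
proof (rule F.block_eqI)
  fix i n
  have "F.block i (P j o\<^sub>L Vrow j) n = (if i = j then F.block i (Vrow j) n else 0)"
    by (rule blinfun_eqI) (simp add: F.block_apply F.P_P)
  then show "F.block i (P j o\<^sub>L Vrow j) n = F.block i (Vrow j) n" by (simp add: block_Vrow)
qed

lemma Vrow_P: "Vrow j o\<^sub>L P n = Vblock j n"
proof -
  have "Vrow j o\<^sub>L P n = F.block j (Vrow j) n"
    unfolding F.block_def P_Vrow ..
  then show ?thesis by (simp add: block_Vrow)
qed

lemma Vrow_has_sum: "((\<lambda>n. emb j (Vhat (j + n) (coef n x))) has_sum Vrow j x) UNIV"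
proof -
  have "((\<lambda>n. Vrow j (P n x)) has_sum Vrow j x) UNIV"
    by (intro has_sum_bounded_linear[OF blinfun.bounded_linear_right] F.P_has_sum)
  moreover have "Vrow j (P n x) = emb j (Vhat (j + n) (coef n x))" for n
    using arg_cong[OF Vrow_P[of j n], of "\<lambda>A. A x"] by (simp add: Vblock_apply)
  ultimately show ?thesis by simp
qed

text \<open>Coordinates determine a vector, so on the domain of \<open>L\<^sub>0\<close> the graph of
  \<open>V\<close> is described by the rows of its matrix.\<close>

lemma op_V_iff:
  assumes xu: "(x, u) \<in> F.G0"
  shows "(x, v) \<in> op_V cls \<omega> \<V> \<longleftrightarrow> (\<forall>j. P j v = Vrow j x)"
    and "\<exists>v. (x, v) \<in> op_V cls \<omega> \<V>"
proof -
  have P_V: "P j (cls (\<lambda>s. \<V> s (y (\<omega> - s)))) = Vrow j (cls y)"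
    if W: "W21_deriv \<omega> y g" and per: "y 0 = y \<omega>" for j y g
  proof -
    obtain C where C: "C \<ge> 0" "\<And>x. norm (V_cls x) \<le> C * norm x" using V_cls_bounded by blast
    from has_sum_bounded_linear[OF bounded_linear_emb V_fourier(1)[OF W per C]]
    show ?thesis using has_sum_unique[OF _ Vrow_has_sum] by (simp add: fourier_proj_apply)
  qed
  obtain g where g: "g \<in> L2" "cls g = u" "W21_deriv \<omega> (fourier_series x) g"
    using G0_W21[OF xu] by blast
  let ?y = "fourier_series x"
  have ex: "(x, cls (\<lambda>s. \<V> s (?y (\<omega> - s)))) \<in> op_V cls \<omega> \<V>"
    unfolding op_V_def mem_Collect_eq
    by (intro exI[of _ ?y] conjI exI[of _ g] g(3) fourier_series_periodic[OF xu, symmetric])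
       (simp only: cls_fourier_series[OF xu])
  then show "\<exists>v. (x, v) \<in> op_V cls \<omega> \<V>" by blast
  show "(x, v) \<in> op_V cls \<omega> \<V> \<longleftrightarrow> (\<forall>j. P j v = Vrow j x)"
  proof
    assume "(x, v) \<in> op_V cls \<omega> \<V>"
    then show "\<forall>j. P j v = Vrow j x" unfolding op_V_def using P_V by auto
  next
    assume v: "\<forall>j. P j v = Vrow j x"
    have "cls (\<lambda>s. \<V> s (?y (\<omega> - s))) = v"
      by (rule F.vector_eqI)
         (use v P_V[OF g(3) fourier_series_periodic[OF xu, symmetric]] cls_fourier_series[OF xu] in simp)
    with ex show "(x, v) \<in> op_V cls \<omega> \<V>" by simp
  qed
qed

lemma V_relatively_bounded:
  "\<exists>C\<ge>0. \<forall>x u. (x, u) \<in> F.G0 \<longrightarrow> (\<exists>v. (\<forall>j. P j v = Vrow j x) \<and> norm v \<le> C * (\<Sum>\<^sub>\<infinity>n. norm (P n x)))"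
proof -
  obtain C where C: "C \<ge> 0" "\<And>x. norm (V_cls x) \<le> C * norm x" using V_cls_bounded by blast
  have "\<exists>v. (\<forall>j. P j v = Vrow j x) \<and> norm v \<le> C * (\<Sum>\<^sub>\<infinity>n. norm (P n x))" if xu: "(x, u) \<in> F.G0" for x u
  proof -
    obtain v where v: "(x, v) \<in> op_V cls \<omega> \<V>" using op_V_iff(2)[OF xu] by blast
    then obtain y g where y: "x = cls y" "v = cls (\<lambda>s. \<V> s (y (\<omega> - s)))" "W21_deriv \<omega> y g" "y 0 = y \<omega>"
      unfolding op_V_def by auto
    have "norm v \<le> C * (\<Sum>\<^sub>\<infinity>n. norm (P n x))" unfolding y(1,2) by (rule V_fourier(2)[OF y(3,4) C])
    then show ?thesis using op_V_iff(1)[OF xu] v by blast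
  qed
  with C(1) show ?thesis by blast
qed

lemma op_L_eq: "op_L cls \<omega> \<V> = {(x, u - v) | x u v. (x, u) \<in> F.G0 \<and> (\<forall>j. P j v = Vrow j x)}"
  unfolding op_L_def op_L0_eq using op_V_iff(1) by fastforce

text \<open>The entries depend on \<open>j + l\<close> only and the divisors on \<open>j - l\<close>
  only; in these variables the family is dominated by a product of two summable ones.\<close>

lemma Vblock_off_diagonal_summable:
  "(\<lambda>(j, l). (norm (Vrow j o\<^sub>L P l) / of_int (j - l))\<^sup>2) summable_on {(j, l). j \<noteq> l}"
proof -
  let ?c = "2 * pi / \<omega>"
  \<comment> \<open>A summable majorant of \<open>1 / d\<^sup>2\<close> off \<open>0\<close> that is defined for all \<open>d\<close>.\<close>
  define g where "g d = (?c\<^sup>2 + 1) * (1 / (?c\<^sup>2 * (of_int d)\<^sup>2 + 1 :: real))" for d :: int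
  have gs: "g summable_on UNIV" unfolding g_def by (intro summable_on_cmult_right F.summable_inverse_square)
  have g0: "g d \<ge> 0" for d unfolding g_def by simp
  have inv_le: "1 / (of_int d)\<^sup>2 \<le> g d" if "d \<noteq> 0" for d
  proof -
    have "1 \<le> \<bar>of_int d :: real\<bar>" using that by linarith
    then have "1 \<le> (of_int d :: real)\<^sup>2" by (simp add: abs_le_square_iff[of 1, simplified])
    then have "?c\<^sup>2 * (of_int d)\<^sup>2 + 1 \<le> (?c\<^sup>2 + 1) * (of_int d :: real)\<^sup>2" by (simp add: distrib_right)
    moreover have "?c\<^sup>2 * (of_int d)\<^sup>2 + 1 > (0::real)" by (simp add: add_nonneg_pos)
    moreover have "(of_int d :: real)\<^sup>2 > 0" using that by simp
    ultimately show ?thesis unfolding g_def by (simp add: divide_le_eq pos_divide_le_eq pos_le_divide_eq)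
  qed
  have prod: "(\<lambda>(m, d). (norm (Vhat m))\<^sup>2 * g d) summable_on UNIV"
    by (rule summable_on_product_nonneg[OF V_coeff_summable _ gs g0]) simp
  have inj: "inj_on (\<lambda>(j, l). (j + l, j - l)) {(j, l). j \<noteq> (l::int)}"
    by (auto simp: inj_on_def)
  have "(\<lambda>i. (\<lambda>(m, d). (norm (Vhat m))\<^sup>2 * g d) ((\<lambda>(j, l). (j + l, j - l)) i)) summable_on {(j, l). j \<noteq> l}"
    by (rule summable_on_inj[OF prod inj])
  then show ?thesis
  proof (rule summable_on_comparison_test)
    fix i :: "int \<times> int" assume "i \<in> {(j, l). j \<noteq> l}"
    then obtain j l where i: "i = (j, l)" "j - l \<noteq> 0" by auto
    have "(norm (Vblock j l) / of_int (j - l))\<^sup>2 = (norm (Vblock j l))\<^sup>2 * (1 / (of_int (j - l))\<^sup>2)"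
      by (simp add: power_divide)
    also have "\<dots> \<le> (norm (Vhat (j + l)))\<^sup>2 * g (j - l)"
      by (intro mult_mono power_mono norm_Vblock_le inv_le i) auto
    finally show "(case i of (j, l) \<Rightarrow> (norm (Vrow j o\<^sub>L P l) / of_int (j - l))\<^sup>2)
        \<le> (\<lambda>(m, d). (norm (Vhat m))\<^sup>2 * g d) ((\<lambda>(j, l). (j + l, j - l)) i)"
      by (simp add: i Vrow_P)
  qed auto
qed

lemma Vblock_diagonal_summable: "(\<lambda>j. (norm (Vrow j o\<^sub>L P j))\<^sup>2) summable_on UNIV"
proof -
  have "(\<lambda>j. (norm (Vhat (j + j)))\<^sup>2) summable_on UNIV"
    by (rule summable_on_inj[OF V_coeff_summable]) (simp add: inj_on_def)
  then show ?thesis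
  proof (rule summable_on_comparison_test)
    show "(norm (Vrow j o\<^sub>L P j))\<^sup>2 \<le> (norm (Vhat (j + j)))\<^sup>2" for j
      unfolding Vrow_P by (intro power_mono norm_Vblock_le norm_ge_zero)
  qed simp
qed

lemma Vblock_column_summable: "(\<lambda>j. (norm (Vrow j o\<^sub>L P l))\<^sup>2) summable_on UNIV"
proof -
  have "(\<lambda>j. (norm (Vhat (j + l)))\<^sup>2) summable_on UNIV"
    by (rule summable_on_inj[OF V_coeff_summable]) (simp add: inj_on_def)
  then show ?thesis
    by (rule summable_on_comparison_test) (auto simp: Vrow_P intro: power_mono norm_Vblock_le)
qed

text \<open>The entry \<open>(j, l)\<close> of the product of \<open>V\<close> and
  \<open>\<Gamma> V\<close> is, up to the constant factor \<open>z\<close>, the sum in the second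
  hypothesis on the Fourier coefficients. The product of two Hankel matrices involves
  \<open>j + n\<close> and \<open>n + l\<close>, and the frequency difference \<open>n - l\<close>
  has the opposite sign of the divisor \<open>l - n\<close>.\<close>

lemma norm_Vrow_Gamma_le:
  assumes G: "\<And>j l. F.block j G l =
      (if j = l then 0 else scalar_op (1 / (F.freq j - F.freq l)) o\<^sub>L (Vrow j o\<^sub>L P l))"
  shows "norm (Vrow j o\<^sub>L G o\<^sub>L P l) \<le> \<omega> / (2 * pi) *
    norm (\<Sum>\<^sub>\<infinity>n\<in>{n. n \<noteq> l}. (Vhat (j + n) o\<^sub>L Vhat (l + n)) /\<^sub>R of_int (l - n))"
proof -
  let ?c = "2 * pi / \<omega>"
  let ?k = "\<lambda>n. (Vhat (j + n) o\<^sub>L Vhat (l + n)) /\<^sub>R of_int (l - n)"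
  define K where "K = infsum ?k {n. n \<noteq> l}"
  define z where "z = - 1 / (\<i> * complex_of_real ?c)"
  have cpos: "?c > 0" using \<omega>_pos by simp
  have kz: "cmod z = \<omega> / (2 * pi)" using \<omega>_pos by (simp add: z_def norm_divide norm_mult)
  have ks: "?k summable_on {n. n \<noteq> l}"
  proof (rule abs_summable_summable, rule summable_on_comparison_test)
    show "(\<lambda>n. (norm (Vhat (j + n)))\<^sup>2 + (norm (Vhat (l + n)))\<^sup>2) summable_on {n. n \<noteq> l}"
      by (intro summable_on_add summable_on_inj[OF V_coeff_summable]) (simp_all add: inj_on_def)
    fix n assume "n \<in> {n. n \<noteq> l}"
    then have "1 \<le> \<bar>of_int (l - n) :: real\<bar>" by simp
    then have "\<bar>inverse (of_int (l - n) :: real)\<bar> \<le> 1" by (simp add: inverse_le_1_iff)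
    then have "norm (?k n) \<le> 1 * norm (Vhat (j + n) o\<^sub>L Vhat (l + n))"
      unfolding norm_scaleR by (rule mult_right_mono) simp
    also have "\<dots> \<le> norm (Vhat (j + n)) * norm (Vhat (l + n))" by (simp add: norm_blinfun_compose)
    also have "\<dots> \<le> (norm (Vhat (j + n)))\<^sup>2 + (norm (Vhat (l + n)))\<^sup>2"
    proof -
      have "2 * (norm (Vhat (j + n)) * norm (Vhat (l + n))) \<le> (norm (Vhat (j + n)))\<^sup>2 + (norm (Vhat (l + n)))\<^sup>2"
        using sum_squares_bound[of "norm (Vhat (j + n))" "norm (Vhat (l + n))"] by (simp add: mult.assoc)
      moreover have "0 \<le> norm (Vhat (j + n)) * norm (Vhat (l + n))" by simp
      ultimately show ?thesis by linarith
    qed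
    finally show "norm (?k n) \<le> (norm (Vhat (j + n)))\<^sup>2 + (norm (Vhat (l + n)))\<^sup>2" .
  qed simp
  have apply_eq: "(Vrow j o\<^sub>L G o\<^sub>L P l) x = z *\<^sub>C emb j (K (coef l x))" for x
  proof -
    have "((\<lambda>n. Vrow j (P n (G (P l x)))) has_sum Vrow j (G (P l x))) UNIV"
      by (intro has_sum_bounded_linear[OF blinfun.bounded_linear_right] F.P_has_sum)
    moreover have "((\<lambda>n. Vrow j (P n (G (P l x)))) has_sum z *\<^sub>C emb j (K (coef l x))) UNIV"
    proof (rule has_sum_cong_neutral[where S = "{n. n \<noteq> l}" and T = UNIV, THEN iffD1, rotated -1])
      have "(?k has_sum K) {n. n \<noteq> l}" unfolding K_def using ks by simp
      from has_sum_bounded_linear[OF scaleC.bounded_linear_right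
          has_sum_bounded_linear[OF bounded_linear_emb has_sum_bounded_linear[OF blinfun.bounded_linear_left this]]]
      show "((\<lambda>n. z *\<^sub>C emb j (?k n (coef l x))) has_sum z *\<^sub>C emb j (K (coef l x))) {n. n \<noteq> l}" .
      have block: "P n (G (P l x)) = (if n = l then 0 else (1 / (F.freq n - F.freq l)) *\<^sub>C emb n (Vhat (n + l) (coef l x)))" for n
        using arg_cong[OF G[of n l], of "\<lambda>A. A x"] by (simp add: F.block_apply Vrow_P Vblock_apply)
      show "Vrow j (P n (G (P l x))) = 0" if "n \<in> UNIV - {n. n \<noteq> l}" for n
        using that by (simp add: block)
      fix n assume "n \<in> {n. n \<noteq> l} \<inter> UNIV"
      then have n: "n \<noteq> l" by simp
      have Ve: "Vrow j (emb n h) = emb j (Vhat (j + n) h)" for h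
        using arg_cong[OF Vrow_P[of j n], of "\<lambda>A. A (emb n h)"]
        by (simp add: Vblock_apply fourier_proj_apply coef_emb)
      have s: "1 / (F.freq n - F.freq l) = z * complex_of_real (inverse (of_int (l - n)))"
      proof -
        have "F.freq n - F.freq l = \<i> * complex_of_real ?c * complex_of_real (of_int (n - l))"
          unfolding F.freq_def of_real_mult of_int_diff of_real_diff by (simp only: right_diff_distrib mult.assoc)
        then have "1 / (F.freq n - F.freq l) = 1 / (\<i> * complex_of_real ?c) * (1 / complex_of_real (of_int (n - l)))"
          by simp
        also have "1 / complex_of_real (of_int (n - l)) = - complex_of_real (inverse (of_int (l - n)))"
        proof -
          have "(of_int (n - l) :: real) = - of_int (l - n)" by simp
          then show ?thesis
            by (simp only: of_real_minus of_real_inverse divide_inverse inverse_minus_eq mult_1_left)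
        qed
        finally show ?thesis by (simp add: z_def)
      qed
      have "Vrow j (P n (G (P l x))) = (1 / (F.freq n - F.freq l)) *\<^sub>C emb j (Vhat (j + n) (Vhat (n + l) (coef l x)))"
        using n by (simp add: block complex_operatorsD[OF Vrow_complex] Ve)
      also have "\<dots> = z *\<^sub>C emb j (?k n (coef l x))"
        unfolding s
        by (simp only: blinfun.scaleR_left scaleR_scaleC emb_scaleC scaleC_scaleC blinfun_apply_blinfun_compose add.commute[of l n])
      finally show "z *\<^sub>C emb j (?k n (coef l x)) = Vrow j (P n (G (P l x)))" by (rule sym)
    qed simp
    ultimately show ?thesis using has_sum_unique by simp
  qed
  have "norm (Vrow j o\<^sub>L G o\<^sub>L P l) \<le> \<omega> / (2 * pi) * norm K"
  proof (rule norm_blinfun_bound)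
    fix x
    have "norm (K (coef l x)) \<le> norm K * norm x"
      using norm_blinfun[of K "coef l x"] mult_left_mono[OF norm_coef_le[of l x], of "norm K"] by simp
    then have "\<omega> / (2 * pi) * norm (K (coef l x)) \<le> \<omega> / (2 * pi) * (norm K * norm x)"
      using \<omega>_pos by (intro mult_left_mono) auto
    then show "norm ((Vrow j o\<^sub>L G o\<^sub>L P l) x) \<le> \<omega> / (2 * pi) * norm K * norm x"
      unfolding apply_eq norm_scaleC kz norm_emb by (simp only: mult.assoc)
  qed (use \<omega>_pos in simp)
  then show ?thesis by (simp only: K_def)
qed

end

section \<open>The group generated by the perturbed derivative\<close>

theorem theorem2p10:
  fixes \<omega> :: real
    and cls :: "(real \<Rightarrow> 'h::complex_hilbert) \<Rightarrow> 'e::complex_hilbert"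
    and \<V> :: "real \<Rightarrow> 'h \<Rightarrow>\<^sub>L 'h"
  assumes omega_pos: "\<omega> > 0"
    and L2_space: "is_L2_space \<omega> cls"
    and V_values: "\<forall>s\<in>{0..\<omega>}. \<V> s \<in> complex_operators"
    and V_measurable: "\<forall>x. strongly_measurable (lebesgue_on {0..\<omega>}) (\<lambda>s. \<V> s x)"
    and V_L2: "\<forall>x. (\<lambda>s. \<V> s x) \<in> L2_functions \<omega>"
    and V_coeff_summable:
      "(\<lambda>n. (norm (op_fourier_coeff \<omega> \<V> n))\<^sup>2) summable_on (UNIV :: int set)"
    and V_product_summable:
      "(\<lambda>(j, l). (norm (\<Sum>\<^sub>\<infinity>n\<in>{n. n \<noteq> l}.
           (op_fourier_coeff \<omega> \<V> (j + n) o\<^sub>L op_fourier_coeff \<omega> \<V> (l + n)) /\<^sub>R of_int (l - n)))\<^sup>2)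
         summable_on (UNIV :: (int \<times> int) set)"
  shows "\<exists>T. C0_group T \<and> generator T = op_L cls \<omega> \<V> \<and>
    (\<exists>(k::nat) U U' W B\<^sub>k B.
       U \<in> complex_operators \<and> U' \<in> complex_operators \<and>
       U o\<^sub>L U' = id_blinfun \<and> U' o\<^sub>L U = id_blinfun \<and>
       U = id_blinfun + W \<and> W \<in> S2_class cls \<omega> \<and>
       B\<^sub>k \<in> complex_operators_on (range (fourier_proj_upto cls \<omega> k)) \<and>
       (\<forall>l. \<bar>l\<bar> > int k \<longrightarrow> B l \<in> complex_operators_on (range (fourier_proj cls \<omega> l))) \<and>
       (\<lambda>l. (onorm_on (range (fourier_proj cls \<omega> l)) (B l))\<^sup>2) summable_on {l. \<bar>l\<bar> > int k} \<and>
       (\<forall>t. is_orthogonal_direct_sum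
          (insert None (Some ` {l. \<bar>l\<bar> > int k}))
          (case_option (range (fourier_proj_upto cls \<omega> k)) (\<lambda>l. range (fourier_proj cls \<omega> l)))
          (case_option
             (op_exp (\<lambda>x. t *\<^sub>R B\<^sub>k x))
             (\<lambda>l. op_exp (\<lambda>x. t *\<^sub>R ((\<i> * of_real (2 * pi * of_int l / \<omega>)) *\<^sub>C x + B l x))))
          (U' o\<^sub>L T t o\<^sub>L U)))"
proof -
  interpret summable_perturbation \<omega> cls \<V>
    by unfold_locales (use assms in auto)
  obtain C where C: "C \<ge> 0"
    "\<And>x u. (x, u) \<in> F.G0 \<Longrightarrow> \<exists>v. (\<forall>j. P j v = Vrow j x) \<and> norm v \<le> C * (\<Sum>\<^sub>\<infinity>n. norm (P n x))"
    using V_relatively_bounded by metis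
  have prod: "(\<lambda>(j, l). (norm (Vrow j o\<^sub>L G o\<^sub>L P l))\<^sup>2) summable_on UNIV"
    if "\<And>j l. F.block j G l = (if j = l then 0 else scalar_op (1 / (F.freq j - F.freq l)) o\<^sub>L (Vrow j o\<^sub>L P l))" for G
  proof (rule summable_on_comparison_test[OF summable_on_cmult_right[OF V_product_summable, of "(\<omega> / (2 * pi))\<^sup>2"]])
    fix i :: "int \<times> int"
    obtain j l where i: "i = (j, l)" by (cases i)
    from power_mono[OF norm_Vrow_Gamma_le[OF that] norm_ge_zero, of j l 2]
    show "(case i of (j, l) \<Rightarrow> (norm (Vrow j o\<^sub>L G o\<^sub>L P l))\<^sup>2) \<le> (\<omega> / (2 * pi))\<^sup>2 *
        (case i of (j, l) \<Rightarrow> (norm (\<Sum>\<^sub>\<infinity>n\<in>{n. n \<noteq> l}. (Vhat (j + n) o\<^sub>L Vhat (l + n)) /\<^sub>R of_int (l - n)))\<^sup>2)"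
      by (simp only: i prod.case power_mult_distrib)
  qed auto
  have freq: "F.freq l = \<i> * complex_of_real (2 * pi * of_int l / \<omega>)" for l
    by (simp add: F.freq_def)
  have upto: "F.P_upto k = fourier_proj_upto cls \<omega> k" for k
    by (simp add: F.P_upto_def fourier_proj_upto_def)
  have hs_S2: "W \<in> S2_class cls \<omega>" if "F.hs r W" for r W
    using F.hsD(1)[OF that] F.hs_summable[OF that] unfolding S2_class_def F.block_def by simp
  have "\<exists>T. C0_group T \<and> generator T = op_L cls \<omega> \<V> \<and> (\<exists>k U U' W D. F.block_diagonalizes k U U' W D T)"
    unfolding op_L_eq
    by (rule F.perturbed_group_block_diagonalizable[OF Vrow_complex P_Vrow C(2) C(1)
        Vblock_off_diagonal_summable Vblock_diagonal_summable Vblock_column_summable prod])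
  then obtain T k U U' W D where T: "C0_group T" "generator T = op_L cls \<omega> \<V>"
    and "F.block_diagonalizes k U U' W D T"
    by blast
  note U = this(3)[unfolded F.block_diagonalizes_def]
  \<comment> \<open>The bounded operator \<open>D\<close> leaves every block invariant and serves for all of them.\<close>
  show ?thesis
  proof (intro exI conjI)
    show "C0_group T" "generator T = op_L cls \<omega> \<V>" by (fact T)+
    show "U \<in> complex_operators" using U by (elim conjE)
    show "U' \<in> complex_operators" using U by (elim conjE)
    show "U o\<^sub>L U' = id_blinfun" using U by (elim conjE)
    show "U' o\<^sub>L U = id_blinfun" using U by (elim conjE)
    show "U = id_blinfun + W" using U by (elim conjE)
    show "W \<in> S2_class cls \<omega>" using U hs_S2 by (elim conjE exE)
    show "blinfun_apply D \<in> complex_operators_on (range (fourier_proj_upto cls \<omega> k))"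
      using U unfolding upto by (elim conjE)
    show "\<forall>l. \<bar>l\<bar> > int k \<longrightarrow> blinfun_apply D \<in> complex_operators_on (range (P l))"
      using U by (elim conjE)
    show "(\<lambda>l. (onorm_on (range (P l)) (blinfun_apply D))\<^sup>2) summable_on {l. \<bar>l\<bar> > int k}"
      using U by (elim conjE)
    show "\<forall>t. is_orthogonal_direct_sum (insert None (Some ` {l. \<bar>l\<bar> > int k}))
        (case_option (range (fourier_proj_upto cls \<omega> k)) (\<lambda>l. range (P l)))
        (case_option (op_exp (\<lambda>x. t *\<^sub>R blinfun_apply D x))
          (\<lambda>l. op_exp (\<lambda>x. t *\<^sub>R ((\<i> * of_real (2 * pi * of_int l / \<omega>)) *\<^sub>C x + blinfun_apply D x))))
        (U' o\<^sub>L T t o\<^sub>L U)"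
      using U unfolding F.blocks_def F.block_space_def upto freq by (elim conjE)
  qed
qed

end
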